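(* Let $(\varphi^t)_{t\in\mathbb R}$ be a smooth transversely holomorphic partially hyperbolic flow on a smooth compact manifold $M$ with a flow-invariant subcenter foliation $\mathcal F^{\hat c}$. Let $*\in\{s,u,\hat c\}$. Then each leaf of $\mathcal F^*$ is an immersed complex manifold, and for every $t\in\mathbb R$ and $x\in M$ the well-defined map $$\varphi^t|_{\mathcal F^*(x)}:\mathcal F^*(x)\to\mathcal F^*(\varphi^t(x))$$ is holomorphic with respect to these complex structures. Moreover, if $*\in\{s,u\}$ and $E^{\hat c*}:=E^*\oplus E^{\hat c}$ is integrable to a flow-invariant foliation $\mathcal F^{\hat c*}$, then each leaf of $\mathcal F^{\hat c*}$ is an immersed complex manifold, and for every $t\in\mathbb R$ and $x\in M$ the map $\varphi^t|_{\mathcal F^{\hat c*}(x)}:\mathcal F^{\hat c*}(x)\to\mathcal F^{\hat c*}(\varphi^t(x))$ is holomorphic with respect to these complex structures.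
   Context: Manifolds are smooth ($C^\infty$), connected and without boundary. Foliations are continuous foliations with $C^1$ leaves whose tangent spaces form a continuous subbundle of $TM$; flow-invariant means $\varphi^t(\mathcal F(x))=\mathcal F(\varphi^t(x))$ for all $x,t$. A smooth flow $(\varphi^t)$ on a compact manifold $M$, generated by a nowhere vanishing smooth vector field $X$, is partially hyperbolic if there are a $d\varphi^t$-invariant continuous splitting $TM=E^s\oplus E^{\hat c}\oplus\mathbb RX\oplus E^u$, a Riemannian metric, real numbers $\alpha<\alpha'<1<\beta'<\beta$ and $C>0$ such that for all $t\ge0$: $\|d\varphi^t v\|\le C\alpha^t\|v\|$ for $v\in E^s$; $C^{-1}\beta^t\|v\|\le\|d\varphi^tv\|$ for $v\in E^u$; $C^{-1}\alpha'^t\|v\|\le\|d\varphi^tv\|\le C\beta'^t\|v\|$ for $v\in E^{\hat c}$. The distributions $E^s,E^u$ integrate uniquely to flow-invariant foliations $\mathcal F^s,\mathcal F^u$ with $C^\infty$ leaves. A subcenter foliation $\mathcal F^{\hat c}$ is a foliation tangent to $E^{\hat c}$. A smooth flow is transversely holomorphic if its orbit foliation has a smooth foliated atlas whose transverse transition maps are holomorphic maps between open subsets of $\mathbb C^q$, where $\dim M=1+2q$. This induces an almost complex structure $I$ on the normal bundle $TM/\mathbb RX$, hence on $E^s\oplus E^{\hat c}\oplus E^u\cong TM/\mathbb RX$; the complex structures on the leaves are those induced by $I$. *)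

theory Defs
  imports "HOL-Analysis.Analysis"
begin

section \<open>Differentiability classes\<close>

text \<open>Meant for open \<open>S\<close>. \<open>C_on r S f\<close> says that \<open>f\<close> is of class \<open>C^r\<close> on \<open>S\<close>, for
  \<open>r = 0, 1, \<dots>, \<infinity>\<close>.\<close>

primrec Ck_on :: "nat \<Rightarrow> 'v::euclidean_space set \<Rightarrow> ('v \<Rightarrow> 'w::euclidean_space) \<Rightarrow> bool" where
  "Ck_on 0 S f \<longleftrightarrow> continuous_on S f"
| "Ck_on (Suc k) S f \<longleftrightarrow>
     (\<forall>x\<in>S. f differentiable (at x)) \<and> (\<forall>v. Ck_on k S (\<lambda>x. frechet_derivative f (at x) v))"

definition C_on :: "enat \<Rightarrow> 'v::euclidean_space set \<Rightarrow> ('v \<Rightarrow> 'w::euclidean_space) \<Rightarrow> bool" where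
  "C_on r S f \<longleftrightarrow> (\<forall>k. enat k \<le> r \<longrightarrow> Ck_on k S f)"

definition holo_on :: "(complex^'n) set \<Rightarrow> (complex^'n \<Rightarrow> complex^'n) \<Rightarrow> bool" where
  "holo_on S h \<longleftrightarrow>
     (\<forall>z\<in>S. \<exists>D. (h has_derivative D) (at z) \<and> (\<forall>a v. D (a *s v) = a *s D v))"

section \<open>Smooth manifolds\<close>

type_synonym ('a, 'v) chart = "'a set \<times> ('a \<Rightarrow> 'v)"

definition cinv :: "('a, 'v) chart \<Rightarrow> 'v \<Rightarrow> 'a" where
  "cinv c = inv_into (fst c) (snd c)"

text \<open>A chart of the topological space \<open>X\<close> modelled on the subset \<open>S\<close> of a Euclidean space.\<close>

definition is_chart :: "'a topology \<Rightarrow> 'v::euclidean_space set \<Rightarrow> ('a, 'v) chart \<Rightarrow> bool" where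
  "is_chart X S c \<longleftrightarrow>
     openin X (fst c) \<and>
     openin (top_of_set S) (snd c ` fst c) \<and>
     homeomorphic_map (subtopology X (fst c)) (top_of_set (snd c ` fst c)) (snd c)"

record ('a, 'e) manifold =
  mtop :: "'a topology"
  atl :: "('a, 'e) chart set"

definition smooth_manifold :: "('a, 'e::euclidean_space) manifold \<Rightarrow> bool" where
  "smooth_manifold M \<longleftrightarrow>
     Hausdorff_space (mtop M) \<and> second_countable (mtop M) \<and> connected_space (mtop M) \<and>
     (\<forall>c\<in>atl M. is_chart (mtop M) UNIV c) \<and>
     (\<Union>c\<in>atl M. fst c) = topspace (mtop M) \<and>
     (\<forall>c\<in>atl M. \<forall>d\<in>atl M. C_on \<infinity> (snd c ` (fst c \<inter> fst d)) (snd d \<circ> cinv c))"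

text \<open>A chart of class \<open>C^r\<close>: it is related to the charts of the smooth atlas by
  \<open>C^r\<close> diffeomorphisms.\<close>

definition Cr_chart ::
  "enat \<Rightarrow> ('a, 'e::euclidean_space) manifold \<Rightarrow> ('a, 'v::euclidean_space) chart \<Rightarrow> bool" where
  "Cr_chart r M c \<longleftrightarrow>
     is_chart (mtop M) UNIV c \<and>
     (\<forall>d\<in>atl M. C_on r (snd c ` (fst c \<inter> fst d)) (snd d \<circ> cinv c) \<and>
                C_on r (snd d ` (fst c \<inter> fst d)) (snd c \<circ> cinv d))"

text \<open>The tangent space at \<open>x\<close> is the model space \<open>'e\<close>: a tangent vector at \<open>x\<close> is given by its
  coordinates in the preferred chart \<open>chart_at M x\<close>. Thus a vector field is a function
  \<open>'a \<Rightarrow> 'e\<close> and a distribution is a function \<open>'a \<Rightarrow> 'e set\<close>, both of them only relevant on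
  \<open>topspace (mtop M)\<close>.\<close>

definition chart_at :: "('a, 'e) manifold \<Rightarrow> 'a \<Rightarrow> ('a, 'e) chart" where
  "chart_at M x = (SOME c. c \<in> atl M \<and> x \<in> fst c)"

text \<open>\<open>mderiv M f x\<close> is the differential at \<open>x\<close> of a vector-valued function \<open>f\<close> defined near \<open>x\<close>.
  In particular \<open>mderiv M (snd c) x v\<close> is the coordinate vector of \<open>v\<close> in the chart \<open>c\<close>, and
  \<open>coord_vec M c x\<close> is the inverse of this linear map. \<open>tmap M f x\<close> is the tangent map of a
  self-map \<open>f\<close> of \<open>M\<close>.\<close>

definition mderiv ::
  "('a, 'e::euclidean_space) manifold \<Rightarrow> ('a \<Rightarrow> 'v::euclidean_space) \<Rightarrow> 'a \<Rightarrow> 'e \<Rightarrow> 'v" where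
  "mderiv M f x = frechet_derivative (f \<circ> cinv (chart_at M x)) (at (snd (chart_at M x) x))"

definition coord_vec ::
  "('a, 'e::euclidean_space) manifold \<Rightarrow> ('a, 'e) chart \<Rightarrow> 'a \<Rightarrow> 'e \<Rightarrow> 'e" where
  "coord_vec M c x = frechet_derivative (snd (chart_at M x) \<circ> cinv c) (at (snd c x))"

definition tmap :: "('a, 'e::euclidean_space) manifold \<Rightarrow> ('a \<Rightarrow> 'a) \<Rightarrow> 'a \<Rightarrow> 'e \<Rightarrow> 'e" where
  "tmap M f x = mderiv M (snd (chart_at M (f x)) \<circ> f) x"

definition smooth_vector_field :: "('a, 'e::euclidean_space) manifold \<Rightarrow> ('a \<Rightarrow> 'e) \<Rightarrow> bool" where
  "smooth_vector_field M X \<longleftrightarrow>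
     (\<forall>c\<in>atl M. C_on \<infinity> (snd c ` fst c) (\<lambda>u. mderiv M (snd c) (cinv c u) (X (cinv c u))))"

definition riemannian_metric ::
  "('a, 'e::euclidean_space) manifold \<Rightarrow> ('a \<Rightarrow> 'e \<Rightarrow> 'e \<Rightarrow> real) \<Rightarrow> bool" where
  "riemannian_metric M g \<longleftrightarrow>
     (\<forall>x\<in>topspace (mtop M). bilinear (g x) \<and> (\<forall>v w. g x v w = g x w v) \<and>
        (\<forall>v. v \<noteq> 0 \<longrightarrow> g x v v > 0)) \<and>
     (\<forall>c\<in>atl M. \<forall>v w. C_on \<infinity> (snd c ` fst c)
        (\<lambda>u. g (cinv c u) (coord_vec M c (cinv c u) v) (coord_vec M c (cinv c u) w)))"

text \<open>Continuous subbundles of the tangent bundle: in a chart, they have continuous local frames.\<close>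

definition continuous_subbundle :: "('a, 'e::euclidean_space) manifold \<Rightarrow> ('a \<Rightarrow> 'e set) \<Rightarrow> bool" where
  "continuous_subbundle M E \<longleftrightarrow>
     (\<forall>x\<in>topspace (mtop M). subspace (E x)) \<and>
     (\<forall>x\<in>topspace (mtop M). \<exists>c\<in>atl M. \<exists>W. openin (mtop M) W \<and> x \<in> W \<and> W \<subseteq> fst c \<and>
        (\<exists>(k::nat) (s :: nat \<Rightarrow> 'a \<Rightarrow> 'e).
           (\<forall>i<k. continuous_map (subtopology (mtop M) W) euclidean (s i)) \<and>
           (\<forall>y\<in>W. inj_on (\<lambda>i. s i y) {..<k} \<and> independent ((\<lambda>i. s i y) ` {..<k}) \<and>
                   span ((\<lambda>i. s i y) ` {..<k}) = mderiv M (snd c) y ` E y)))"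

section \<open>Flows\<close>

definition smooth_flow ::
  "('a, 'e::euclidean_space) manifold \<Rightarrow> (real \<Rightarrow> 'a \<Rightarrow> 'a) \<Rightarrow> bool" where
  "smooth_flow M \<phi> \<longleftrightarrow>
     continuous_map (prod_topology euclideanreal (mtop M)) (mtop M) (\<lambda>(t, x). \<phi> t x) \<and>
     (\<forall>x\<in>topspace (mtop M). \<phi> 0 x = x) \<and>
     (\<forall>s t. \<forall>x\<in>topspace (mtop M). \<phi> (s + t) x = \<phi> s (\<phi> t x)) \<and>
     (\<forall>c\<in>atl M. \<forall>d\<in>atl M.
        C_on \<infinity> {(t, u). u \<in> snd c ` fst c \<and> \<phi> t (cinv c u) \<in> fst d}
          (\<lambda>(t, u). snd d (\<phi> t (cinv c u))))"

definition generates ::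
  "('a, 'e::euclidean_space) manifold \<Rightarrow> ('a \<Rightarrow> 'e) \<Rightarrow> (real \<Rightarrow> 'a \<Rightarrow> 'a) \<Rightarrow> bool" where
  "generates M X \<phi> \<longleftrightarrow>
     (\<forall>x\<in>topspace (mtop M). \<forall>t.
        ((\<lambda>s. snd (chart_at M (\<phi> t x)) (\<phi> s x)) has_vector_derivative X (\<phi> t x)) (at t))"

definition partially_hyperbolic ::
  "('a, 'e::euclidean_space) manifold \<Rightarrow> (real \<Rightarrow> 'a \<Rightarrow> 'a) \<Rightarrow> ('a \<Rightarrow> 'e) \<Rightarrow>
   ('a \<Rightarrow> 'e set) \<Rightarrow> ('a \<Rightarrow> 'e set) \<Rightarrow> ('a \<Rightarrow> 'e set) \<Rightarrow> bool" where
  "partially_hyperbolic M \<phi> X Es Ec Eu \<longleftrightarrow>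
     (\<forall>E\<in>{Es, Ec, Eu}. continuous_subbundle M E \<and>
        (\<forall>t. \<forall>x\<in>topspace (mtop M). tmap M (\<phi> t) x ` E x = E (\<phi> t x))) \<and>
     (\<forall>x\<in>topspace (mtop M). \<forall>v. \<exists>!p. case p of (a, b, r, d) \<Rightarrow>
        a \<in> Es x \<and> b \<in> Ec x \<and> d \<in> Eu x \<and> v = a + b + r *\<^sub>R X x + d) \<and>
     (\<exists>g \<alpha> \<alpha>' \<beta>' \<beta> C. riemannian_metric M g \<and>
        0 < \<alpha> \<and> \<alpha> < \<alpha>' \<and> \<alpha>' < 1 \<and> 1 < \<beta>' \<and> \<beta>' < \<beta> \<and> 0 < C \<and>
        (let nrm = (\<lambda>x v. sqrt (g x v v)); d\<phi> = (\<lambda>t. tmap M (\<phi> t)) in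
         \<forall>t\<ge>0. \<forall>x\<in>topspace (mtop M).
          (\<forall>v\<in>Es x. nrm (\<phi> t x) (d\<phi> t x v) \<le> C * \<alpha> powr t * nrm x v) \<and>
          (\<forall>v\<in>Eu x. inverse C * \<beta> powr t * nrm x v \<le> nrm (\<phi> t x) (d\<phi> t x v)) \<and>
          (\<forall>v\<in>Ec x. inverse C * \<alpha>' powr t * nrm x v \<le> nrm (\<phi> t x) (d\<phi> t x v) \<and>
                     nrm (\<phi> t x) (d\<phi> t x v) \<le> C * \<beta>' powr t * nrm x v)))"

text \<open>\<open>T\<close> is a smooth foliated atlas of the orbit foliation: in a chart \<open>c \<in> T\<close> with coordinates
  \<open>(\<tau>, z) \<in> \<real> \<times> \<complex>^q\<close>, orbits locally stay in the one-dimensional plaques on which \<open>z\<close> is constant.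
  The transverse transition maps \<open>h\<close> are holomorphic. (Each \<open>h\<close> is locally invertible with
  holomorphic inverse, since the roles of \<open>c\<close> and \<open>d\<close> can be exchanged.)\<close>

definition transversely_holomorphic ::
  "('a, 'e::euclidean_space) manifold \<Rightarrow> (real \<Rightarrow> 'a \<Rightarrow> 'a) \<Rightarrow>
   ('a, real \<times> (complex^'q)) chart set \<Rightarrow> bool" where
  "transversely_holomorphic M \<phi> T \<longleftrightarrow>
     DIM('e) = 1 + 2 * CARD('q) \<and>
     (\<forall>c\<in>T. Cr_chart \<infinity> M c) \<and>
     (\<Union>c\<in>T. fst c) = topspace (mtop M) \<and>
     (\<forall>c\<in>T. \<forall>x\<in>fst c. \<exists>\<epsilon>>0. \<forall>t. \<bar>t\<bar> < \<epsilon> \<longrightarrow>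
        \<phi> t x \<in> fst c \<and> snd (snd c (\<phi> t x)) = snd (snd c x)) \<and>
     (\<forall>c\<in>T. \<forall>d\<in>T. \<forall>x \<in> fst c \<inter> fst d.
        \<exists>W \<Omega> h. openin (mtop M) W \<and> x \<in> W \<and> W \<subseteq> fst c \<inter> fst d \<and> open \<Omega> \<and> holo_on \<Omega> h \<and>
          (\<forall>y\<in>W. snd (snd c y) \<in> \<Omega> \<and> snd (snd d y) = h (snd (snd c y))))"

text \<open>The differential \<open>dz\<close> of the transverse coordinate of a chart in \<open>T\<close> has kernel \<open>\<real>X\<close>, and so
  identifies \<open>TM/\<real>X\<close> with \<open>\<complex>^q\<close>; \<open>I\<close> is multiplication by \<open>\<i>\<close> under this identification.
  \<open>induced_I M T H x\<close> is \<open>I\<close> transported to a complement \<open>H x\<close> of \<open>\<real>X\<close>.\<close>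

definition dz ::
  "('a, 'e::euclidean_space) manifold \<Rightarrow> ('a, real \<times> (complex^'q)) chart \<Rightarrow> 'a \<Rightarrow> 'e \<Rightarrow> complex^'q" where
  "dz M c x = mderiv M (\<lambda>y. snd (snd c y)) x"

definition induced_I ::
  "('a, 'e::euclidean_space) manifold \<Rightarrow> ('a, real \<times> (complex^'q)) chart set \<Rightarrow>
   ('a \<Rightarrow> 'e set) \<Rightarrow> 'a \<Rightarrow> 'e \<Rightarrow> 'e" where
  "induced_I M T H x v =
     (THE w. w \<in> H x \<and> (\<forall>c\<in>T. x \<in> fst c \<longrightarrow> dz M c x w = \<i> *s dz M c x v))"

definition sum_bundle :: "('a \<Rightarrow> 'e::real_vector set) \<Rightarrow> ('a \<Rightarrow> 'e set) \<Rightarrow> 'a \<Rightarrow> 'e set" where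
  "sum_bundle E E' x = {v + w | v w. v \<in> E x \<and> w \<in> E' x}"

section \<open>Foliations\<close>

text \<open>A foliation is given by a foliated atlas. Its charts take values in the model space \<open>'e\<close> of
  the manifold, and the plaques are the slices parallel to the linear subspace \<open>fmodel F\<close>.
  The chart images are convex, so plaques are connected. The leaf through a point consists of all
  points that can be reached by a chain of plaques.\<close>

record ('a, 'e) foliation =
  fmodel :: "'e set"
  fatlas :: "('a, 'e) chart set"

definition plaque :: "('a, 'e::euclidean_space) foliation \<Rightarrow> ('a, 'e) chart \<Rightarrow> 'a \<Rightarrow> 'a set" where
  "plaque F c x = {y \<in> fst c. snd c y - snd c x \<in> fmodel F}"

definition leaf :: "('a, 'e::euclidean_space) foliation \<Rightarrow> 'a \<Rightarrow> 'a set" where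
  "leaf F x = {y. (x, y) \<in> {(a, b). \<exists>c\<in>fatlas F. a \<in> fst c \<and> b \<in> plaque F c a}\<^sup>*}"

definition leaf_topology ::
  "('a, 'e::euclidean_space) manifold \<Rightarrow> ('a, 'e) foliation \<Rightarrow> 'a set \<Rightarrow> 'a topology" where
  "leaf_topology M F L =
     topology_generated_by {plaque F c y \<inter> W | c y W.
        c \<in> fatlas F \<and> y \<in> fst c \<inter> L \<and> openin (mtop M) W}"

definition foliated_atlas ::
  "('a, 'e::euclidean_space) manifold \<Rightarrow> ('a, 'e) foliation \<Rightarrow> bool" where
  "foliated_atlas M F \<longleftrightarrow>
     subspace (fmodel F) \<and>
     (\<forall>c\<in>fatlas F. is_chart (mtop M) UNIV c \<and> convex (snd c ` fst c)) \<and>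
     (\<Union>c\<in>fatlas F. fst c) = topspace (mtop M) \<and>
     (\<forall>c\<in>fatlas F. \<forall>d\<in>fatlas F. \<forall>x \<in> fst c \<inter> fst d.
        \<exists>W. openin (mtop M) W \<and> x \<in> W \<and> W \<subseteq> fst c \<inter> fst d \<and>
          (\<forall>y\<in>W. \<forall>y'\<in>W. snd c y - snd c y' \<in> fmodel F \<longrightarrow> snd d y - snd d y' \<in> fmodel F))"

text \<open>\<open>F\<close> is a continuous foliation with \<open>C^r\<close> leaves, tangent to \<open>E\<close>: plaques are \<open>C^r\<close>
  submanifolds of \<open>M\<close> (there are \<open>C^r\<close> charts \<open>k\<close> of \<open>M\<close> in which they are flat) and
  their tangent spaces are given by \<open>E\<close>.\<close>

definition tangent_foliation ::
  "enat \<Rightarrow> ('a, 'e::euclidean_space) manifold \<Rightarrow> ('a \<Rightarrow> 'e set) \<Rightarrow> ('a, 'e) foliation \<Rightarrow> bool" where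
  "tangent_foliation r M E F \<longleftrightarrow>
     foliated_atlas M F \<and> continuous_subbundle M E \<and>
     (\<forall>c\<in>fatlas F. \<forall>x\<in>fst c. \<exists>k. Cr_chart r M k \<and> x \<in> fst k \<and>
        fst k \<inter> plaque F c x = {y \<in> fst k. snd k y - snd k x \<in> fmodel F} \<and>
        mderiv M (snd k) x ` E x = fmodel F)"

definition flow_invariant ::
  "('a, 'e::euclidean_space) manifold \<Rightarrow> (real \<Rightarrow> 'a \<Rightarrow> 'a) \<Rightarrow> ('a, 'e) foliation \<Rightarrow> bool" where
  "flow_invariant M \<phi> F \<longleftrightarrow>
     (\<forall>t. \<forall>x\<in>topspace (mtop M). \<phi> t ` leaf F x = leaf F (\<phi> t x))"

section \<open>Complex manifolds\<close>

text \<open>In order to have complex manifolds whose dimension \<open>m\<close> is not fixed by a type, charts take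
  values in a coordinate subspace \<open>\<complex>^J\<close> of \<open>\<complex>^n\<close> with \<open>card J = m\<close>.
  A function \<open>f\<close> on an open subset \<open>S\<close> of \<open>\<complex>^J\<close> is differentiated by regarding it as the
  function \<open>f \<circ> cproj J\<close> on the open subset \<open>cproj J -` S\<close> of \<open>\<complex>^n\<close>, which does not depend on
  the coordinates outside \<open>J\<close>.\<close>

definition cspace :: "'n set \<Rightarrow> (complex^'n) set" where
  "cspace J = {z. \<forall>i. i \<notin> J \<longrightarrow> z $ i = 0}"

definition cproj :: "'n set \<Rightarrow> complex^'n \<Rightarrow> complex^'n" where
  "cproj J z = (\<chi> i. if i \<in> J then z $ i else 0)"

definition complex_manifold ::
  "'a topology \<Rightarrow> 'n::finite set \<Rightarrow> ('a, complex^'n) chart set \<Rightarrow> bool" where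
  "complex_manifold Y J B \<longleftrightarrow>
     Hausdorff_space Y \<and> second_countable Y \<and> connected_space Y \<and>
     (\<forall>c\<in>B. is_chart Y (cspace J) c) \<and>
     (\<Union>c\<in>B. fst c) = topspace Y \<and>
     (\<forall>c\<in>B. \<forall>d\<in>B.
        holo_on (cproj J -` (snd c ` (fst c \<inter> fst d))) (snd d \<circ> cinv c \<circ> cproj J))"

definition holomorphic_map ::
  "'n::finite set \<Rightarrow> 'a topology \<Rightarrow> ('a, complex^'n) chart set \<Rightarrow>
   'a topology \<Rightarrow> ('a, complex^'n) chart set \<Rightarrow> ('a \<Rightarrow> 'a) \<Rightarrow> bool" where
  "holomorphic_map J Y B Y' B' f \<longleftrightarrow>
     continuous_map Y Y' f \<and>
     (\<forall>c\<in>B. \<forall>d\<in>B'.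
        holo_on (cproj J -` (snd c ` {y \<in> fst c. f y \<in> fst d})) (snd d \<circ> f \<circ> cinv c \<circ> cproj J))"

text \<open>The inclusion into \<open>M\<close> of the manifold \<open>Y\<close> with atlas \<open>B\<close> is a \<open>C^r\<close> immersion, \<open>r \<ge> 1\<close>.
  \<open>incl_deriv M J c y\<close> is its differential at \<open>y\<close>, where tangent vectors of \<open>Y\<close> at \<open>y\<close> are
  represented by their coordinates in \<open>\<complex>^J\<close> with respect to the chart \<open>c\<close>.\<close>

definition incl_deriv ::
  "('a, 'e::euclidean_space) manifold \<Rightarrow> 'n::finite set \<Rightarrow> ('a, complex^'n) chart \<Rightarrow> 'a \<Rightarrow>
   complex^'n \<Rightarrow> 'e" where
  "incl_deriv M J c y = frechet_derivative (snd (chart_at M y) \<circ> cinv c \<circ> cproj J) (at (snd c y))"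

definition immersed ::
  "enat \<Rightarrow> ('a, 'e::euclidean_space) manifold \<Rightarrow> 'a topology \<Rightarrow> 'n::finite set \<Rightarrow>
   ('a, complex^'n) chart set \<Rightarrow> bool" where
  "immersed r M Y J B \<longleftrightarrow>
     continuous_map Y (mtop M) id \<and>
     (\<forall>c\<in>B. \<forall>d\<in>atl M.
        C_on r (cproj J -` (snd c ` (fst c \<inter> fst d))) (snd d \<circ> cinv c \<circ> cproj J)) \<and>
     (\<forall>c\<in>B. \<forall>y\<in>fst c. inj_on (incl_deriv M J c y) (cspace J))"

text \<open>The leaves of \<open>F\<close> are \<open>C^r\<close>-immersed complex manifolds with complex structure induced by the
  almost complex structure \<open>I\<close> on \<open>H \<cong> TM/\<real>X\<close>, and the flow acts holomorphically
  between them. The condition that \<open>induced_I\<close> be multiplication by \<open>\<i>\<close> determines the complex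
  structure \<open>B L\<close> of each leaf \<open>L\<close>.\<close>

definition holomorphic_leaves ::
  "enat \<Rightarrow> ('a, 'e::euclidean_space) manifold \<Rightarrow> (real \<Rightarrow> 'a \<Rightarrow> 'a) \<Rightarrow>
   ('a, real \<times> (complex^'q)) chart set \<Rightarrow> ('a \<Rightarrow> 'e set) \<Rightarrow> ('a, 'e) foliation \<Rightarrow> bool" where
  "holomorphic_leaves r M \<phi> T H F \<longleftrightarrow>
     (\<exists>(J :: 'q set) B.
        (\<forall>x\<in>topspace (mtop M). let L = leaf F x; Y = leaf_topology M F L in
           topspace Y = L \<and> complex_manifold Y J (B L) \<and> immersed r M Y J (B L) \<and>
           (\<forall>c\<in>B L. \<forall>y\<in>fst c. \<forall>v\<in>cspace J.
              incl_deriv M J c y v \<in> H y \<and>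
              incl_deriv M J c y (\<i> *s v) = induced_I M T H y (incl_deriv M J c y v))) \<and>
        (\<forall>t. \<forall>x\<in>topspace (mtop M). let L = leaf F x; L' = leaf F (\<phi> t x) in
           holomorphic_map J (leaf_topology M F L) (B L) (leaf_topology M F L') (B L') (\<phi> t)))"

end

theory Submission
  imports Defs
begin

text \<open>The orbit foliation being transversely holomorphic, \<open>d\<phi>\<^sup>t\<close> commutes with \<open>I\<close> on \<open>TM/\<real>X\<close>. Since \<open>I\<close> and
  the projections of the splitting are bounded on the compact manifold \<open>M\<close>, the components of \<open>I v\<close> grow
  along an orbit at most as fast as \<open>v\<close>. For \<open>v\<close> in \<open>E\<^sup>s\<close>, \<open>E\<^sup>c\<close> or \<open>E\<^sup>u\<close> the rates of partial hyperbolicity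
  force the components of \<open>I v\<close> in the two other bundles to vanish, so each bundle is \<open>I\<close>-invariant.
  Consequently the holomorphic transverse coordinates, restricted to a leaf and followed by a complex
  linear projection, are local charts of the leaf. In such charts the transition maps and \<open>\<phi>\<^sup>t\<close> are
  differentiable with complex linear differential, i.e. holomorphic. That \<open>\<phi>\<^sup>t\<close> is continuous for the
  leaf topologies holds because a leaf meets a foliated chart in only countably many plaques.\<close>

text \<open>Everything about \<open>I\<close> is phrased through the differentials \<open>dz\<close>
  of transverse coordinates: they kill exactly the flow direction and are injective on a complement
  of it. Invariance of a bundle thus becomes a pointwise statement, in which the bundle enters only
  as a continuous one. Two obstacles shape the rest. The leaves come from a merely continuous
  foliation and may be only \<open>C^1\<close>, so the flow in leaf coordinates is a priori only
  continuous; it is differentiated through the inclusion of the target leaf, an immersion. And a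
  leaf carries a finer topology than the one induced by \<open>M\<close>, while flow invariance is
  an equality of sets; countability of the plaques of a leaf is what turns this equality into
  continuity. Transition maps between leaf charts are the flow at time 0, so one argument gives both
  the complex structure and the holomorphy of the flow. All leaves must share one index set
  \<open>J\<close>, hence the care taken to show that their complex dimension is constant.\<close>

section \<open>Functions of class \<open>C^k\<close> on open sets: congruence, algebra, composition,
  inverses\<close>

lemma has_derivative_cong_open:
  assumes "open S" "x \<in> S" "\<And>x. x \<in> S \<Longrightarrow> f x = g x"
  shows "(f has_derivative D) (at x) \<longleftrightarrow> (g has_derivative D) (at x)"
  using has_derivative_transform_within_open[of f D x UNIV S g]
    has_derivative_transform_within_open[of g D x UNIV S f] assms by auto

lemma Ck_on_cong:
  assumes "open S" "\<And>x. x \<in> S \<Longrightarrow> f x = g x"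
  shows "Ck_on k S f \<longleftrightarrow> Ck_on k S g"
  using assms(2)
proof (induction k arbitrary: f g)
  case 0
  then show ?case by (simp cong: continuous_on_cong)
next
  case (Suc k)
  have *: "(f has_derivative D) (at x) \<longleftrightarrow> (g has_derivative D) (at x)" if "x \<in> S" for x D
    by (rule has_derivative_cong_open[OF assms(1) that Suc.prems])
  have "f differentiable (at x) \<longleftrightarrow> g differentiable (at x)" if "x \<in> S" for x
    using *[OF that] by (simp add: differentiable_def)
  moreover have "frechet_derivative f (at x) = frechet_derivative g (at x)" if "x \<in> S" for x
    using *[OF that] by (simp add: frechet_derivative_def)
  then have "Ck_on k S (\<lambda>x. frechet_derivative f (at x) v) = Ck_on k S (\<lambda>x. frechet_derivative g (at x) v)" for v
    by (intro Suc.IH) simp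
  ultimately show ?case by simp
qed

text \<open>The recursion in \<open>Ck_on\<close> runs through \<open>frechet_derivative\<close>, a
  choice operator. On an open set any explicit family of derivatives may replace it; the inductions
  for sums, products, compositions and inverses work with this form.\<close>

lemma Ck_on_Suc_iff:
  assumes "open S"
  shows "Ck_on (Suc k) S f \<longleftrightarrow>
    (\<exists>f'. (\<forall>x\<in>S. (f has_derivative f' x) (at x)) \<and> (\<forall>v. Ck_on k S (\<lambda>x. f' x v)))"
proof
  assume "Ck_on (Suc k) S f"
  then show "\<exists>f'. (\<forall>x\<in>S. (f has_derivative f' x) (at x)) \<and> (\<forall>v. Ck_on k S (\<lambda>x. f' x v))"
    by (intro exI[of _ "\<lambda>x. frechet_derivative f (at x)"]) (simp add: frechet_derivative_works[symmetric])
next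
  assume "\<exists>f'. (\<forall>x\<in>S. (f has_derivative f' x) (at x)) \<and> (\<forall>v. Ck_on k S (\<lambda>x. f' x v))"
  then obtain f' where f': "\<And>x. x \<in> S \<Longrightarrow> (f has_derivative f' x) (at x)" "\<And>v. Ck_on k S (\<lambda>x. f' x v)"
    by blast
  have eq: "frechet_derivative f (at x) = f' x" if "x \<in> S" for x
    using frechet_derivative_at[OF f'(1)[OF that]] by simp
  have "Ck_on k S (\<lambda>x. frechet_derivative f (at x) v) = Ck_on k S (\<lambda>x. f' x v)" for v
    by (rule Ck_on_cong[OF assms]) (simp add: eq)
  then show "Ck_on (Suc k) S f"
    using f' by (auto simp: differentiable_def)
qed

lemma Ck_on_subset: "Ck_on k S f \<Longrightarrow> T \<subseteq> S \<Longrightarrow> Ck_on k T f"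
  by (induction k arbitrary: f) (auto intro: continuous_on_subset)

lemma Ck_on_imp_continuous: "Ck_on k S f \<Longrightarrow> continuous_on S f"
  by (cases k) (auto intro!: differentiable_imp_continuous_on simp: differentiable_on_def
      differentiable_at_withinI)

lemma Ck_on_Suc_imp: "Ck_on (Suc k) S f \<Longrightarrow> Ck_on k S f"
proof (induction k arbitrary: f)
  case 0
  then show ?case using Ck_on_imp_continuous Ck_on.simps(1) by blast
next
  case (Suc k)
  have "Ck_on k S (\<lambda>x. frechet_derivative f (at x) v)" for v
    by (rule Suc.IH) (use Suc.prems in simp)
  then show ?case using Suc.prems by simp
qed

text \<open>Derivatives are taken at points of the whole space, so they do not depend on the
  neighbourhood used. This is how class \<open>C^r\<close> is later checked inside one chart at a
  time.\<close>

lemma Ck_on_local: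
  assumes "\<And>x. x \<in> S \<Longrightarrow> \<exists>U. open U \<and> x \<in> U \<and> Ck_on k U f"
  shows "Ck_on k S f"
  using assms
proof (induction k arbitrary: f)
  case 0
  then show ?case
    by (metis Ck_on.simps(1) continuous_at_imp_continuous_on continuous_on_eq_continuous_at)
next
  case (Suc k)
  have "Ck_on k S (\<lambda>x. frechet_derivative f (at x) v)" for v
    by (rule Suc.IH) (use Suc.prems in fastforce)
  moreover have "f differentiable (at x)" if "x \<in> S" for x
    using Suc.prems[OF that] by auto
  ultimately show ?case by simp
qed

lemma Ck_on_const: "Ck_on k S (\<lambda>x. c)"
proof (induction k arbitrary: c)
  case (Suc k)
  have "frechet_derivative (\<lambda>x. c) (at x) v = 0" for x v
    by (metis frechet_derivative_const)
  then show ?case using Suc by simp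
qed simp

lemma Ck_on_linear:
  fixes f :: "'a::euclidean_space \<Rightarrow> 'b::euclidean_space"
  assumes "linear f" shows "Ck_on k S f"
proof (cases k)
  case 0
  then show ?thesis using assms by (simp add: linear_continuous_on linear_conv_bounded_linear)
next
  case (Suc m)
  have "(f has_derivative f) (at x)" for x
    using assms by (simp add: linear_conv_bounded_linear bounded_linear_imp_has_derivative)
  then have "Ck_on k UNIV f"
    unfolding Suc Ck_on_Suc_iff[OF open_UNIV] by (intro exI[of _ "\<lambda>x. f"]) (simp add: Ck_on_const)
  then show ?thesis using Ck_on_subset by blast
qed

lemma Ck_on_add:
  assumes "open S" "Ck_on k S f" "Ck_on k S g"
  shows "Ck_on k S (\<lambda>x. f x + g x)"
  using assms(2,3)
proof (induction k arbitrary: f g)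
  case 0
  then show ?case by (simp add: continuous_on_add)
next
  case (Suc k)
  from Suc.prems obtain f' g' where
    "\<And>x. x \<in> S \<Longrightarrow> (f has_derivative f' x) (at x)" "\<And>v. Ck_on k S (\<lambda>x. f' x v)"
    "\<And>x. x \<in> S \<Longrightarrow> (g has_derivative g' x) (at x)" "\<And>v. Ck_on k S (\<lambda>x. g' x v)"
    unfolding Ck_on_Suc_iff[OF assms(1)] by metis
  then show ?case
    unfolding Ck_on_Suc_iff[OF assms(1)]
    by (intro exI[of _ "\<lambda>x v. f' x v + g' x v"]) (auto intro: Suc.IH has_derivative_add)
qed

lemma Ck_on_sum:
  assumes "open S" "\<And>i. i \<in> I \<Longrightarrow> Ck_on k S (f i)"
  shows "Ck_on k S (\<lambda>x. \<Sum>i\<in>I. f i x)"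
proof (cases "finite I")
  case True
  then show ?thesis using assms(2)
    by (induction I) (auto simp: Ck_on_const intro: Ck_on_add[OF assms(1)])
qed (simp add: Ck_on_const)

lemma Ck_on_scaleR:
  fixes g :: "'a::euclidean_space \<Rightarrow> 'b::euclidean_space"
  assumes "open S" "Ck_on k S f" "Ck_on k S g"
  shows "Ck_on k S (\<lambda>x. f x *\<^sub>R g x)"
  using assms(2,3)
proof (induction k arbitrary: f g)
  case 0
  then show ?case by (simp add: continuous_on_scaleR)
next
  case (Suc k)
  from Suc.prems obtain f' g' where
    *: "\<And>x. x \<in> S \<Longrightarrow> (f has_derivative f' x) (at x)" "\<And>v. Ck_on k S (\<lambda>x. f' x v)"
    "\<And>x. x \<in> S \<Longrightarrow> (g has_derivative g' x) (at x)" "\<And>v. Ck_on k S (\<lambda>x. g' x v)"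
    unfolding Ck_on_Suc_iff[OF assms(1)] by metis
  have "Ck_on k S f" "Ck_on k S g" using Suc.prems Ck_on_Suc_imp by blast+
  with * show ?case
    unfolding Ck_on_Suc_iff[OF assms(1)]
    by (intro exI[of _ "\<lambda>x v. f x *\<^sub>R g' x v + f' x v *\<^sub>R g x"])
      (auto intro!: Suc.IH has_derivative_scaleR Ck_on_add[OF assms(1)])
qed

lemma Ck_on_linear_compose:
  fixes L :: "'b::euclidean_space \<Rightarrow> 'c::euclidean_space"
  assumes "open S" "linear L" "Ck_on k S f"
  shows "Ck_on k S (\<lambda>x. L (f x))"
  using assms(3)
proof (induction k arbitrary: f)
  case 0
  then show ?case using assms(2) bounded_linear.continuous_on
    by (simp add: linear_conv_bounded_linear)
next
  case (Suc k)
  from Suc.prems obtain f' where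
    *: "\<And>x. x \<in> S \<Longrightarrow> (f has_derivative f' x) (at x)" "\<And>v. Ck_on k S (\<lambda>x. f' x v)"
    unfolding Ck_on_Suc_iff[OF assms(1)] by metis
  then show ?case
    unfolding Ck_on_Suc_iff[OF assms(1)]
    by (intro exI[of _ "\<lambda>x v. L (f' x v)"] conjI ballI allI Suc.IH
        bounded_linear.has_derivative[OF assms(2)[unfolded linear_conv_bounded_linear]]) blast+
qed

text \<open>A family of linear maps is expanded over the standard basis, which makes it possible to stay
  within functions of a single variable.\<close>

lemma linear_expand: "linear L \<Longrightarrow> L w = (\<Sum>b\<in>Basis. (w \<bullet> b) *\<^sub>R L b)"
  for w :: "'a::euclidean_space"
  by (metis (no_types, lifting) euclidean_representation linear_cmul linear_sum sum.cong)

text \<open>Serves the chain rule and the derivative of an inverse, where both the linear map and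
  its argument vary with the point.\<close>

lemma Ck_on_apply_linear:
  fixes w :: "'a::euclidean_space \<Rightarrow> 'b::euclidean_space"
  assumes "open S" "\<And>x. x \<in> S \<Longrightarrow> linear (L x)" "\<And>b. Ck_on k S (\<lambda>x. L x b)" "Ck_on k S w"
  shows "Ck_on k S (\<lambda>x. L x (w x))"
proof -
  have "Ck_on k S (\<lambda>x. \<Sum>b\<in>Basis. (w x \<bullet> b) *\<^sub>R L x b)"
    by (intro Ck_on_sum Ck_on_scaleR assms Ck_on_linear_compose[where L="\<lambda>y. y \<bullet> b" for b])
      (auto intro!: linearI simp: inner_add_left)
  then show ?thesis
    by (subst Ck_on_cong[OF assms(1)]) (use linear_expand assms(2) in auto)
qed

text \<open>Induction on \<open>k\<close> with \<open>g\<close> arbitrary and \<open>f\<close>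
  fixed: the derivative of the composition is \<open>g' (f x) (f' x v)\<close>, and the induction
  hypothesis applies to each column of \<open>g'\<close> composed with \<open>f\<close>.\<close>

lemma Ck_on_compose:
  assumes "open S" "open T" "Ck_on k S f" "Ck_on k T g" "f ` S \<subseteq> T"
  shows "Ck_on k S (\<lambda>x. g (f x))"
  using assms(3,4)
proof (induction k arbitrary: g)
  case 0
  then show ?case using assms(5) by (auto intro: continuous_on_compose2)
next
  case (Suc k)
  from Suc.prems obtain f' g' where
    *: "\<And>x. x \<in> S \<Longrightarrow> (f has_derivative f' x) (at x)" "\<And>v. Ck_on k S (\<lambda>x. f' x v)"
    "\<And>x. x \<in> T \<Longrightarrow> (g has_derivative g' x) (at x)" "\<And>v. Ck_on k T (\<lambda>x. g' x v)"
    unfolding Ck_on_Suc_iff[OF assms(1)] Ck_on_Suc_iff[OF assms(2)] by metis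
  have fS: "f x \<in> T" if "x \<in> S" for x using that assms(5) by blast
  have "((\<lambda>x. g (f x)) has_derivative (\<lambda>v. g' (f x) (f' x v))) (at x)" if "x \<in> S" for x
    using has_derivative_compose[OF *(1)[OF that] *(3)[OF fS[OF that]]] .
  moreover have "Ck_on k S (\<lambda>x. g' (f x) (f' x v))" for v
  proof (rule Ck_on_apply_linear[OF assms(1), where L="\<lambda>x. g' (f x)" and w="\<lambda>x. f' x v"])
    show "linear (g' (f x))" if "x \<in> S" for x
      using has_derivative_linear[OF *(3)[OF fS[OF that]]] .
    show "Ck_on k S (\<lambda>x. g' (f x) b)" for b
      using Suc.IH[OF Ck_on_Suc_imp[OF Suc.prems(1)] *(4)] .
  qed (rule *)
  ultimately show ?case
    unfolding Ck_on_Suc_iff[OF assms(1)] by (intro exI[of _ "\<lambda>x v. g' (f x) (f' x v)"]) auto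
qed

text \<open>The rule \<open>B' = - B A' B\<close> for pointwise inverses. Only continuity of the
  columns of \<open>B\<close> is assumed, so differentiability has to come out of the algebraic
  identities, column by column.\<close>

lemma has_derivative_inverse_family:
  fixes A B :: "'a::euclidean_space \<Rightarrow> 'b::euclidean_space \<Rightarrow> 'b"
  assumes S: "open S" and lin: "\<And>x. x \<in> S \<Longrightarrow> linear (A x)" "\<And>x. x \<in> S \<Longrightarrow> linear (B x)"
    and AB: "\<And>x v. x \<in> S \<Longrightarrow> A x (B x v) = v" and BA: "\<And>x v. x \<in> S \<Longrightarrow> B x (A x v) = v"
    and contB: "\<And>v. continuous_on S (\<lambda>x. B x v)"
    and dA: "\<And>x v. x \<in> S \<Longrightarrow> ((\<lambda>x. A x v) has_derivative (\<lambda>h. A' x h v)) (at x)"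
    and x: "x \<in> S"
  shows "((\<lambda>x. B x v) has_derivative (\<lambda>h. - B x (A' x h (B x v)))) (at x)"
proof -
  define w where "w = B x v"
  have bl: "linear (\<lambda>h. A' x h w)" using dA[OF x] has_derivative_linear by blast
  have dw: "((\<lambda>y. A y w) has_derivative (\<lambda>h. A' x h w)) (at x)" using dA[OF x] .
  \<comment> \<open>\<open>B y v - B x v = - B y (A y w - A x w)\<close>, and \<open>B y\<close> may be replaced by \<open>B x\<close> up to first order.\<close>
  define R where "R y = B y (A y w - A x w)" for y
  have R_exp: "R y = (\<Sum>b\<in>Basis. ((A y w - A x w) \<bullet> b) *\<^sub>R B y b)" if "y \<in> S" for y
    unfolding R_def using linear_expand[OF lin(2)[OF that]] .
  \<comment> \<open>A scalar function that is differentiable and zero at \<open>x\<close>, times a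
    merely continuous vector function, is differentiable at \<open>x\<close>: freezing the
    continuous factor at \<open>x\<close> costs a bounded difference quotient times a quantity
    tending to 0.\<close>
  have mult: "((\<lambda>y. ((A y w - A x w) \<bullet> b) *\<^sub>R B y b) has_derivative (\<lambda>h. (A' x h w \<bullet> b) *\<^sub>R B x b)) (at x)" for b
  proof -
    let ?f = "\<lambda>y. (A y w - A x w) \<bullet> b"
    have f: "(?f has_derivative (\<lambda>h. A' x h w \<bullet> b)) (at x)"
      by (auto intro!: derivative_eq_intros dw)
    have c: "((\<lambda>y. B y b - B x b) \<longlongrightarrow> 0) (at x)"
      using contB[of b] x S by (metis LIM_zero continuous_on_def at_within_open)
    obtain K where K: "\<And>h. norm (A' x h w \<bullet> b) \<le> norm h * K"
      using has_derivative_bounded_linear[OF f] bounded_linear.bounded by blast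
    have "((\<lambda>y. (?f y / norm (y - x)) *\<^sub>R (B y b - B x b)) \<longlongrightarrow> 0) (at x)"
    proof (rule Lim_null_comparison)
      have "((\<lambda>y. (?f y - ?f x - (A' x (y - x) w \<bullet> b)) /\<^sub>R norm (y - x)) \<longlongrightarrow> 0) (at x)"
        using f unfolding has_derivative_at_within by (auto simp: diff_diff_eq2 algebra_simps)
      then have "\<forall>\<^sub>F y in at x. norm ((?f y - (A' x (y - x) w \<bullet> b)) /\<^sub>R norm (y - x)) < 1"
        using order_tendstoD(2)[OF tendsto_norm_zero] by fastforce
      moreover have "\<forall>\<^sub>F y in at x. y \<noteq> x" by (simp add: eventually_at_filter)
      ultimately have ev: "\<forall>\<^sub>F y in at x. norm (?f y / norm (y - x)) \<le> K + 1"
      proof eventually_elim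
        case (elim y)
        have n: "norm (y - x) > 0" using elim(2) by simp
        have "norm (?f y - (A' x (y - x) w \<bullet> b)) < norm (y - x)"
          using elim(1) n by (simp add: divide_simps abs_mult)
        with K[of "y - x"] have "norm (?f y) \<le> norm (y - x) * (K + 1)"
          by (simp add: algebra_simps)
        then show ?case using n by (simp add: divide_simps mult.commute)
      qed
      then show "\<forall>\<^sub>F y in at x. norm ((?f y / norm (y - x)) *\<^sub>R (B y b - B x b)) \<le> (K + 1) * norm (B y b - B x b)"
      proof eventually_elim
        case (elim y)
        from mult_right_mono[OF this norm_ge_zero[of "B y b - B x b"]] show ?case by simp
      qed
      show "((\<lambda>y. (K + 1) * norm (B y b - B x b)) \<longlongrightarrow> 0) (at x)"
        using tendsto_mult_right_zero[OF tendsto_norm_zero[OF c]] .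
    qed
    then have "((\<lambda>y. ?f y *\<^sub>R (B y b - B x b)) has_derivative (\<lambda>h. 0)) (at x)"
      unfolding has_derivative_at_within
      by (auto simp: divide_inverse mult.commute)
    from has_derivative_add[OF this has_derivative_scaleR_left[OF f, of "B x b"]]
    show ?thesis by (simp add: algebra_simps)
  qed
  have "((\<lambda>y. \<Sum>b\<in>Basis. ((A y w - A x w) \<bullet> b) *\<^sub>R B y b) has_derivative
      (\<lambda>h. \<Sum>b\<in>Basis. (A' x h w \<bullet> b) *\<^sub>R B x b)) (at x)"
    by (rule has_derivative_sum) (rule mult)
  moreover have "(\<Sum>b\<in>Basis. (A' x h w \<bullet> b) *\<^sub>R B x b) = B x (A' x h w)" for h
    using linear_expand[OF lin(2)[OF x]] by metis
  ultimately have "(R has_derivative (\<lambda>h. B x (A' x h w))) (at x)"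
    by (simp add: has_derivative_cong_open[OF S x R_exp])
  then have "((\<lambda>y. w - R y) has_derivative (\<lambda>h. - B x (A' x h w))) (at x)"
    by (auto intro!: derivative_eq_intros)
  moreover have "w - R y = B y v" if "y \<in> S" for y
    using that x by (simp add: R_def w_def AB BA linear_diff[OF lin(2)[OF that]])
  ultimately show ?thesis
    using has_derivative_cong_open[OF S x, of "\<lambda>y. w - R y" "\<lambda>y. B y v"] unfolding w_def by blast
qed

text \<open>Bootstrap: the derivative of a column of \<open>B\<close> is an expression in
  \<open>B\<close> and the derivative of \<open>A\<close>, hence of class \<open>C^k\<close> once
  \<open>B\<close> is; so \<open>B\<close> gains one order at each step.\<close>

lemma Ck_on_inverse_family:
  fixes A B :: "'a::euclidean_space \<Rightarrow> 'b::euclidean_space \<Rightarrow> 'b"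
  assumes S: "open S" and lin: "\<And>x. x \<in> S \<Longrightarrow> linear (A x)" "\<And>x. x \<in> S \<Longrightarrow> linear (B x)"
    and AB: "\<And>x v. x \<in> S \<Longrightarrow> A x (B x v) = v" and BA: "\<And>x v. x \<in> S \<Longrightarrow> B x (A x v) = v"
    and contB: "\<And>v. continuous_on S (\<lambda>x. B x v)"
    and "\<And>v. Ck_on k S (\<lambda>x. A x v)"
  shows "Ck_on k S (\<lambda>x. B x v)"
  using assms(7)
proof (induction k arbitrary: v)
  case 0
  then show ?case using contB by simp
next
  case (Suc k)
  have "\<exists>f'. (\<forall>x\<in>S. ((\<lambda>x. A x v) has_derivative f' x) (at x)) \<and> (\<forall>h. Ck_on k S (\<lambda>x. f' x h))" for v
    using Suc.prems unfolding Ck_on_Suc_iff[OF S] .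
  then obtain f' where f': "\<And>v x. x \<in> S \<Longrightarrow> ((\<lambda>x. A x v) has_derivative f' v x) (at x)"
     "\<And>v h. Ck_on k S (\<lambda>x. f' v x h)" by metis
  have IH: "Ck_on k S (\<lambda>x. B x v)" for v by (rule Suc.IH) (rule Ck_on_Suc_imp[OF Suc.prems])
  \<comment> \<open>Linearity of the derivative in the parameter \<open>w\<close> is inherited from
    that of \<open>A x\<close>, since derivatives at a point are unique.\<close>
  have linf: "linear (\<lambda>w. f' w x h)" if x: "x \<in> S" for x h
  proof (rule linearI)
    fix v w c
    have *: "((\<lambda>y. A y (v + w)) has_derivative (\<lambda>h. f' v x h + f' w x h)) (at x)"
      by (rule has_derivative_transform_within_open[OF has_derivative_add[OF f'(1)[OF x] f'(1)[OF x]] S x])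
         (simp add: linear_add lin(1))
    show "f' (v + w) x h = f' v x h + f' w x h"
      using has_derivative_unique[OF f'(1)[OF x] *] by metis
    have *: "((\<lambda>y. A y (c *\<^sub>R v)) has_derivative (\<lambda>h. c *\<^sub>R f' v x h)) (at x)"
      by (rule has_derivative_transform_within_open[OF has_derivative_scaleR_right[OF f'(1)[OF x]] S x])
         (simp add: linear_cmul lin(1))
    show "f' (c *\<^sub>R v) x h = c *\<^sub>R f' v x h"
      using has_derivative_unique[OF f'(1)[OF x] *] by metis
  qed
  have "((\<lambda>x. B x v) has_derivative (\<lambda>h. - B x (f' (B x v) x h))) (at x)" if "x \<in> S" for x
    by (rule has_derivative_inverse_family[where A = A and S = S and A' = "\<lambda>x h v. f' v x h"])
       (use assms f' that in auto)
  moreover have "Ck_on k S (\<lambda>x. - B x (f' (B x v) x h))" for h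
  proof (rule Ck_on_linear_compose[OF S, where L="\<lambda>x. - x"])
    show "Ck_on k S (\<lambda>x. B x (f' (B x v) x h))"
    proof (rule Ck_on_apply_linear[OF S, where L=B and w="\<lambda>x. f' (B x v) x h"])
      show "Ck_on k S (\<lambda>x. f' (B x v) x h)"
        by (rule Ck_on_apply_linear[OF S, where L="\<lambda>x w. f' w x h" and w="\<lambda>x. B x v"])
           (rule linf f'(2) IH; assumption?)+
    qed (rule lin IH; assumption?)+
  qed (simp add: linearI)
  ultimately show ?case unfolding Ck_on_Suc_iff[OF S]
    by (intro exI[of _ "\<lambda>x h. - B x (f' (B x v) x h)"]) auto
qed

text \<open>The same bootstrap for maps: \<open>g' y\<close> is the inverse of
  \<open>f' (g y)\<close>, so it is of class \<open>C^k\<close> when \<open>g\<close> is. The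
  starting point, a derivative of \<open>g\<close> that is continuous, is assumed here and supplied
  by the inverse function theorem.\<close>

lemma Ck_on_inverse:
  fixes f g :: "'a::euclidean_space \<Rightarrow> 'a"
  assumes S: "open S" and T: "open T" and f: "Ck_on k S f" and gT: "g ` T \<subseteq> S"
    and fg: "\<And>y. y \<in> T \<Longrightarrow> f (g y) = y"
    and dg: "\<And>y. y \<in> T \<Longrightarrow> (g has_derivative g' y) (at y)"
    and cg': "\<And>v. continuous_on T (\<lambda>y. g' y v)"
  shows "Ck_on k T g"
  using f
proof (induction k)
  case 0
  have "g differentiable_on T"
    using dg by (meson differentiable_def differentiable_on_def differentiable_at_withinI)
  then show ?case by (simp add: differentiable_imp_continuous_on)
next
  case (Suc k)
  then obtain f' where f': "\<And>x. x \<in> S \<Longrightarrow> (f has_derivative f' x) (at x)" "\<And>v. Ck_on k S (\<lambda>x. f' x v)"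
    unfolding Ck_on_Suc_iff[OF S] by metis
  have gy: "g y \<in> S" if "y \<in> T" for y using that gT by blast
  have l: "linear (f' (g y))" "linear (g' y)" if "y \<in> T" for y
    using f'(1)[OF gy[OF that]] dg[OF that] has_derivative_linear by blast+
  have fg': "f' (g y) (g' y v) = v" if "y \<in> T" for y v
  proof -
    have "((\<lambda>y. f (g y)) has_derivative (\<lambda>v. f' (g y) (g' y v))) (at y)"
      using has_derivative_compose[OF dg[OF that] f'(1)[OF gy[OF that]]] .
    moreover have "((\<lambda>y. f (g y)) has_derivative (\<lambda>v. v)) (at y)"
      by (rule has_derivative_transform_within_open[OF has_derivative_ident T that]) (simp add: fg)
    ultimately show ?thesis using has_derivative_unique by metis
  qed
  \<comment> \<open>In finite dimension a right inverse of an endomorphism is also a left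
    inverse.\<close>
  have gf': "g' y (f' (g y) v) = v" if "y \<in> T" for y v
    using linear_inverse_left[OF l[OF that]] fg'[OF that] by (metis comp_apply ext id_apply)
  have IH: "Ck_on k T g" using Suc Ck_on_Suc_imp by blast
  have "Ck_on k T (\<lambda>y. g' y v)" for v
    by (rule Ck_on_inverse_family[where A="\<lambda>y. f' (g y)"])
       (use T l fg' gf' cg' IH Ck_on_compose[OF T S IH f'(2) gT] in auto)
  then show ?case unfolding Ck_on_Suc_iff[OF T] using dg by blast
qed

section \<open>The classes \<open>C^r\<close>, with \<open>r\<close> finite or infinite, and the
  inverse function theorem in class \<open>C^r\<close>\<close>

lemma C_on_cong: "open S \<Longrightarrow> (\<And>x. x \<in> S \<Longrightarrow> f x = g x) \<Longrightarrow> C_on r S f \<longleftrightarrow> C_on r S g"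
  unfolding C_on_def using Ck_on_cong by metis

lemma C_on_subset: "C_on r S f \<Longrightarrow> T \<subseteq> S \<Longrightarrow> C_on r T f"
  unfolding C_on_def using Ck_on_subset by metis

lemma C_on_mono: "C_on r S f \<Longrightarrow> s \<le> r \<Longrightarrow> C_on s S f"
  by (auto simp: C_on_def intro: order_trans)

lemma C_on_local:
  assumes "\<And>x. x \<in> S \<Longrightarrow> \<exists>U. open U \<and> x \<in> U \<and> C_on r U f"
  shows "C_on r S f"
  unfolding C_on_def
proof (intro allI impI Ck_on_local)
  fix k x assume "enat k \<le> r" "x \<in> S"
  then show "\<exists>U. open U \<and> x \<in> U \<and> Ck_on k U f"
    using assms[of x] by (auto simp: C_on_def)
qed

lemma C_on_linear: "linear f \<Longrightarrow> C_on r S f"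
  unfolding C_on_def by (simp add: Ck_on_linear)

lemma C_on_const: "C_on r S (\<lambda>x. c)"
  unfolding C_on_def by (simp add: Ck_on_const)

lemma C_on_add: "open S \<Longrightarrow> C_on r S f \<Longrightarrow> C_on r S g \<Longrightarrow> C_on r S (\<lambda>x. f x + g x)"
  unfolding C_on_def by (simp add: Ck_on_add)

lemma C_on_compose:
  "open S \<Longrightarrow> open T \<Longrightarrow> C_on r S f \<Longrightarrow> C_on r T g \<Longrightarrow> f ` S \<subseteq> T \<Longrightarrow> C_on r S (\<lambda>x. g (f x))"
  by (auto simp: C_on_def intro: Ck_on_compose)

lemma C_on_imp_continuous: "C_on r S f \<Longrightarrow> continuous_on S f"
  unfolding C_on_def by (drule spec[of _ 0]) (simp add: zero_enat_def[symmetric])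

lemma C_on_imp_Ck_1:
  assumes "C_on r S f" "1 \<le> r" shows "Ck_on (Suc 0) S f"
  using assms unfolding C_on_def one_enat_def One_nat_def by blast

lemma C_on_has_derivative:
  "C_on r S f \<Longrightarrow> 1 \<le> r \<Longrightarrow> x \<in> S \<Longrightarrow> (f has_derivative frechet_derivative f (at x)) (at x)"
  using C_on_imp_Ck_1[of r S f] by (simp add: frechet_derivative_works[symmetric])

lemma C_on_continuous_derivative:
  "C_on r S f \<Longrightarrow> 1 \<le> r \<Longrightarrow> continuous_on S (\<lambda>x. frechet_derivative f (at x) v)"
  using C_on_imp_Ck_1[of r S f] by simp

text \<open>The classical theorem yields a differentiable local inverse \<open>g\<close> with
  \<open>g' y\<close> inverse to \<open>f' (g y)\<close>. What is added is continuity of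
  \<open>g'\<close>; then \<open>Ck_on_inverse\<close> raises \<open>g\<close> to every order up to
  \<open>r\<close>.\<close>

lemma C_on_inverse_function:
  fixes f :: "'a::euclidean_space \<Rightarrow> 'a"
  assumes S: "open S" and r: "1 \<le> r" and f: "C_on r S f" and x0: "x0 \<in> S"
    and inj: "inj (frechet_derivative f (at x0))"
  obtains U V g where "open U" "U \<subseteq> S" "x0 \<in> U" "open V" "homeomorphism U V f g" "C_on r V g"
    "\<And>y. y \<in> V \<Longrightarrow> (g has_derivative frechet_derivative g (at y)) (at y)"
    "\<And>y v. y \<in> V \<Longrightarrow> frechet_derivative f (at (g y)) (frechet_derivative g (at y) v) = v"
    "\<And>y v. y \<in> V \<Longrightarrow> frechet_derivative g (at y) (frechet_derivative f (at (g y)) v) = v"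
proof -
  let ?D = "\<lambda>x. frechet_derivative f (at x)"
  define f' where "f' x = Blinfun (?D x)" for x
  have D: "(f has_derivative ?D x) (at x)" if "x \<in> S" for x
    using C_on_has_derivative[OF f r that] .
  have f'_app: "blinfun_apply (f' x) = ?D x" if "x \<in> S" for x
    unfolding f'_def using D[OF that] by (simp add: bounded_linear_Blinfun_apply has_derivative_bounded_linear)
  have cf': "continuous_on S f'"
    by (rule continuous_on_blinfun_componentwise)
       (use C_on_continuous_derivative[OF f r] f'_app in \<open>simp cong: continuous_on_cong\<close>)
  have lin0: "linear (?D x0)" using D[OF x0] has_derivative_linear by blast
  obtain h where h: "linear h" "h \<circ> ?D x0 = id"
    using linear_injective_left_inverse[OF lin0 inj] by blast
  have "Blinfun h o\<^sub>L f' x0 = id_blinfun"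
    by (rule blinfun_eqI)
      (use h f'_app[OF x0] in \<open>simp add: bounded_linear_Blinfun_apply linear_conv_bounded_linear o_def fun_eq_iff id_def\<close>)
  from inverse_function_theorem[OF S _ cf' x0 this, of f] D f'_app
  obtain U V g g' where UV: "open U" "U \<subseteq> S" "x0 \<in> U" "open V" "f x0 \<in> V" "homeomorphism U V f g"
    and g': "\<And>y. y \<in> V \<Longrightarrow> (g has_derivative g' y) (at y)"
      "\<And>y. y \<in> V \<Longrightarrow> g' y = inv (blinfun_apply (f' (g y)))"
      "\<And>y. y \<in> V \<Longrightarrow> bij (blinfun_apply (f' (g y)))"
    by metis
  have gV: "g y \<in> U" if "y \<in> V" for y using UV(6) that unfolding homeomorphism_def by blast
  have gS: "g y \<in> S" if "y \<in> V" for y using gV[OF that] UV(2) by blast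
  have fg: "f (g y) = y" if "y \<in> V" for y using UV(6) that unfolding homeomorphism_def by blast
  have fr: "frechet_derivative g (at y) = g' y" if "y \<in> V" for y
    using g'(1)[OF that] frechet_derivative_at by metis
  have i1: "?D (g y) (g' y v) = v" and i2: "g' y (?D (g y) v) = v" if "y \<in> V" for y v
    using g'(2,3)[OF that] f'_app[OF gS[OF that]]
    by (simp_all add: bij_is_surj surj_f_inv_f bij_is_inj inv_f_f)
  have cg': "continuous_on V (\<lambda>y. g' y v)" for v
    unfolding continuous_on_eq_continuous_at[OF UV(4)]
  proof
    fix y assume y: "y \<in> V"
    have lg: "bounded_linear (g' z)" if "z \<in> V" for z using g'(1)[OF that] has_derivative_bounded_linear by blast
    obtain K where K: "K > 0" "\<And>v. norm (g' y v) \<le> norm v * K"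
      using bounded_linear.pos_bounded[OF lg[OF y]] by blast
    have cy: "continuous_on V (\<lambda>z. f' (g z))"
      by (rule continuous_on_compose2[OF cf']) (use UV(2,6) gS in \<open>auto simp: homeomorphism_def\<close>)
    then have "((\<lambda>z. f' (g z)) \<longlongrightarrow> f' (g y)) (at y)"
      using y UV(4) by (metis continuous_on_def at_within_open)
    then have t0: "((\<lambda>z. norm (f' (g z) - f' (g y))) \<longlongrightarrow> 0) (at y)"
      by (metis LIM_zero tendsto_norm_zero)
    have ev1: "\<forall>\<^sub>F z in at y. norm (f' (g z) - f' (g y)) < 1 / (2 * K)"
      using order_tendstoD(2)[OF t0, of "1 / (2*K)"] K by simp
    have evV: "\<forall>\<^sub>F z in at y. z \<in> V" using eventually_at_in_open' UV(4) y by blast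
    have "\<forall>\<^sub>F z in at y. norm (g' z v - g' y v) \<le> K * (2 * K * norm v) * norm (f' (g z) - f' (g y))"
      using ev1 evV
    proof eventually_elim
      case (elim z)
      \<comment> \<open>The resolvent identity \<open>P - Q = - Q (P^-1 - Q^-1) P\<close> for
        \<open>P = g' z\<close> and \<open>Q = g' y\<close>.\<close>
      have eq: "g' z v - g' y v = - g' y (blinfun_apply (f' (g z) - f' (g y)) (g' z v))"
        using elim(2) y by (simp add: blinfun.diff_left f'_app gS i1 i2 bounded_linear.linear[OF lg] linear_diff)
      define \<epsilon> where "\<epsilon> = norm (f' (g z) - f' (g y))"
      have "norm (g' z v - g' y v) \<le> norm (blinfun_apply (f' (g z) - f' (g y)) (g' z v)) * K"
        unfolding eq using K(2) by simp
      also have "\<dots> \<le> (\<epsilon> * norm (g' z v)) * K"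
        using K(1) norm_blinfun by (auto simp: \<epsilon>_def intro: mult_right_mono)
      finally have b: "norm (g' z v - g' y v) \<le> (\<epsilon> * norm (g' z v)) * K" .
      \<comment> \<open>This is why \<open>ev1\<close> uses \<open>1 / (2 * K)\<close>: half of
        \<open>norm (g' z v)\<close> can be absorbed, which bounds \<open>g' z\<close> by twice the
        bound \<open>K\<close> of \<open>g' y\<close>.\<close>
      have "\<epsilon> * K \<le> 1/2" using elim(1) K(1) by (simp add: \<epsilon>_def field_simps)
      then have "(\<epsilon> * norm (g' z v)) * K \<le> 1/2 * norm (g' z v)"
        by (metis mult.assoc mult.commute mult_right_mono norm_ge_zero)
      with b have "norm (g' z v) \<le> norm (g' y v) + norm (g' z v) / 2"
        using norm_triangle_sub[of "g' z v" "g' y v"] by linarith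
      then have "norm (g' z v) \<le> 2 * K * norm v"
        using K(2)[of v] mult.commute[of K "norm v"] by linarith
      then have "(\<epsilon> * norm (g' z v)) * K \<le> (\<epsilon> * (2 * K * norm v)) * K"
        using K(1) by (intro mult_right_mono mult_left_mono) (auto simp: \<epsilon>_def)
      with b show ?case by (simp add: \<epsilon>_def mult_ac)
    qed
    moreover have "((\<lambda>z. K * (2 * K * norm v) * norm (f' (g z) - f' (g y))) \<longlongrightarrow> 0) (at y)"
      using tendsto_mult_right_zero[OF t0] by blast
    ultimately have "((\<lambda>z. g' z v - g' y v) \<longlongrightarrow> 0) (at y)"
      by (rule Lim_null_comparison)
    then show "continuous (at y) (\<lambda>y. g' y v)"
      unfolding isCont_def by (rule LIM_zero_cancel)
  qed
  have "Ck_on k V g" if "enat k \<le> r" for k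
  proof (rule Ck_on_inverse[OF S UV(4) _ _ fg g'(1) cg'])
    show "Ck_on k S f" using f that by (simp add: C_on_def)
    show "g ` V \<subseteq> S" using gS by blast
  qed assumption+
  then have "C_on r V g" by (simp add: C_on_def)
  with UV(1-4,6) show thesis
    by (rule that) (use g'(1) i1 i2 fr in auto)
qed

section \<open>Charts\<close>

context
  fixes X :: "'a topology" and S :: "'v::euclidean_space set" and c :: "('a, 'v) chart"
  assumes c: "is_chart X S c"
begin

lemma chart_openin: "openin X (fst c)"
  using c by (simp add: is_chart_def)

lemma chart_subset: "fst c \<subseteq> topspace X"
  using chart_openin openin_subset by blast

lemma chart_inj_on: "inj_on (snd c) (fst c)"
proof -
  have "inj_on (snd c) (topspace (subtopology X (fst c)))"
    using c homeomorphic_imp_injective_map unfolding is_chart_def by blast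
  then show ?thesis using chart_subset by (simp add: inf_absorb2)
qed

lemma cinv_chart [simp]: "y \<in> fst c \<Longrightarrow> cinv c (snd c y) = y"
  unfolding cinv_def by (rule inv_into_f_f[OF chart_inj_on])

lemma cinv_in: "u \<in> snd c ` fst c \<Longrightarrow> cinv c u \<in> fst c"
  unfolding cinv_def by (rule inv_into_into)

lemma chart_cinv: "u \<in> snd c ` fst c \<Longrightarrow> snd c (cinv c u) = u"
  unfolding cinv_def by (rule f_inv_into_f)

lemma continuous_map_chart: "continuous_map (subtopology X (fst c)) euclidean (snd c)"
proof -
  have "continuous_map (subtopology X (fst c)) (top_of_set (snd c ` fst c)) (snd c)"
    using c homeomorphic_imp_continuous_map unfolding is_chart_def by blast
  then show ?thesis by (simp add: continuous_map_in_subtopology)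
qed

lemma continuous_map_cinv: "continuous_map (top_of_set (snd c ` fst c)) X (cinv c)"
proof -
  obtain g where g: "homeomorphic_maps (subtopology X (fst c)) (top_of_set (snd c ` fst c)) (snd c) g"
    using c unfolding is_chart_def homeomorphic_map_maps by blast
  have *: "continuous_map (top_of_set (snd c ` fst c)) X g"
    using g unfolding homeomorphic_maps_def by (simp add: continuous_map_in_subtopology)
  have "g u = cinv c u" if "u \<in> snd c ` fst c" for u
  proof -
    obtain y where y: "y \<in> fst c" "u = snd c y" using \<open>u \<in> snd c ` fst c\<close> by blast
    then show ?thesis using g chart_subset unfolding homeomorphic_maps_def by auto
  qed
  then show ?thesis
    by (intro continuous_map_eq[OF *]) simp
qed

lemma openin_chart_preimage:
  assumes "open V" shows "openin X {y \<in> fst c. snd c y \<in> V}"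
proof -
  have "openin (subtopology X (fst c)) {y \<in> topspace (subtopology X (fst c)). snd c y \<in> V}"
    using openin_continuous_map_preimage[OF continuous_map_chart, of V] assms by (simp only: open_openin)
  moreover have "{y \<in> topspace (subtopology X (fst c)). snd c y \<in> V} = {y \<in> fst c. snd c y \<in> V}"
    using chart_subset by auto
  ultimately show ?thesis using openin_trans_full[OF _ chart_openin] by metis
qed

lemma openin_chart_image:
  assumes "openin X W" "W \<subseteq> fst c"
  shows "openin (top_of_set (snd c ` fst c)) (snd c ` W)"
proof -
  have "openin (subtopology X (fst c)) W"
    using assms by (metis inf.absorb_iff2 inf_commute openin_subtopology_Int)
  moreover have "homeomorphic_map (subtopology X (fst c)) (top_of_set (snd c ` fst c)) (snd c)"
    using c by (simp add: is_chart_def)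
  ultimately show ?thesis
    using homeomorphic_imp_open_map open_map_def by blast
qed

end

context
  fixes X :: "'a topology" and c :: "('a, 'v::euclidean_space) chart"
  assumes c: "is_chart X UNIV c"
begin

lemma open_chart_range: "open (snd c ` fst c)"
  using c by (simp add: is_chart_def)

lemma open_chart_image: "openin X W \<Longrightarrow> W \<subseteq> fst c \<Longrightarrow> open (snd c ` W)"
  using openin_chart_image[OF c] open_chart_range openin_open_trans by (metis openin_open_eq)

lemma eventually_chart:
  assumes "x \<in> fst c" "openin X W" "x \<in> W"
  shows "\<forall>\<^sub>F u in nhds (snd c x). u \<in> snd c ` fst c \<and> cinv c u \<in> W \<inter> fst c"
proof -
  have "open (snd c ` (W \<inter> fst c))"
    by (rule open_chart_image) (use assms chart_openin[OF c] in auto)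
  moreover have "snd c x \<in> snd c ` (W \<inter> fst c)" using assms by blast
  ultimately have "\<forall>\<^sub>F u in nhds (snd c x). u \<in> snd c ` (W \<inter> fst c)"
    by (rule eventually_nhds_in_open)
  then show ?thesis
    by eventually_elim (use cinv_chart[OF c] in auto)
qed

end

section \<open>Differential calculus on manifolds\<close>

text \<open>\<open>has_mderiv\<close> and \<open>has_pderiv\<close> express the differentials of maps from \<open>M\<close> to a Euclidean space
  and from a Euclidean space to \<open>M\<close> in preferred charts. \<open>cvec\<close> is \<open>coord_vec\<close> for charts with values in
  an arbitrary Euclidean space.\<close>

definition has_mderiv ::
  "('a, 'e::euclidean_space) manifold \<Rightarrow> ('a \<Rightarrow> 'v::euclidean_space) \<Rightarrow> ('e \<Rightarrow> 'v) \<Rightarrow> 'a \<Rightarrow> bool" where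
  "has_mderiv M f D x \<longleftrightarrow> ((f \<circ> cinv (chart_at M x)) has_derivative D) (at (snd (chart_at M x) x))"

definition has_pderiv ::
  "('a, 'e::euclidean_space) manifold \<Rightarrow> ('w::euclidean_space \<Rightarrow> 'a) \<Rightarrow> ('w \<Rightarrow> 'e) \<Rightarrow> 'w \<Rightarrow> bool" where
  "has_pderiv M F D u \<longleftrightarrow> (\<forall>\<^sub>F w in nhds u. F w \<in> fst (chart_at M (F u))) \<and>
     ((snd (chart_at M (F u)) \<circ> F) has_derivative D) (at u)"

definition cvec ::
  "('a, 'e::euclidean_space) manifold \<Rightarrow> ('a, 'v::euclidean_space) chart \<Rightarrow> 'a \<Rightarrow> 'v \<Rightarrow> 'e" where
  "cvec M k x = frechet_derivative (snd (chart_at M x) \<circ> cinv k) (at (snd k x))"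

lemma has_derivative_cong_eventually:
  assumes "\<forall>\<^sub>F w in nhds u. f w = g w"
  shows "(f has_derivative D) (at u) \<longleftrightarrow> (g has_derivative D) (at u)"
proof -
  obtain S where "open S" "u \<in> S" "\<And>w. w \<in> S \<Longrightarrow> f w = g w"
    using assms unfolding eventually_nhds by blast
  then show ?thesis by (rule has_derivative_cong_open)
qed

lemma has_derivative_transform_nhds:
  "\<forall>\<^sub>F w in nhds u. f w = g w \<Longrightarrow> (f has_derivative D) (at u) \<Longrightarrow> (g has_derivative D) (at u)"
  using has_derivative_cong_eventually[of f g u D] by blast

lemma eventually_nhds_compose:
  assumes "(p has_derivative p') (at w)" "\<forall>\<^sub>F u in nhds (p w). P u"
  shows "\<forall>\<^sub>F w in nhds w. P (p w)"
proof -
  have "isCont p w" using has_derivative_continuous[OF assms(1)] .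
  then have "filterlim p (nhds (p w)) (nhds w)"
    by (simp add: isCont_def tendsto_at_iff_tendsto_nhds)
  then show ?thesis using assms(2) by (simp add: filterlim_iff)
qed

lemma mderiv_eq: "has_mderiv M f D x \<Longrightarrow> mderiv M f x = D"
  unfolding has_mderiv_def mderiv_def by (simp add: frechet_derivative_at[symmetric])

lemma has_mderiv_linear: "has_mderiv M f D x \<Longrightarrow> linear D"
  unfolding has_mderiv_def using has_derivative_linear by blast

lemma has_pderiv_linear: "has_pderiv M F D u \<Longrightarrow> linear D"
  unfolding has_pderiv_def using has_derivative_linear by blast

lemma has_pderiv_unique: "has_pderiv M F D u \<Longrightarrow> has_pderiv M F D' u \<Longrightarrow> D = D'"
  unfolding has_pderiv_def using has_derivative_unique by blast

lemma has_pderiv_cong: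
  assumes "\<forall>\<^sub>F w in nhds u. F w = G w" "has_pderiv M F D u"
  shows "has_pderiv M G D u"
proof -
  have eq: "F u = G u" using assms(1) by (rule eventually_nhds_x_imp_x)
  have "\<forall>\<^sub>F w in nhds u. (snd (chart_at M (F u)) \<circ> F) w = (snd (chart_at M (F u)) \<circ> G) w"
    using assms(1) by eventually_elim simp
  moreover have "\<forall>\<^sub>F w in nhds u. G w \<in> fst (chart_at M (F u))"
    using assms(1) assms(2)[unfolded has_pderiv_def, THEN conjunct1] by eventually_elim simp
  ultimately show ?thesis
    using assms(2) has_derivative_transform_nhds[of "snd (chart_at M (F u)) \<circ> F" "snd (chart_at M (F u)) \<circ> G" u D]
    by (simp add: has_pderiv_def eq)
qed

lemma has_pderiv_compose:
  assumes "has_pderiv M F F' (p w)" "(p has_derivative p') (at w)"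
  shows "has_pderiv M (\<lambda>w. F (p w)) (\<lambda>v. F' (p' v)) w"
  using eventually_nhds_compose[OF assms(2)] has_derivative_compose[OF assms(2)] assms(1)
  unfolding has_pderiv_def o_def by blast

lemma has_mderiv_compose:
  assumes "has_mderiv M f D x" "(g has_derivative g') (at (f x))" "cinv (chart_at M x) (snd (chart_at M x) x) = x"
  shows "has_mderiv M (\<lambda>y. g (f y)) (\<lambda>v. g' (D v)) x"
  using has_derivative_compose[OF assms(1)[unfolded has_mderiv_def], of g g'] assms(2,3)
  unfolding has_mderiv_def o_def by simp

lemma Cr_chart_mono: "Cr_chart r M k \<Longrightarrow> s \<le> r \<Longrightarrow> Cr_chart s M k"
  by (auto simp: Cr_chart_def intro: C_on_mono)

lemma Cr_chart_is_chart: "Cr_chart r M k \<Longrightarrow> is_chart (mtop M) UNIV k"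
  by (simp add: Cr_chart_def)

locale smooth_mfd =
  fixes M :: "('a, 'e::euclidean_space) manifold"
  assumes smooth_M: "smooth_manifold M"
begin

lemma atl_is_chart: "c \<in> atl M \<Longrightarrow> is_chart (mtop M) UNIV c"
  using smooth_M by (simp add: smooth_manifold_def)

lemma atl_Cr_chart: "c \<in> atl M \<Longrightarrow> Cr_chart r M c"
proof -
  assume c: "c \<in> atl M"
  have *: "C_on r (snd c ` (fst c \<inter> fst d)) (snd d \<circ> cinv c)" if "c \<in> atl M" "d \<in> atl M" for c d
    by (rule C_on_mono[of \<infinity>]) (use smooth_M that in \<open>auto simp: smooth_manifold_def\<close>)
  show ?thesis
    unfolding Cr_chart_def
    using *[OF c] *[OF _ c] atl_is_chart[OF c] by (metis Int_commute)
qed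

lemma chart_at_atl: "x \<in> topspace (mtop M) \<Longrightarrow> chart_at M x \<in> atl M"
  and chart_at_mem: "x \<in> topspace (mtop M) \<Longrightarrow> x \<in> fst (chart_at M x)"
proof -
  assume "x \<in> topspace (mtop M)"
  then have "\<exists>c. c \<in> atl M \<and> x \<in> fst c" using smooth_M unfolding smooth_manifold_def by blast
  then have "chart_at M x \<in> atl M \<and> x \<in> fst (chart_at M x)" unfolding chart_at_def by (rule someI_ex)
  then show "chart_at M x \<in> atl M" "x \<in> fst (chart_at M x)" by auto
qed

lemma chart_at_is_chart: "x \<in> topspace (mtop M) \<Longrightarrow> is_chart (mtop M) UNIV (chart_at M x)"
  using atl_is_chart chart_at_atl by blast

lemma cinv_chart_at: "x \<in> topspace (mtop M) \<Longrightarrow> cinv (chart_at M x) (snd (chart_at M x) x) = x"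
  using cinv_chart[OF chart_at_is_chart chart_at_mem] .

lemma Cr_chart_topspace: "Cr_chart r M k \<Longrightarrow> x \<in> fst k \<Longrightarrow> x \<in> topspace (mtop M)"
  using chart_subset[OF Cr_chart_is_chart] by blast

lemma has_derivative_chain:
  assumes F: "has_pderiv M F F' u" and x: "F u \<in> topspace (mtop M)" and f: "has_mderiv M f D (F u)"
  shows "((\<lambda>w. f (F w)) has_derivative (\<lambda>v. D (F' v))) (at u)"
proof -
  let ?c = "chart_at M (F u)"
  have ev: "\<forall>\<^sub>F w in nhds u. F w \<in> fst ?c" and dF: "((snd ?c \<circ> F) has_derivative F') (at u)"
    using F by (simp_all add: has_pderiv_def)
  have "((f \<circ> cinv ?c) has_derivative D) (at ((snd ?c \<circ> F) u))"
    using f by (simp add: has_mderiv_def)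
  from has_derivative_compose[OF dF this]
  have "((\<lambda>w. f (cinv ?c (snd ?c (F w)))) has_derivative (\<lambda>v. D (F' v))) (at u)" by (simp add: o_def)
  moreover have "\<forall>\<^sub>F w in nhds u. f (cinv ?c (snd ?c (F w))) = f (F w)"
    using ev by eventually_elim (simp add: cinv_chart[OF chart_at_is_chart[OF x]])
  ultimately show ?thesis by (rule has_derivative_transform_nhds[rotated])
qed

lemma has_mderiv_cong:
  assumes x: "x \<in> topspace (mtop M)" and W: "openin (mtop M) W" "x \<in> W"
    and eq: "\<And>y. y \<in> W \<Longrightarrow> f y = g y" and f: "has_mderiv M f D x"
  shows "has_mderiv M g D x"
proof -
  have "\<forall>\<^sub>F u in nhds (snd (chart_at M x) x). (f \<circ> cinv (chart_at M x)) u = (g \<circ> cinv (chart_at M x)) u"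
    using eventually_chart[OF chart_at_is_chart[OF x] chart_at_mem[OF x] W]
    by eventually_elim (simp add: eq)
  then show ?thesis
    using f unfolding has_mderiv_def by (rule has_derivative_transform_nhds)
qed

lemma has_mderiv_chart:
  assumes k: "Cr_chart r M k" "1 \<le> r" and x: "x \<in> fst k"
  shows "has_mderiv M (snd k) (mderiv M (snd k) x) x"
proof -
  have t: "x \<in> topspace (mtop M)" using Cr_chart_topspace k x by blast
  have "C_on r (snd (chart_at M x) ` (fst k \<inter> fst (chart_at M x))) (snd k \<circ> cinv (chart_at M x))"
    using k(1) chart_at_atl[OF t] unfolding Cr_chart_def by blast
  from C_on_has_derivative[OF this k(2)] show ?thesis
    unfolding has_mderiv_def mderiv_def using x chart_at_mem[OF t] by blast
qed

lemma has_pderiv_cinv: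
  assumes k: "Cr_chart r M k" "1 \<le> r" and x: "x \<in> fst k"
  shows "has_pderiv M (cinv k) (cvec M k x) (snd k x)"
proof -
  have t: "x \<in> topspace (mtop M)" using Cr_chart_topspace k x by blast
  have [simp]: "cinv k (snd k x) = x" using cinv_chart[OF Cr_chart_is_chart[OF k(1)] x] .
  have "C_on r (snd k ` (fst k \<inter> fst (chart_at M x))) (snd (chart_at M x) \<circ> cinv k)"
    using k(1) chart_at_atl[OF t] unfolding Cr_chart_def by blast
  from C_on_has_derivative[OF this k(2), of "snd k x"]
  have "((snd (chart_at M x) \<circ> cinv k) has_derivative cvec M k x) (at (snd k x))"
    unfolding cvec_def using x chart_at_mem[OF t] by blast
  moreover have "\<forall>\<^sub>F w in nhds (snd k x). cinv k w \<in> fst (chart_at M x)"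
    using eventually_chart[OF Cr_chart_is_chart[OF k(1)] x
        chart_openin[OF chart_at_is_chart[OF t]] chart_at_mem[OF t]]
    by eventually_elim blast
  ultimately show ?thesis by (simp add: has_pderiv_def)
qed

lemma mderiv_cvec:
  assumes k: "Cr_chart r M k" "1 \<le> r" and x: "x \<in> fst k"
  shows "mderiv M (snd k) x (cvec M k x v) = v"
proof -
  have ch: "is_chart (mtop M) UNIV k" using Cr_chart_is_chart k by blast
  have t: "x \<in> topspace (mtop M)" using Cr_chart_topspace k x by blast
  have [simp]: "cinv k (snd k x) = x" using cinv_chart[OF ch x] .
  have "((\<lambda>w. snd k (cinv k w)) has_derivative (\<lambda>v. mderiv M (snd k) x (cvec M k x v))) (at (snd k x))"
    using has_derivative_chain[OF has_pderiv_cinv[OF k x]] has_mderiv_chart[OF k x] t by simp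
  moreover have "((\<lambda>w. snd k (cinv k w)) has_derivative (\<lambda>v. v)) (at (snd k x))"
  proof (rule has_derivative_transform_within_open[OF has_derivative_ident open_chart_range[OF ch]])
    show "snd k x \<in> snd k ` fst k" using x by blast
  qed (use chart_cinv[OF ch] in auto)
  ultimately show ?thesis using has_derivative_unique by metis
qed

lemma cvec_mderiv:
  assumes k: "Cr_chart r M k" "1 \<le> r" and x: "x \<in> fst k"
  shows "cvec M k x (mderiv M (snd k) x v) = v"
proof -
  let ?c = "chart_at M x"
  have t: "x \<in> topspace (mtop M)" using Cr_chart_topspace k x by blast
  have ch: "is_chart (mtop M) UNIV ?c" using chart_at_is_chart[OF t] .
  have chk: "is_chart (mtop M) UNIV k" using Cr_chart_is_chart k by blast
  have [simp]: "cinv k (snd k x) = x" using cinv_chart[OF chk x] .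
  have 1: "((\<lambda>u. snd k (cinv ?c u)) has_derivative mderiv M (snd k) x) (at (snd ?c x))"
    using has_mderiv_chart[OF k x] by (simp add: has_mderiv_def o_def)
  have 2: "((snd ?c \<circ> cinv k) has_derivative cvec M k x) (at (snd k (cinv ?c (snd ?c x))))"
    using has_pderiv_cinv[OF k x] by (simp add: has_pderiv_def cinv_chart_at[OF t])
  have 3: "((\<lambda>u. (snd ?c \<circ> cinv k) (snd k (cinv ?c u))) has_derivative
      (\<lambda>v. cvec M k x (mderiv M (snd k) x v))) (at (snd ?c x))"
    using has_derivative_compose[OF 1 2] .
  have "\<forall>\<^sub>F u in nhds (snd ?c x). (snd ?c \<circ> cinv k) (snd k (cinv ?c u)) = u"
    using eventually_chart[OF ch chart_at_mem[OF t] chart_openin[OF chk] x]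
    by eventually_elim (use chart_cinv[OF ch] cinv_chart[OF chk] in auto)
  from has_derivative_transform_nhds[OF this 3]
  have "((\<lambda>u. u) has_derivative (\<lambda>v. cvec M k x (mderiv M (snd k) x v))) (at (snd ?c x))" .
  then show ?thesis using has_derivative_unique[OF has_derivative_ident] by metis
qed

lemma linear_mderiv_chart:
  "Cr_chart r M k \<Longrightarrow> 1 \<le> r \<Longrightarrow> x \<in> fst k \<Longrightarrow> linear (mderiv M (snd k) x)"
  using has_mderiv_linear[OF has_mderiv_chart] .

lemma linear_cvec:
  "Cr_chart r M k \<Longrightarrow> 1 \<le> r \<Longrightarrow> x \<in> fst k \<Longrightarrow> linear (cvec M k x)"
  using has_pderiv_linear[OF has_pderiv_cinv] .

text \<open>Tangent vectors at \<open>x\<close> are by convention coordinates in the preferred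
  chart, so its inverse has the identity as differential. Composing with it turns facts on maps out
  of Euclidean spaces into facts on tangent maps.\<close>

lemma has_pderiv_cinv_chart_at:
  assumes "x \<in> topspace (mtop M)"
  shows "has_pderiv M (cinv (chart_at M x)) (\<lambda>v. v) (snd (chart_at M x) x)"
proof -
  let ?c = "chart_at M x"
  have ch: "is_chart (mtop M) UNIV ?c" using chart_at_is_chart assms .
  have "\<forall>\<^sub>F u in nhds (snd ?c x). cinv ?c u \<in> fst ?c \<and> (\<lambda>v. v) u = (snd ?c \<circ> cinv ?c) u"
    using eventually_chart[OF ch chart_at_mem[OF assms] chart_openin[OF ch] chart_at_mem[OF assms]]
    by eventually_elim (use chart_cinv[OF ch] in auto)
  then show ?thesis
    unfolding has_pderiv_def cinv_chart_at[OF assms]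
    using has_derivative_transform_nhds[of "\<lambda>v. v" "snd ?c \<circ> cinv ?c" "snd ?c x" "\<lambda>v. v"]
    by (simp add: eventually_conj_iff)
qed

text \<open>By definition \<open>C^r\<close> charts are compared only with the smooth atlas; near
  each point the transition factors through the preferred chart there.\<close>

lemma Cr_chart_transition:
  assumes k: "Cr_chart r M k" and l: "Cr_chart r M l"
  shows "C_on r (snd k ` (fst k \<inter> fst l)) (\<lambda>u. snd l (cinv k u))"
proof (rule C_on_local)
  fix u assume "u \<in> snd k ` (fst k \<inter> fst l)"
  then obtain x where x: "x \<in> fst k" "x \<in> fst l" "u = snd k x" by blast
  have t: "x \<in> topspace (mtop M)" using Cr_chart_topspace k x by blast
  let ?c = "chart_at M x"
  note chk = Cr_chart_is_chart[OF k] and chl = Cr_chart_is_chart[OF l] and chc = chart_at_is_chart[OF t]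
  let ?W = "fst k \<inter> fst l \<inter> fst ?c"
  have W: "openin (mtop M) ?W"
    by (simp add: openin_Int chart_openin[OF chk] chart_openin[OF chl] chart_openin[OF chc])
  have o: "open (snd k ` ?W)" "open (snd ?c ` ?W)"
    using open_chart_image[OF chk W] open_chart_image[OF chc W] by blast+
  have "C_on r (snd k ` ?W) (\<lambda>u. (snd l \<circ> cinv ?c) ((snd ?c \<circ> cinv k) u))"
  proof (rule C_on_compose[OF o])
    show "C_on r (snd k ` ?W) (snd ?c \<circ> cinv k)"
      by (rule C_on_subset[of r "snd k ` (fst k \<inter> fst ?c)"])
         (use k chart_at_atl[OF t] in \<open>auto simp: Cr_chart_def\<close>)
    show "C_on r (snd ?c ` ?W) (snd l \<circ> cinv ?c)"
      by (rule C_on_subset[of r "snd ?c ` (fst l \<inter> fst ?c)"])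
         (use l chart_at_atl[OF t] in \<open>auto simp: Cr_chart_def\<close>)
    show "(snd ?c \<circ> cinv k) ` snd k ` ?W \<subseteq> snd ?c ` ?W"
      using cinv_chart[OF chk] by auto
  qed
  moreover have "C_on r (snd k ` ?W) (\<lambda>u. (snd l \<circ> cinv ?c) ((snd ?c \<circ> cinv k) u)) \<longleftrightarrow>
      C_on r (snd k ` ?W) (\<lambda>u. snd l (cinv k u))"
    by (rule C_on_cong[OF o(1)]) (use cinv_chart[OF chk] cinv_chart[OF chc] in auto)
  ultimately have "C_on r (snd k ` ?W) (\<lambda>u. snd l (cinv k u))" by blast
  moreover have "u \<in> snd k ` ?W" using x chart_at_mem[OF t] by blast
  ultimately show "\<exists>U. open U \<and> u \<in> U \<and> C_on r U (\<lambda>u. snd l (cinv k u))"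
    using o(1) by blast
qed

end

section \<open>Smooth flows\<close>

locale flow_mfd = smooth_mfd +
  fixes \<phi> :: "real \<Rightarrow> 'a \<Rightarrow> 'a"
  assumes flow: "smooth_flow M \<phi>"
begin

lemma flow_continuous_map2: "continuous_map (prod_topology euclideanreal (mtop M)) (mtop M) (\<lambda>(t, x). \<phi> t x)"
  using flow by (simp add: smooth_flow_def)

lemma flow_continuous_map: "continuous_map (mtop M) (mtop M) (\<phi> t)"
proof -
  have "continuous_map (mtop M) (prod_topology euclideanreal (mtop M)) (\<lambda>x. (t, x))"
    by (simp add: continuous_map_pairedI)
  from continuous_map_compose[OF this flow_continuous_map2] show ?thesis
    by (simp add: o_def)
qed

lemma flow_orbit_continuous: "x \<in> topspace (mtop M) \<Longrightarrow> continuous_map euclideanreal (mtop M) (\<lambda>t. \<phi> t x)"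
proof -
  assume x: "x \<in> topspace (mtop M)"
  have "continuous_map euclideanreal (prod_topology euclideanreal (mtop M)) (\<lambda>t. (t, x))"
    using x by (simp add: continuous_map_pairedI)
  from continuous_map_compose[OF this flow_continuous_map2] show ?thesis
    by (simp add: o_def)
qed

lemma flow_topspace [simp]: "x \<in> topspace (mtop M) \<Longrightarrow> \<phi> t x \<in> topspace (mtop M)"
  using continuous_map_image_subset_topspace[OF flow_continuous_map] by blast

lemma flow_0: "x \<in> topspace (mtop M) \<Longrightarrow> \<phi> 0 x = x"
  using flow by (simp add: smooth_flow_def)

lemma flow_add: "x \<in> topspace (mtop M) \<Longrightarrow> \<phi> (s + t) x = \<phi> s (\<phi> t x)"
  using flow by (simp add: smooth_flow_def)

text \<open>\<open>tmap\<close> is defined by a choice of derivative, so existence has to be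
  supplied: the flow is smooth in \<open>(t, u)\<close> jointly, and \<open>t\<close> is
  frozen.\<close>

lemma flow_has_tmap:
  assumes x: "x \<in> topspace (mtop M)"
  shows "has_mderiv M (\<lambda>y. snd (chart_at M (\<phi> t x)) (\<phi> t y)) (tmap M (\<phi> t) x) x"
proof -
  let ?c = "chart_at M x" and ?d = "chart_at M (\<phi> t x)"
  let ?O = "{(t, u). u \<in> snd ?c ` fst ?c \<and> \<phi> t (cinv ?c u) \<in> fst ?d}"
  have m: "?c \<in> atl M" "?d \<in> atl M" using chart_at_atl flow_topspace x by blast+
  have C: "C_on \<infinity> ?O (\<lambda>(t, u). snd ?d (\<phi> t (cinv ?c u)))"
    using flow m unfolding smooth_flow_def by blast
  have O: "(t, snd ?c x) \<in> ?O"
    using x chart_at_mem[OF x] chart_at_mem[OF flow_topspace[OF x]] by (auto simp: cinv_chart_at)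
  have D: "((\<lambda>(t, u). snd ?d (\<phi> t (cinv ?c u))) has_derivative
      frechet_derivative (\<lambda>(t, u). snd ?d (\<phi> t (cinv ?c u))) (at (t, snd ?c x))) (at (t, snd ?c x))"
    (is "(_ has_derivative ?D) _")
    by (rule C_on_has_derivative[OF C _ O]) simp
  have "((\<lambda>u. (t, u)) has_derivative (\<lambda>v. (0, v))) (at (snd ?c x))"
    by (auto intro!: derivative_eq_intros)
  from has_derivative_compose[OF this D]
  have "has_mderiv M (\<lambda>y. snd ?d (\<phi> t y)) (\<lambda>v. ?D (0, v)) x"
    by (simp add: has_mderiv_def o_def)
  with mderiv_eq[OF this] show ?thesis by (simp add: tmap_def o_def)
qed

lemma linear_tmap: "x \<in> topspace (mtop M) \<Longrightarrow> linear (tmap M (\<phi> t) x)"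
  using has_mderiv_linear[OF flow_has_tmap] .

lemma has_pderiv_flow:
  assumes F: "has_pderiv M F F' u" and x: "F u \<in> topspace (mtop M)"
  shows "has_pderiv M (\<lambda>w. \<phi> t (F w)) (\<lambda>v. tmap M (\<phi> t) (F u) (F' v)) u"
proof -
  let ?c = "chart_at M (F u)" and ?d = "chart_at M (\<phi> t (F u))"
  have d: "((\<lambda>w. snd ?d (\<phi> t (F w))) has_derivative (\<lambda>v. tmap M (\<phi> t) (F u) (F' v))) (at u)"
    by (rule has_derivative_chain[OF F x flow_has_tmap[OF x]])
  have c: "((\<lambda>w. snd ?c (F w)) has_derivative F') (at u)" and ev: "\<forall>\<^sub>F w in nhds u. F w \<in> fst ?c"
    using F by (simp_all add: has_pderiv_def o_def)
  \<comment> \<open>Differentiability of a map into \<open>M\<close> includes that nearby values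
    stay in the preferred chart of the image point; continuity of the flow provides this.\<close>
  let ?W = "{y \<in> topspace (mtop M). \<phi> t y \<in> fst ?d}"
  have W: "openin (mtop M) ?W"
    using openin_continuous_map_preimage[OF flow_continuous_map chart_openin[OF chart_at_is_chart]]
      flow_topspace x by blast
  have "F u \<in> ?W" using x chart_at_mem flow_topspace by blast
  from eventually_nhds_compose[OF c eventually_chart[OF chart_at_is_chart[OF x] chart_at_mem[OF x] W this]]
  have "\<forall>\<^sub>F w in nhds u. \<phi> t (F w) \<in> fst ?d"
    using ev by eventually_elim (simp add: cinv_chart[OF chart_at_is_chart[OF x]])
  with d show ?thesis by (simp add: has_pderiv_def o_def)
qed

lemma has_mderiv_flow:
  assumes x: "x \<in> topspace (mtop M)" and f: "has_mderiv M f D (\<phi> t x)"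
  shows "has_mderiv M (\<lambda>y. f (\<phi> t y)) (\<lambda>v. D (tmap M (\<phi> t) x v)) x"
proof -
  have "has_pderiv M (\<lambda>w. \<phi> t (cinv (chart_at M x) w)) (\<lambda>v. tmap M (\<phi> t) x v) (snd (chart_at M x) x)"
    using has_pderiv_flow[OF has_pderiv_cinv_chart_at[OF x], of t] x by (simp add: cinv_chart_at)
  from has_derivative_chain[OF this] show ?thesis
    using f x by (simp add: has_mderiv_def cinv_chart_at o_def)
qed

lemma tmap_0: "x \<in> topspace (mtop M) \<Longrightarrow> tmap M (\<phi> 0) x v = v"
proof -
  assume x: "x \<in> topspace (mtop M)"
  have 1: "has_pderiv M (cinv (chart_at M x)) (\<lambda>v. v) (snd (chart_at M x) x)"
    by (rule has_pderiv_cinv_chart_at[OF x])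
  have 2: "has_pderiv M (\<lambda>w. \<phi> 0 (cinv (chart_at M x) w)) (\<lambda>v. tmap M (\<phi> 0) x v) (snd (chart_at M x) x)"
    using has_pderiv_flow[OF 1, of 0] x by (simp add: cinv_chart_at)
  have "\<forall>\<^sub>F w in nhds (snd (chart_at M x) x). \<phi> 0 (cinv (chart_at M x) w) = cinv (chart_at M x) w"
    using 1[unfolded has_pderiv_def, THEN conjunct1] 
    by eventually_elim (use x chart_subset[OF chart_at_is_chart[OF x]] in \<open>auto simp: cinv_chart_at flow_0\<close>)
  from has_pderiv_unique[OF has_pderiv_cong[OF this 2] 1] show ?thesis by metis
qed

text \<open>Both sides are the differential of one map, computed along the inverse of the preferred
  chart at \<open>x\<close>.\<close>

lemma tmap_add:
  assumes x: "x \<in> topspace (mtop M)"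
  shows "tmap M (\<phi> (s + t)) x v = tmap M (\<phi> s) (\<phi> t x) (tmap M (\<phi> t) x v)"
proof -
  let ?F = "cinv (chart_at M x)" and ?u = "snd (chart_at M x) x"
  have 1: "has_pderiv M ?F (\<lambda>v. v) ?u"
    by (rule has_pderiv_cinv_chart_at[OF x])
  have 2: "has_pderiv M (\<lambda>w. \<phi> (s + t) (?F w)) (\<lambda>v. tmap M (\<phi> (s + t)) x v) ?u"
    using has_pderiv_flow[OF 1, of "s + t"] x by (simp add: cinv_chart_at)
  have 3: "has_pderiv M (\<lambda>w. \<phi> t (?F w)) (\<lambda>v. tmap M (\<phi> t) x v) ?u"
    using has_pderiv_flow[OF 1, of t] x by (simp add: cinv_chart_at)
  have 4: "has_pderiv M (\<lambda>w. \<phi> s (\<phi> t (?F w))) (\<lambda>v. tmap M (\<phi> s) (\<phi> t x) (tmap M (\<phi> t) x v)) ?u"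
    using has_pderiv_flow[OF 3, of s] x by (simp add: cinv_chart_at)
  have "\<forall>\<^sub>F w in nhds ?u. \<phi> (s + t) (?F w) = \<phi> s (\<phi> t (?F w))"
    using 1[unfolded has_pderiv_def, THEN conjunct1] 
    by eventually_elim (use x chart_subset[OF chart_at_is_chart[OF x]] in \<open>auto simp: cinv_chart_at intro!: flow_add\<close>)
  from has_pderiv_unique[OF has_pderiv_cong[OF this 2] 4] show ?thesis by metis
qed

end

section \<open>The transverse holomorphic structure\<close>

text \<open>Complex homogeneity only; additivity comes with the real linearity of
  derivatives.\<close>

definition clinear :: "(complex^'n \<Rightarrow> complex^'m) \<Rightarrow> bool" where
  "clinear D \<longleftrightarrow> (\<forall>a v. D (a *s v) = a *s D v)"

lemma clinearD: "clinear D \<Longrightarrow> D (a *s v) = a *s D v"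
  by (simp add: clinear_def)

lemma clinear_compose: "clinear f \<Longrightarrow> clinear g \<Longrightarrow> clinear (\<lambda>v. g (f v))"
  by (simp add: clinear_def)

lemma vector_scaleC_of_real: "complex_of_real r *s v = r *\<^sub>R v" for v :: "complex^'n"
  by (simp add: vec_eq_iff scaleR_conv_of_real[symmetric])

lemma clinearI:
  assumes "linear D" "\<And>v. D (\<i> *s v) = \<i> *s D v"
  shows "clinear D"
  unfolding clinear_def
proof (intro allI)
  fix a :: complex and v
  have dec: "a *s w = Re a *\<^sub>R w + Im a *\<^sub>R (\<i> *s w)" for w :: "complex^'k"
  proof -
    have "a *s w = (complex_of_real (Re a) + \<i> * complex_of_real (Im a)) *s w"
      by (simp add: complex_eq[symmetric])
    also have "\<dots> = complex_of_real (Re a) *s w + complex_of_real (Im a) *s (\<i> *s w)"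
      by (simp add: vec.scale_left_distrib vec.scale_scale mult.commute)
    finally show ?thesis by (simp only: vector_scaleC_of_real)
  qed
  show "D (a *s v) = a *s D v"
    by (simp only: dec linear_add[OF assms(1)] linear_cmul[OF assms(1)] assms(2))
qed

locale th_flow = flow_mfd M \<phi> for M :: "('a, 'e::euclidean_space) manifold" and \<phi> +
  fixes X :: "'a \<Rightarrow> 'e" and T :: "('a, real \<times> (complex^'q)) chart set"
  assumes X_nonzero: "x \<in> topspace (mtop M) \<Longrightarrow> X x \<noteq> 0"
    and X_generates: "generates M X \<phi>"
    and trans_holo: "transversely_holomorphic M \<phi> T"
begin

lemma T_Cr_chart: "c \<in> T \<Longrightarrow> Cr_chart r M c"
  using trans_holo Cr_chart_mono[of \<infinity> M c r] by (simp add: transversely_holomorphic_def)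

lemma T_is_chart: "c \<in> T \<Longrightarrow> is_chart (mtop M) UNIV c"
  using Cr_chart_is_chart[OF T_Cr_chart] .

lemma T_topspace: "c \<in> T \<Longrightarrow> x \<in> fst c \<Longrightarrow> x \<in> topspace (mtop M)"
  using chart_subset[OF T_is_chart] by blast

lemma T_cover: "x \<in> topspace (mtop M) \<Longrightarrow> \<exists>c\<in>T. x \<in> fst c"
  using trans_holo unfolding transversely_holomorphic_def by blast

lemma mderiv_dz:
  assumes c: "c \<in> T" and x: "x \<in> fst c"
  shows has_mderiv_dz: "has_mderiv M (\<lambda>y. snd (snd c y)) (dz M c x) x"
    and dz_eq: "dz M c x v = snd (mderiv M (snd c) x v)"
proof -
  have 1: "has_mderiv M (snd c) (mderiv M (snd c) x) x"
    using has_mderiv_chart[OF T_Cr_chart[OF c, of 1] _ x] by simp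
  have "has_mderiv M (\<lambda>y. snd (snd c y)) (\<lambda>v. snd (mderiv M (snd c) x v)) x"
    by (rule has_mderiv_compose[OF 1 _ cinv_chart_at[OF T_topspace[OF c x]]])
       (rule has_derivative_snd[OF has_derivative_ident])
  then show "has_mderiv M (\<lambda>y. snd (snd c y)) (dz M c x) x" "dz M c x v = snd (mderiv M (snd c) x v)"
    using mderiv_eq unfolding dz_def by metis+
qed

lemma linear_dz: "c \<in> T \<Longrightarrow> x \<in> fst c \<Longrightarrow> linear (dz M c x)"
  using has_mderiv_linear[OF has_mderiv_dz] .

lemma has_pderiv_orbit:
  assumes x: "x \<in> topspace (mtop M)"
  shows "has_pderiv M (\<lambda>s. \<phi> s x) (\<lambda>s. s *\<^sub>R X (\<phi> t x)) t"
proof -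
  let ?c = "chart_at M (\<phi> t x)"
  have y: "\<phi> t x \<in> topspace (mtop M)" using x by simp
  have "((\<lambda>s. snd ?c (\<phi> s x)) has_vector_derivative X (\<phi> t x)) (at t)"
    using X_generates x unfolding generates_def by blast
  moreover have "open {s. \<phi> s x \<in> fst ?c}"
    using openin_continuous_map_preimage[OF flow_orbit_continuous[OF x]
        chart_openin[OF chart_at_is_chart[OF y]]] by (simp only: open_openin topspace_euclidean UNIV_I simp_thms)
  then have "\<forall>\<^sub>F s in nhds t. s \<in> {s. \<phi> s x \<in> fst ?c}"
    by (rule eventually_nhds_in_open) (use chart_at_mem[OF y] in simp)
  ultimately show ?thesis
    by (simp add: has_pderiv_def has_vector_derivative_def o_def)
qed

lemma T_flow_box:
  assumes c: "c \<in> T" and x: "x \<in> fst c"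
  shows "\<exists>\<epsilon>>0. \<forall>t. \<bar>t\<bar> < \<epsilon> \<longrightarrow> \<phi> t x \<in> fst c \<and> snd (snd c (\<phi> t x)) = snd (snd c x)"
  using trans_holo assms unfolding transversely_holomorphic_def by blast

lemma dz_X:
  assumes c: "c \<in> T" and x: "x \<in> fst c"
  shows "dz M c x (X x) = 0"
proof -
  have t: "x \<in> topspace (mtop M)" using T_topspace c x .
  obtain \<epsilon> where \<epsilon>: "\<epsilon> > 0" "\<And>t. \<bar>t\<bar> < \<epsilon> \<Longrightarrow> snd (snd c (\<phi> t x)) = snd (snd c x)"
    using T_flow_box[OF c x] by blast
  have 1: "((\<lambda>s. snd (snd c (\<phi> s x))) has_derivative (\<lambda>s. dz M c x (s *\<^sub>R X x))) (at 0)"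
    using has_derivative_chain[OF has_pderiv_orbit[OF t, of 0]] has_mderiv_dz[OF c x] t
    by (simp add: flow_0)
  have 2: "((\<lambda>s. snd (snd c (\<phi> s x))) has_derivative (\<lambda>s. 0)) (at 0)"
    by (rule has_derivative_transform_within_open[OF has_derivative_const, of "ball 0 \<epsilon>"]) (use \<epsilon> in auto)
  from has_derivative_unique[OF 1 2] have "dz M c x (1 *\<^sub>R X x) = 0" by metis
  then show ?thesis by simp
qed

text \<open>In the chart coordinates \<open>(\<tau>, z)\<close> both \<open>v\<close> and
  \<open>X x\<close> lie on the \<open>\<tau>\<close>-axis, and \<open>X x\<close> is nonzero there
  because the differential of the chart is injective.\<close>

lemma dz_kernel:
  assumes c: "c \<in> T" and x: "x \<in> fst c" and v: "dz M c x v = 0"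
  shows "\<exists>r. v = r *\<^sub>R X x"
proof -
  have k: "Cr_chart 1 M c" using T_Cr_chart c by blast
  let ?l = "mderiv M (snd c) x"
  have lin: "linear ?l" using linear_mderiv_chart[OF k _ x] by simp
  have inj: "v = w" if "?l v = ?l w" for v w using cvec_mderiv[OF k _ x] that by (metis order_refl)
  have 1: "?l v = (fst (?l v), 0)" "?l (X x) = (fst (?l (X x)), 0)"
    using v dz_X[OF c x] dz_eq[OF c x] by (simp_all add: prod_eq_iff)
  have "?l (X x) \<noteq> 0" using inj[of "X x" 0] X_nonzero[OF T_topspace[OF c x]] linear_0[OF lin] by auto
  then have nz: "fst (?l (X x)) \<noteq> 0" using 1(2) by (metis zero_prod_def)
  have "?l ((fst (?l v) / fst (?l (X x))) *\<^sub>R X x) = (fst (?l v) / fst (?l (X x))) *\<^sub>R ?l (X x)"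
    using linear_cmul[OF lin] .
  also have "\<dots> = (fst (?l v), 0)" by (subst 1(2)) (simp add: nz)
  finally show ?thesis using inj 1(1) by metis
qed

lemma dz_change:
  assumes c: "c \<in> T" and d: "d \<in> T" and x: "x \<in> fst c" "x \<in> fst d"
  shows "\<exists>D. clinear D \<and> (\<forall>v. dz M d x v = D (dz M c x v))"
proof -
  have t: "x \<in> topspace (mtop M)" using T_topspace c x by blast
  obtain W \<Omega> h where W: "openin (mtop M) W" "x \<in> W" and h: "holo_on \<Omega> h"
     "\<And>y. y \<in> W \<Longrightarrow> snd (snd c y) \<in> \<Omega>" "\<And>y. y \<in> W \<Longrightarrow> snd (snd d y) = h (snd (snd c y))"
    using trans_holo c d x unfolding transversely_holomorphic_def by (metis IntI)
  obtain D where D: "(h has_derivative D) (at (snd (snd c x)))" "\<And>a v. D (a *s v) = a *s D v"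
    using h(1) h(2)[OF W(2)] unfolding holo_on_def by blast
  have "has_mderiv M (\<lambda>y. h (snd (snd c y))) (\<lambda>v. D (dz M c x v)) x"
    by (rule has_mderiv_compose[OF has_mderiv_dz[OF c x(1)] D(1) cinv_chart_at[OF t]])
  then have "has_mderiv M (\<lambda>y. snd (snd d y)) (\<lambda>v. D (dz M c x v)) x"
    by (rule has_mderiv_cong[OF t W, rotated]) (simp add: h(3))
  from mderiv_eq[OF this] have "dz M d x = (\<lambda>v. D (dz M c x v))"
    by (simp only: dz_def)
  then show ?thesis using D(2) unfolding clinear_def by auto
qed

text \<open>Quantified over all charts at both ends, so that the property composes along an orbit
  without any coherent choice of charts.\<close>

definition flow_clinear :: "real \<Rightarrow> 'a \<Rightarrow> bool" where
  "flow_clinear t x \<longleftrightarrow> (\<forall>c\<in>T. \<forall>d\<in>T. x \<in> fst c \<longrightarrow> \<phi> t x \<in> fst d \<longrightarrow>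
     (\<exists>D. clinear D \<and> (\<forall>v. dz M d (\<phi> t x) (tmap M (\<phi> t) x v) = D (dz M c x v))))"

text \<open>A change of chart acts on \<open>dz\<close> by a complex linear map, so a single pair of
  charts decides.\<close>

lemma flow_clinearI:
  assumes c: "c \<in> T" and d: "d \<in> T" and x: "x \<in> fst c" "\<phi> t x \<in> fst d"
    and D: "clinear D" "\<And>v. dz M d (\<phi> t x) (tmap M (\<phi> t) x v) = D (dz M c x v)"
  shows "flow_clinear t x"
  unfolding flow_clinear_def
proof (intro ballI impI)
  fix c' d' assume *: "c' \<in> T" "d' \<in> T" "x \<in> fst c'" "\<phi> t x \<in> fst d'"
  obtain D1 where D1: "clinear D1" "\<And>v. dz M c x v = D1 (dz M c' x v)"
    using dz_change[OF *(1) c *(3) x(1)] by blast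
  obtain D2 where D2: "clinear D2" "\<And>v. dz M d' (\<phi> t x) v = D2 (dz M d (\<phi> t x) v)"
    using dz_change[OF d *(2) x(2) *(4)] by blast
  show "\<exists>D. clinear D \<and> (\<forall>v. dz M d' (\<phi> t x) (tmap M (\<phi> t) x v) = D (dz M c' x v))"
    by (rule exI[of _ "\<lambda>v. D2 (D (D1 v))"])
       (use D1 D2 D in \<open>auto intro!: clinear_compose[where g=D2] clinear_compose[where g=D]\<close>)
qed

lemma flow_clinear_add:
  assumes x: "x \<in> topspace (mtop M)" and 1: "flow_clinear t x" and 2: "flow_clinear s (\<phi> t x)"
  shows "flow_clinear (s + t) x"
proof -
  obtain c where c: "c \<in> T" "x \<in> fst c" using T_cover[OF x] by blast
  obtain d where d: "d \<in> T" "\<phi> t x \<in> fst d" using T_cover[OF flow_topspace[OF x]] by blast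
  obtain e where e: "e \<in> T" "\<phi> s (\<phi> t x) \<in> fst e"
    using T_cover[OF flow_topspace[OF flow_topspace[OF x]]] by blast
  obtain D1 where D1: "clinear D1" "\<And>v. dz M d (\<phi> t x) (tmap M (\<phi> t) x v) = D1 (dz M c x v)"
    using 1 c d unfolding flow_clinear_def by blast
  obtain D2 where D2: "clinear D2"
     "\<And>v. dz M e (\<phi> s (\<phi> t x)) (tmap M (\<phi> s) (\<phi> t x) v) = D2 (dz M d (\<phi> t x) v)"
    using 2 d e unfolding flow_clinear_def by blast
  show ?thesis
  proof (rule flow_clinearI[OF c(1) e(1) c(2)])
    show "\<phi> (s + t) x \<in> fst e" using e x by (simp add: flow_add)
    show "clinear (\<lambda>v. D2 (D1 v))" using clinear_compose D1(1) D2(1) by blast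
    show "dz M e (\<phi> (s + t) x) (tmap M (\<phi> (s + t)) x v) = D2 (D1 (dz M c x v))" for v
      using x by (simp add: flow_add tmap_add D1(2) D2(2))
  qed
qed

text \<open>The time during which the foliated atlas controls an orbit depends on the point. What it
  gives at every time is that the transverse coordinate is locally constant, hence has derivative
  zero, hence is constant on the interval.\<close>

lemma flow_transverse_const:
  assumes c: "c \<in> T" and box: "\<And>s. \<bar>s\<bar> < \<epsilon> \<Longrightarrow> \<phi> s y \<in> fst c" and y: "y \<in> topspace (mtop M)" and s: "\<bar>s\<bar> < \<epsilon>"
  shows "snd (snd c (\<phi> s y)) = snd (snd c y)"
proof -
  have "((\<lambda>s. snd (snd c (\<phi> s y))) has_derivative (\<lambda>h. 0)) (at s within ball 0 \<epsilon>)"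
    if s: "s \<in> ball 0 \<epsilon>" for s
  proof -
    obtain \<delta> where \<delta>: "\<delta> > 0"
      "\<And>t. \<bar>t\<bar> < \<delta> \<Longrightarrow> snd (snd c (\<phi> t (\<phi> s y))) = snd (snd c (\<phi> s y))"
      using T_flow_box[OF c box[of s]] s by auto
    have "((\<lambda>s. snd (snd c (\<phi> s y))) has_derivative (\<lambda>h. 0)) (at s)"
    proof (rule has_derivative_transform_within_open[OF has_derivative_const, of "ball s \<delta>"])
      fix r assume "r \<in> ball s \<delta>"
      then have "\<bar>r - s\<bar> < \<delta>" by (simp add: dist_real_def)
      from \<delta>(2)[OF this] show "snd (snd c (\<phi> s y)) = snd (snd c (\<phi> r y))"
        using flow_add[OF y, of "r - s" s] by simp
    qed (use \<delta>(1) in auto)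
    then show ?thesis by (rule has_derivative_at_withinI)
  qed
  from has_derivative_zero_constant[OF convex_ball this]
  obtain k where k: "\<And>s. s \<in> ball 0 \<epsilon> \<Longrightarrow> snd (snd c (\<phi> s y)) = k" by blast
  have "s \<in> ball 0 \<epsilon>" "0 \<in> ball 0 \<epsilon>" using s by auto
  from k[OF this(1)] k[OF this(2)] show ?thesis by (simp add: flow_0[OF y])
qed

text \<open>For small times the orbits of a whole neighbourhood \<open>W\<close> stay in one chart
  and keep their transverse coordinate, so the tangent map is the identity under \<open>dz\<close>.
  The backward statement from \<open>\<phi> s x\<close>, with the same \<open>\<epsilon>\<close>, is
  what closedness of the set of good times will use.\<close>

lemma flow_clinear_local:
  assumes x: "x \<in> topspace (mtop M)"
  shows "\<exists>\<epsilon>>0. \<forall>s. \<bar>s\<bar> < \<epsilon> \<longrightarrow> flow_clinear s x \<and> flow_clinear (- s) (\<phi> s x)"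
proof -
  obtain c where c: "c \<in> T" "x \<in> fst c" using T_cover[OF x] by blast
  let ?P = "{p \<in> topspace (prod_topology euclideanreal (mtop M)). (\<lambda>(t, x). \<phi> t x) p \<in> fst c}"
  have oP: "openin (prod_topology euclideanreal (mtop M)) ?P"
    using openin_continuous_map_preimage[OF flow_continuous_map2 chart_openin[OF T_is_chart[OF c(1)]]] .
  have "(0, x) \<in> ?P" using x c flow_0 by simp
  from openin_prod_topology_alt[THEN iffD1, OF oP, rule_format, OF this]
  obtain V W where V: "openin euclideanreal V" and VW: "V \<times> W \<subseteq> ?P" "openin (mtop M) W" "0 \<in> V" "x \<in> W"
    by (elim exE conjE) (rule that)
  then have oV: "open V" by (simp only: open_openin)
  obtain \<epsilon> where \<epsilon>: "\<epsilon> > 0" "ball 0 \<epsilon> \<subseteq> V" using openE[OF oV VW(3)] .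
  have box: "\<phi> s y \<in> fst c" "y \<in> topspace (mtop M)" if "\<bar>s\<bar> < \<epsilon>" "y \<in> W" for s y
  proof -
    have "(s, y) \<in> V \<times> W" using that \<epsilon>(2) by (auto simp: subset_iff)
    then have "(s, y) \<in> ?P" using VW(1) by (rule subsetD[rotated])
    then show "\<phi> s y \<in> fst c" "y \<in> topspace (mtop M)" by auto
  qed
  have key: "dz M c (\<phi> s x) (tmap M (\<phi> s) x v) = dz M c x v" if s: "\<bar>s\<bar> < \<epsilon>" for s v
  proof -
    have "has_mderiv M (\<lambda>y. snd (snd c (\<phi> s y))) (\<lambda>v. dz M c (\<phi> s x) (tmap M (\<phi> s) x v)) x"
      by (rule has_mderiv_flow[OF x has_mderiv_dz[OF c(1) box(1)[OF s VW(4)]]])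
    moreover have "has_mderiv M (\<lambda>y. snd (snd c (\<phi> s y))) (dz M c x) x"
      by (rule has_mderiv_cong[OF x VW(2,4) _ has_mderiv_dz[OF c]])
         (simp add: flow_transverse_const[OF c(1) box(1) box(2)[OF s] s])
    ultimately show ?thesis using mderiv_eq by metis
  qed
  have "flow_clinear s x \<and> flow_clinear (- s) (\<phi> s x)" if s: "\<bar>s\<bar> < \<epsilon>" for s
  proof
    note sc = box(1)[OF s VW(4)]
    show "flow_clinear s x"
      by (rule flow_clinearI[OF c(1) c(1) c(2) sc, where D="\<lambda>v. v"]) (simp_all add: key[OF s] clinear_def)
    have inv: "\<phi> (- s) (\<phi> s x) = x" using flow_add[OF x, of "-s" s] flow_0[OF x] by simp
    show "flow_clinear (- s) (\<phi> s x)"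
    proof (rule flow_clinearI[OF c(1) c(1) sc, where D="\<lambda>v. v"])
      fix v
      have y: "\<phi> s x \<in> topspace (mtop M)" using x by simp
      have "tmap M (\<phi> s) x (tmap M (\<phi> (- s)) (\<phi> s x) v) = v"
        using tmap_add[OF y, of s "- s" v] tmap_0[OF y] by (simp add: inv)
      then show "dz M c (\<phi> (- s) (\<phi> s x)) (tmap M (\<phi> (- s)) (\<phi> s x) v) = dz M c (\<phi> s x) v"
        using key[OF s, of "tmap M (\<phi> (- s)) (\<phi> s x) v"] by (simp add: inv)
    qed (simp_all add: inv c clinear_def)
  qed
  with \<epsilon>(1) show ?thesis by (intro exI[of _ \<epsilon>]) simp
qed

text \<open>Good times form an open set by the local statement at \<open>\<phi> t x\<close>. So do
  bad times: from a good time \<open>r\<close> close to \<open>t\<close> the backward statement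
  would lead to \<open>t\<close>. The real line is connected.\<close>

theorem flow_clinear_all:
  assumes x: "x \<in> topspace (mtop M)"
  shows "flow_clinear t x"
proof -
  let ?S = "{t. flow_clinear t x}"
  have "open ?S"
    unfolding open_dist
  proof
    fix t assume t: "t \<in> ?S"
    obtain \<epsilon> where \<epsilon>: "\<epsilon> > 0" "\<And>s. \<bar>s\<bar> < \<epsilon> \<Longrightarrow> flow_clinear s (\<phi> t x)"
      using flow_clinear_local[OF flow_topspace[OF x]] by blast
    have "r \<in> ?S" if "dist r t < \<epsilon>" for r
      using flow_clinear_add[OF x, of t "r - t"] \<epsilon>(2)[of "r - t"] that t by (simp add: dist_real_def)
    then show "\<exists>e>0. \<forall>y. dist y t < e \<longrightarrow> y \<in> ?S" using \<epsilon>(1) by blast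
  qed
  moreover have "open (- ?S)"
    unfolding open_dist
  proof
    fix t assume t: "t \<in> - ?S"
    obtain \<epsilon> where \<epsilon>: "\<epsilon> > 0" "\<And>s. \<bar>s\<bar> < \<epsilon> \<Longrightarrow> flow_clinear (- s) (\<phi> s (\<phi> t x))"
      using flow_clinear_local[OF flow_topspace[OF x]] by blast
    have "r \<in> - ?S" if "dist r t < \<epsilon>" for r
      using flow_clinear_add[OF x, of r "t - r"] \<epsilon>(2)[of "r - t"] that t flow_add[OF x, of "r - t" t]
      by (auto simp: dist_real_def)
    then show "\<exists>e>0. \<forall>y. dist y t < e \<longrightarrow> y \<in> - ?S" using \<epsilon>(1) by blast
  qed
  then have "closed ?S" by (simp add: closed_def)
  ultimately have "?S = {} \<or> ?S = UNIV" using clopen[of ?S] by blast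
  moreover have "flow_clinear 0 x" using flow_clinear_local[OF x] by force
  ultimately show ?thesis by blast
qed

lemma dz_flow:
  assumes "c \<in> T" "d \<in> T" "x \<in> fst c" "\<phi> t x \<in> fst d"
  shows "\<exists>D. clinear D \<and> (\<forall>v. dz M d (\<phi> t x) (tmap M (\<phi> t) x v) = D (dz M c x v))"
  using flow_clinear_all[OF T_topspace[OF assms(1,3)]] assms unfolding flow_clinear_def by blast

lemma dz_flow_ii:
  assumes "c \<in> T" "d \<in> T" "x \<in> fst c" "\<phi> t x \<in> fst d" "dz M c x w = \<i> *s dz M c x v"
  shows "dz M d (\<phi> t x) (tmap M (\<phi> t) x w) = \<i> *s dz M d (\<phi> t x) (tmap M (\<phi> t) x v)"
  using dz_flow[OF assms(1-4)] assms(5) by (metis clinearD)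

lemma dz_change_ii:
  assumes "c \<in> T" "d \<in> T" "x \<in> fst c" "x \<in> fst d" "dz M c x w = \<i> *s dz M c x v"
  shows "dz M d x w = \<i> *s dz M d x v"
  using dz_change[OF assms(1-4)] assms(5) by (metis clinearD)

end

section \<open>Compact families of linear maps\<close>

lemma compact_linear_family_bounded:
  fixes f :: "'q::topological_space \<Rightarrow> 'a::euclidean_space \<Rightarrow> 'b::euclidean_space"
  assumes Q: "compact Q" and lin: "\<And>q. q \<in> Q \<Longrightarrow> linear (f q)" and cont: "\<And>p. continuous_on Q (\<lambda>q. f q p)"
  shows "\<exists>K\<ge>0. \<forall>q\<in>Q. \<forall>p. norm (f q p) \<le> K * norm p"
proof -
  have "\<exists>k\<ge>0. \<forall>q\<in>Q. norm (f q b) \<le> k" for b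
  proof -
    have "bounded ((\<lambda>q. f q b) ` Q)"
      using compact_imp_bounded[OF compact_continuous_image[OF cont Q]] .
    then show ?thesis unfolding bounded_pos by (auto intro: less_imp_le)
  qed
  then obtain k where k: "\<And>b. k b \<ge> 0" "\<And>b q. q \<in> Q \<Longrightarrow> norm (f q b) \<le> k b" by metis
  have "norm (f q p) \<le> (\<Sum>b\<in>Basis. k b) * norm p" if q: "q \<in> Q" for q p
  proof -
    have "norm (f q p) \<le> (\<Sum>b\<in>Basis. norm ((p \<bullet> b) *\<^sub>R f q b))"
      by (subst linear_expand[OF lin[OF q]]) (rule norm_sum)
    also have "\<dots> \<le> (\<Sum>b\<in>Basis. norm p * k b)"
      by (rule sum_mono) (use k q Basis_le_norm in \<open>auto intro!: mult_mono\<close>)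
    finally show ?thesis by (simp add: sum_distrib_left mult.commute)
  qed
  then show ?thesis using k(1) by (intro exI[of _ "\<Sum>b\<in>Basis. k b"]) (auto intro: sum_nonneg)
qed

lemma continuous_on_linear_family:
  fixes f :: "'q::topological_space \<Rightarrow> 'a::euclidean_space \<Rightarrow> 'b::euclidean_space"
  assumes lin: "\<And>q. q \<in> Q \<Longrightarrow> linear (f q)" and cont: "\<And>p. continuous_on Q (\<lambda>q. f q p)"
  shows "continuous_on (Q \<times> S) (\<lambda>(q, p). f q p)"
proof -
  have "continuous_on (Q \<times> S) (\<lambda>x. f (fst x) b)" for b
    by (rule continuous_on_compose2[OF cont[of b]]) (auto intro: continuous_intros)
  then have "continuous_on (Q \<times> S) (\<lambda>x. \<Sum>b\<in>Basis. (snd x \<bullet> b) *\<^sub>R f (fst x) b)"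
    by (intro continuous_intros)
  moreover have "(\<Sum>b\<in>Basis. (snd x \<bullet> b) *\<^sub>R f (fst x) b) = (\<lambda>(q, p). f q p) x" if "x \<in> Q \<times> S" for x
    using linear_expand[OF lin, of "fst x" "snd x"] that by auto
  ultimately show ?thesis by (simp cong: continuous_on_cong)
qed

text \<open>The minimum of \<open>norm (f q p)\<close> over \<open>Q\<close> and the unit sphere of
  \<open>Z\<close> is attained, and injectivity makes it positive. This is the source of the bound
  of the components of a vector by the vector.\<close>

lemma compact_linear_family_below:
  fixes f :: "'q::topological_space \<Rightarrow> 'a::euclidean_space \<Rightarrow> 'b::euclidean_space"
  assumes Q: "compact Q" and lin: "\<And>q. q \<in> Q \<Longrightarrow> linear (f q)" and cont: "\<And>p. continuous_on Q (\<lambda>q. f q p)"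
    and Z: "subspace Z" and inj: "\<And>q p. q \<in> Q \<Longrightarrow> p \<in> Z \<Longrightarrow> f q p = 0 \<Longrightarrow> p = 0"
  shows "\<exists>m>0. \<forall>q\<in>Q. \<forall>p\<in>Z. m * norm p \<le> norm (f q p)"
proof (cases "Q \<times> (Z \<inter> sphere 0 1) = {}")
  \<comment> \<open>Here \<open>Q\<close> is empty or \<open>Z\<close> is the zero space; every
    constant works and 1 is taken.\<close>
  case True
  have "p = 0" if "q \<in> Q" "p \<in> Z" for q p
  proof (rule ccontr)
    assume "p \<noteq> 0"
    then have "(q, p /\<^sub>R norm p) \<in> Q \<times> (Z \<inter> sphere 0 1)"
      using that Z by (simp add: subspace_scale)
    then show False using True by blast
  qed
  then have "1 * norm p \<le> norm (f q p)" if "q \<in> Q" "p \<in> Z" for q p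
    using that by (metis mult_1 norm_ge_zero norm_zero)
  then show ?thesis by (intro exI[of _ 1]) simp
next
  case False
  have "compact (Q \<times> (Z \<inter> sphere 0 1))"
    using compact_Times[OF Q] compact_Int_closed[OF compact_sphere closed_subspace[OF Z]] by (metis Int_commute)
  moreover have "continuous_on (Q \<times> (Z \<inter> sphere 0 1)) (\<lambda>x. norm ((\<lambda>(q, p). f q p) x))"
    by (intro continuous_on_norm continuous_on_linear_family lin cont)
  ultimately obtain x where x: "x \<in> Q \<times> (Z \<inter> sphere 0 1)"
    "\<And>y. y \<in> Q \<times> (Z \<inter> sphere 0 1) \<Longrightarrow> norm ((\<lambda>(q, p). f q p) x) \<le> norm ((\<lambda>(q, p). f q p) y)"
    using continuous_attains_inf[OF _ False] by metis
  obtain q0 p0 where qp: "x = (q0, p0)" "q0 \<in> Q" "p0 \<in> Z" "norm p0 = 1" using x(1) by auto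
  define m where "m = norm (f q0 p0)"
  have "m > 0" using inj[OF qp(2,3)] qp(4) unfolding m_def by force
  moreover have "m * norm p \<le> norm (f q p)" if "q \<in> Q" "p \<in> Z" for q p
  proof (cases "p = 0")
    case False
    have "(q, p /\<^sub>R norm p) \<in> Q \<times> (Z \<inter> sphere 0 1)"
      using that Z False by (simp add: subspace_scale)
    from x(2)[OF this] have "m \<le> norm (f q (p /\<^sub>R norm p))" by (simp add: qp m_def)
    also have "\<dots> = norm (f q p) / norm p"
      by (simp add: linear_cmul[OF lin[OF that(1)]] divide_inverse mult.commute)
    finally show ?thesis using False by (simp add: pos_le_divide_eq)
  qed simp
  ultimately show ?thesis by blast
qed

text \<open>Letting \<open>t\<close> run through the natural numbers turns the bound into a
  geometric sequence.\<close>

lemma le_powr_decay: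
  fixes n B \<rho> :: real
  assumes "\<And>t. 0 \<le> t \<Longrightarrow> n \<le> B * \<rho> powr t" "0 < \<rho>" "\<rho> < 1"
  shows "n \<le> 0"
proof -
  have "(\<lambda>k. B * \<rho> ^ k) \<longlonglongrightarrow> B * 0"
    using assms(2,3) by (intro tendsto_mult_left LIMSEQ_power_zero) simp
  moreover have "n \<le> B * \<rho> ^ k" for k
    using assms(1)[of "real k"] assms(2) by (simp add: powr_realpow)
  ultimately show ?thesis using LIMSEQ_le_const[of "\<lambda>k. B * \<rho> ^ k" "B * 0" n] by simp
qed

section \<open>Local estimates for metrics and subbundles\<close>

context smooth_mfd
begin

lemma mderiv_transition:
  assumes k: "Cr_chart r M k" "1 \<le> r" and l: "Cr_chart r M l" and x: "x \<in> fst k" "x \<in> fst l"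
  shows "frechet_derivative (\<lambda>u. snd l (cinv k u)) (at (snd k x)) p = mderiv M (snd l) x (cvec M k x p)"
proof -
  have t: "x \<in> topspace (mtop M)" using Cr_chart_topspace k x by blast
  have [simp]: "cinv k (snd k x) = x" using cinv_chart[OF Cr_chart_is_chart[OF k(1)] x(1)] .
  have "((\<lambda>u. snd l (cinv k u)) has_derivative (\<lambda>p. mderiv M (snd l) x (cvec M k x p))) (at (snd k x))"
    using has_derivative_chain[OF has_pderiv_cinv[OF k x(1)]] has_mderiv_chart[OF l k(2) x(2)] t by simp
  from frechet_derivative_at[OF this] show ?thesis by metis
qed

lemma continuous_on_transition_derivative:
  assumes k: "Cr_chart r M k" "1 \<le> r" and l: "Cr_chart r M l"
  shows "continuous_on (snd k ` (fst k \<inter> fst l)) (\<lambda>u. mderiv M (snd l) (cinv k u) (cvec M k (cinv k u) p))"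
proof -
  have "continuous_on (snd k ` (fst k \<inter> fst l)) (\<lambda>u. frechet_derivative (\<lambda>u. snd l (cinv k u)) (at u) p)"
    by (rule C_on_continuous_derivative[OF Cr_chart_transition[OF k(1) l] k(2)])
  moreover have "frechet_derivative (\<lambda>u. snd l (cinv k u)) (at u) p =
      mderiv M (snd l) (cinv k u) (cvec M k (cinv k u) p)" if "u \<in> snd k ` (fst k \<inter> fst l)" for u
    using that mderiv_transition[OF k l] cinv_chart[OF Cr_chart_is_chart[OF k(1)]] by auto
  ultimately show ?thesis by (simp cong: continuous_on_cong)
qed

lemma cball_chart:
  assumes ch: "is_chart (mtop M) UNIV c" and W: "openin (mtop M) W" "x \<in> W" "W \<subseteq> fst c"
  obtains \<rho> where "\<rho> > 0" "cball (snd c x) \<rho> \<subseteq> snd c ` W"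
  using open_contains_cball[of "snd c ` W"] open_chart_image[OF ch W(1,3)] W(2) by blast

lemma openin_cball_preimage:
  assumes ch: "is_chart (mtop M) UNIV c" and x: "x \<in> fst c" and \<rho>: "\<rho> > 0"
  obtains W where "openin (mtop M) W" "x \<in> W" "W \<subseteq> fst c" "\<And>y. y \<in> W \<Longrightarrow> snd c y \<in> cball (snd c x) \<rho>"
proof (rule that[of "{y \<in> fst c. snd c y \<in> ball (snd c x) \<rho>}"])
  show "openin (mtop M) {y \<in> fst c. snd c y \<in> ball (snd c x) \<rho>}"
    by (rule openin_chart_preimage[OF ch open_ball])
qed (use x \<rho> in auto)

text \<open>On a closed ball the transition derivatives form a compact family, which gives this
  inequality; the converse one is obtained by exchanging the charts.\<close>

lemma chart_norms_equivalent:
  assumes k: "Cr_chart 1 M k" and l: "Cr_chart 1 M l" and x: "x \<in> fst k" "x \<in> fst l"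
  obtains W K where "openin (mtop M) W" "x \<in> W" "W \<subseteq> fst k \<inter> fst l" "K \<ge> 0"
    "\<And>y v. y \<in> W \<Longrightarrow> norm (mderiv M (snd l) y v) \<le> K * norm (mderiv M (snd k) y v)"
proof -
  note chk = Cr_chart_is_chart[OF k] and chl = Cr_chart_is_chart[OF l]
  have o: "openin (mtop M) (fst k \<inter> fst l)"
    by (simp add: openin_Int chart_openin[OF chk] chart_openin[OF chl])
  obtain \<rho> where \<rho>: "\<rho> > 0" "cball (snd k x) \<rho> \<subseteq> snd k ` (fst k \<inter> fst l)"
    by (rule cball_chart[OF chk o]) (use x in auto)
  let ?Q = "cball (snd k x) \<rho>"
  let ?f = "\<lambda>u p. mderiv M (snd l) (cinv k u) (cvec M k (cinv k u) p)"
  have Qd: "cinv k u \<in> fst k" "cinv k u \<in> fst l" if "u \<in> ?Q" for u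
    using \<rho>(2) that cinv_chart[OF chk] by auto
  have "linear (?f u)" if "u \<in> ?Q" for u
    using linear_compose[OF linear_cvec[OF k order_refl Qd(1)[OF that]] linear_mderiv_chart[OF l order_refl Qd(2)[OF that]]]
    by (simp add: o_def)
  moreover have "continuous_on ?Q (\<lambda>u. ?f u p)" for p
    by (rule continuous_on_subset[OF continuous_on_transition_derivative[OF k order_refl l] \<rho>(2)])
  ultimately obtain K where K: "K \<ge> 0" "\<And>u p. u \<in> ?Q \<Longrightarrow> norm (?f u p) \<le> K * norm p"
    using compact_linear_family_bounded[OF compact_cball, of "snd k x" \<rho> ?f] by blast
  obtain W where W: "openin (mtop M) W" "x \<in> W" "W \<subseteq> fst k" "\<And>y. y \<in> W \<Longrightarrow> snd k y \<in> ?Q"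
    using openin_cball_preimage[OF chk x(1) \<rho>(1)] by blast
  have c: "cinv k (snd k y) = y" if "y \<in> W" for y using W(3) that cinv_chart[OF chk] by blast
  show thesis
  proof (rule that[OF W(1,2) _ K(1)])
    show "W \<subseteq> fst k \<inter> fst l" using Qd(2)[OF W(4)] c W(3) by auto
    show "norm (mderiv M (snd l) y v) \<le> K * norm (mderiv M (snd k) y v)" if y: "y \<in> W" for y v
      using K(2)[OF W(4)[OF y], of "mderiv M (snd k) y v"] c[OF y] cvec_mderiv[OF k order_refl] W(3) y
      by auto
  qed
qed

text \<open>The metric is smooth in the coordinates of atlas charts only. The comparison is
  therefore made in the preferred chart at \<open>x\<close>, by extremal values on a closed ball
  times the unit sphere, and then carried over to \<open>k\<close>.\<close>

lemma metric_norm_equivalent: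
  assumes g: "riemannian_metric M g" and k: "Cr_chart 1 M k" and x: "x \<in> fst k"
  obtains W K where "openin (mtop M) W" "x \<in> W" "W \<subseteq> fst k" "K \<ge> 0"
    "\<And>y v. y \<in> W \<Longrightarrow> sqrt (g y v v) \<le> K * norm (mderiv M (snd k) y v)"
    "\<And>y v. y \<in> W \<Longrightarrow> norm (mderiv M (snd k) y v) \<le> K * sqrt (g y v v)"
proof -
  have t: "x \<in> topspace (mtop M)" using Cr_chart_topspace k x by blast
  let ?e = "chart_at M x"
  have e: "Cr_chart 1 M ?e" using atl_Cr_chart[OF chart_at_atl[OF t]] .
  note che = Cr_chart_is_chart[OF e]
  have xe: "x \<in> fst ?e" using chart_at_mem[OF t] .
  obtain \<rho> where \<rho>: "\<rho> > 0" "cball (snd ?e x) \<rho> \<subseteq> snd ?e ` fst ?e"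
    by (rule cball_chart[OF che chart_openin[OF che] xe order_refl])
  let ?Q = "cball (snd ?e x) \<rho>"
  let ?h = "\<lambda>u v w. g (cinv ?e u) (cvec M ?e (cinv ?e u) v) (cvec M ?e (cinv ?e u) w)"
  have Qd: "cinv ?e u \<in> fst ?e" "cinv ?e u \<in> topspace (mtop M)" if "u \<in> ?Q" for u
    using \<rho>(2) that cinv_in[OF che] chart_subset[OF che] by blast+
  have coh: "continuous_on ?Q (\<lambda>u. ?h u v w)" for v w
  proof -
    have "C_on \<infinity> (snd ?e ` fst ?e) (\<lambda>u. g (cinv ?e u) (coord_vec M ?e (cinv ?e u) v) (coord_vec M ?e (cinv ?e u) w))"
      using g chart_at_atl[OF t] unfolding riemannian_metric_def by blast
    then have "C_on \<infinity> (snd ?e ` fst ?e) (\<lambda>u. ?h u v w)" unfolding coord_vec_def cvec_def .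
    from continuous_on_subset[OF C_on_imp_continuous[OF this] \<rho>(2)] show ?thesis .
  qed
  have bil: "bilinear (g y)" "\<And>v. v \<noteq> 0 \<Longrightarrow> g y v v > 0" if "y \<in> topspace (mtop M)" for y
    using g that unfolding riemannian_metric_def by blast+
  have linh: "linear (?h u v)" "linear (\<lambda>v. ?h u v w)" if "u \<in> ?Q" for u v w
  proof -
    have b: "linear (g (cinv ?e u) a)" "linear (\<lambda>a. g (cinv ?e u) a b)" for a b
      using bil(1)[OF Qd(2)[OF that]] unfolding bilinear_def by blast+
    note lc = linear_cvec[OF e order_refl Qd(1)[OF that]]
    show "linear (?h u v)" "linear (\<lambda>v. ?h u v w)"
      using linear_compose[OF lc b(1)[of "cvec M ?e (cinv ?e u) v"]]
        linear_compose[OF lc b(2)[of "cvec M ?e (cinv ?e u) w"]]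
      by (simp_all only: o_def)
  qed
  \<comment> \<open>A double expansion over the basis gives joint continuity in base point and
    vector from the continuity of the coefficients.\<close>
  have exp: "?h u p p = (\<Sum>b\<in>Basis. \<Sum>b'\<in>Basis. (p \<bullet> b) *\<^sub>R (p \<bullet> b') *\<^sub>R ?h u b b')" if "u \<in> ?Q" for u p
  proof -
    have "?h u p p = (\<Sum>b\<in>Basis. (p \<bullet> b) *\<^sub>R ?h u b p)"
      using linear_expand[OF linh(2)[OF that]] .
    also have "\<dots> = (\<Sum>b\<in>Basis. (p \<bullet> b) *\<^sub>R (\<Sum>b'\<in>Basis. (p \<bullet> b') *\<^sub>R ?h u b b'))"
      using linear_expand[OF linh(1)[OF that], of _ p] by metis
    finally show ?thesis by (simp add: sum_distrib_left)
  qed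
  have "continuous_on (?Q \<times> sphere 0 1) (\<lambda>x. ?h (fst x) b b')" for b b' :: 'e
    by (rule continuous_on_compose2[OF coh[of b b']]) (auto intro: continuous_intros)
  then have "continuous_on (?Q \<times> sphere 0 1)
      (\<lambda>x. \<Sum>b\<in>Basis. \<Sum>b'\<in>Basis. (snd x \<bullet> b) *\<^sub>R (snd x \<bullet> b') *\<^sub>R ?h (fst x) b b')"
    by (intro continuous_intros)
  then have coH: "continuous_on (?Q \<times> sphere 0 1) (\<lambda>x. ?h (fst x) (snd x) (snd x))"
    by (rule continuous_on_eq) (use exp in auto)
  have cpt: "compact (?Q \<times> sphere (0::'e) 1)"
    by (intro compact_Times compact_cball compact_sphere)
  obtain b0 :: 'e where b0: "b0 \<in> Basis" using nonempty_Basis by blast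
  then have ne: "?Q \<times> sphere (0::'e) 1 \<noteq> {}" using \<rho>(1) by (auto intro!: exI[of _ b0])
  have pos: "?h u p p > 0" if "u \<in> ?Q" "p \<noteq> 0" for u p
  proof -
    have "cvec M ?e (cinv ?e u) p \<noteq> 0"
      using mderiv_cvec[OF e order_refl Qd(1)[OF that(1)], of p] that(2)
        linear_0[OF linear_mderiv_chart[OF e order_refl Qd(1)[OF that(1)]]] by metis
    then show ?thesis using bil(2)[OF Qd(2)[OF that(1)]] by blast
  qed
  obtain x1 where x1: "x1 \<in> ?Q \<times> sphere 0 1"
    "\<forall>y\<in>?Q \<times> sphere 0 1. ?h (fst x1) (snd x1) (snd x1) \<le> ?h (fst y) (snd y) (snd y)"
    using continuous_attains_inf[OF cpt ne coH] by (elim bexE) (rule that)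
  obtain x2 where x2: "x2 \<in> ?Q \<times> sphere 0 1"
    "\<forall>y\<in>?Q \<times> sphere 0 1. ?h (fst y) (snd y) (snd y) \<le> ?h (fst x2) (snd x2) (snd x2)"
    using continuous_attains_sup[OF cpt ne coH] by (elim bexE) (rule that)
  define m where "m = ?h (fst x1) (snd x1) (snd x1)"
  define m' where "m' = ?h (fst x2) (snd x2) (snd x2)"
  have m: "m > 0" unfolding m_def using x1(1) by (intro pos) auto
  have m': "m' > 0" unfolding m'_def using x2(1) by (intro pos) auto
  have bnd: "m * (norm p)\<^sup>2 \<le> ?h u p p" "?h u p p \<le> m' * (norm p)\<^sup>2" if u: "u \<in> ?Q" for u p
  proof -
    have "m * (norm p)\<^sup>2 \<le> ?h u p p \<and> ?h u p p \<le> m' * (norm p)\<^sup>2"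
    proof (cases "p = 0")
      case True
      then show ?thesis using linear_0[OF linh(1)[OF u]] by simp
    next
      case False
      let ?q = "p /\<^sub>R norm p"
      have "(u, ?q) \<in> ?Q \<times> sphere 0 1" using u False by simp
      from x1(2)[rule_format, OF this] x2(2)[rule_format, OF this]
      have *: "m \<le> ?h u ?q ?q" "?h u ?q ?q \<le> m'" by (simp_all add: m_def m'_def)
      have sc: "?h u (norm p *\<^sub>R ?q) (norm p *\<^sub>R ?q) = (norm p)\<^sup>2 * ?h u ?q ?q"
        by (simp only: linear_cmul[OF linh(1)[OF u]] linear_cmul[OF linh(2)[OF u]])
           (simp add: power2_eq_square)
      have "norm p *\<^sub>R ?q = p" using False by simp
      with sc have eq: "?h u p p = (norm p)\<^sup>2 * ?h u ?q ?q" by simp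
      show ?thesis unfolding eq
        using mult_left_mono[OF *(1), of "(norm p)\<^sup>2"] mult_left_mono[OF *(2), of "(norm p)\<^sup>2"]
        by (simp add: mult.commute)
    qed
    then show "m * (norm p)\<^sup>2 \<le> ?h u p p" "?h u p p \<le> m' * (norm p)\<^sup>2" by auto
  qed
  obtain W0 where W0: "openin (mtop M) W0" "x \<in> W0" "W0 \<subseteq> fst ?e" "\<And>y. y \<in> W0 \<Longrightarrow> snd ?e y \<in> ?Q"
    using openin_cball_preimage[OF che xe \<rho>(1)] by blast
  obtain W1 K1 where W1: "openin (mtop M) W1" "x \<in> W1" "W1 \<subseteq> fst k \<inter> fst ?e" "K1 \<ge> 0"
    "\<And>y v. y \<in> W1 \<Longrightarrow> norm (mderiv M (snd ?e) y v) \<le> K1 * norm (mderiv M (snd k) y v)"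
    using chart_norms_equivalent[OF k e x xe] by blast
  obtain W2 K2 where W2: "openin (mtop M) W2" "x \<in> W2" "W2 \<subseteq> fst ?e \<inter> fst k" "K2 \<ge> 0"
    "\<And>y v. y \<in> W2 \<Longrightarrow> norm (mderiv M (snd k) y v) \<le> K2 * norm (mderiv M (snd ?e) y v)"
    using chart_norms_equivalent[OF e k xe x] by blast
  have ge: "m * (norm (mderiv M (snd ?e) y v))\<^sup>2 \<le> g y v v" "g y v v \<le> m' * (norm (mderiv M (snd ?e) y v))\<^sup>2"
    if y: "y \<in> W0" for y v
    using bnd[OF W0(4)[OF y], of "mderiv M (snd ?e) y v"] cinv_chart[OF che] cvec_mderiv[OF e order_refl] W0(3) y
    by auto
  have s1: "sqrt (g y v v) \<le> sqrt m' * norm (mderiv M (snd ?e) y v)" if y: "y \<in> W0" for y v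
    using real_sqrt_le_mono[OF ge(2)[OF y]] by (simp add: real_sqrt_mult)
  have s2: "sqrt m * norm (mderiv M (snd ?e) y v) \<le> sqrt (g y v v)" if y: "y \<in> W0" for y v
    using real_sqrt_le_mono[OF ge(1)[OF y]] by (simp add: real_sqrt_mult)
  \<comment> \<open>One constant for both inequalities: \<open>sqrt m' * K1\<close> serves the upper
    bound of the metric norm, \<open>K2 / sqrt m\<close> the lower one, and the sum dominates
    each.\<close>
  define K where "K = sqrt m' * K1 + K2 / sqrt m"
  have Kle: "sqrt m' * K1 \<le> K" "K2 / sqrt m \<le> K" "0 \<le> K"
    unfolding K_def using m m' W1(4) W2(4) by auto
  show thesis
  proof (rule that[of "W0 \<inter> W1 \<inter> W2" K])
    show "openin (mtop M) (W0 \<inter> W1 \<inter> W2)" using W0(1) W1(1) W2(1) by (simp add: openin_Int)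
    show "x \<in> W0 \<inter> W1 \<inter> W2" "W0 \<inter> W1 \<inter> W2 \<subseteq> fst k" using W0 W1 W2 by auto
    fix y v assume "y \<in> W0 \<inter> W1 \<inter> W2"
    then have y: "y \<in> W0" "y \<in> W1" "y \<in> W2" by auto
    have "sqrt (g y v v) \<le> sqrt m' * (K1 * norm (mderiv M (snd k) y v))"
      by (rule order_trans[OF s1[OF y(1)] mult_left_mono[OF W1(5)[OF y(2)]]]) (use m' in simp)
    also have "\<dots> \<le> K * norm (mderiv M (snd k) y v)"
      using mult_right_mono[OF Kle(1) norm_ge_zero] by (simp add: mult.assoc)
    finally show "sqrt (g y v v) \<le> K * norm (mderiv M (snd k) y v)" .
    have "norm (mderiv M (snd ?e) y v) \<le> sqrt (g y v v) / sqrt m"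
      using s2[OF y(1), of v] m by (simp add: pos_le_divide_eq mult.commute)
    then have "norm (mderiv M (snd k) y v) \<le> K2 * (sqrt (g y v v) / sqrt m)"
      using W2(5)[OF y(3), of v] mult_left_mono[OF _ W2(4)] by fastforce
    also have "\<dots> = K2 / sqrt m * sqrt (g y v v)" by simp
    also have "\<dots> \<le> K * sqrt (g y v v)"
    proof (rule mult_right_mono[OF Kle(2)])
      have "0 \<le> m * (norm (mderiv M (snd ?e) y v))\<^sup>2" using m by simp
      then show "0 \<le> sqrt (g y v v)" using ge(1)[OF y(1), of v] by auto
    qed
    finally show "norm (mderiv M (snd k) y v) \<le> K * sqrt (g y v v)" .
  qed (rule Kle(3))
qed

text \<open>The frames in the definition of a subbundle live in some atlas chart. Here they become
  linear maps \<open>A u\<close>, injective on one fixed subspace \<open>Z\<close> and mapping it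
  onto the fibre, in the coordinates of the prescribed chart \<open>c\<close>. With a fixed domain
  the estimates for compact families apply.\<close>

lemma subbundle_frame:
  assumes E: "continuous_subbundle M E" and c: "Cr_chart 1 M c" and x: "x \<in> fst c"
  obtains \<rho> Z A where "\<rho> > 0" "cball (snd c x) \<rho> \<subseteq> snd c ` fst c" "subspace (Z :: 'e set)"
    "\<And>p. continuous_on (cball (snd c x) \<rho>) (\<lambda>u. A u p)"
    "\<And>u. u \<in> cball (snd c x) \<rho> \<Longrightarrow> linear (A u)"
    "\<And>u p. u \<in> cball (snd c x) \<rho> \<Longrightarrow> p \<in> Z \<Longrightarrow> A u p = 0 \<Longrightarrow> p = 0"
    "\<And>u. u \<in> cball (snd c x) \<rho> \<Longrightarrow> A u ` Z = mderiv M (snd c) (cinv c u) ` E (cinv c u)"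
proof -
  have t: "x \<in> topspace (mtop M)" using Cr_chart_topspace c x by blast
  note chc = Cr_chart_is_chart[OF c]
  from E[unfolded continuous_subbundle_def, THEN conjunct2, rule_format, OF t]
  obtain c0 W and k :: nat and s where c0: "c0 \<in> atl M" and W: "openin (mtop M) W" "x \<in> W" "W \<subseteq> fst c0"
    and cs': "\<forall>i<k. continuous_map (subtopology (mtop M) W) euclidean (s i)"
    and fr': "\<forall>y\<in>W. inj_on (\<lambda>i. s i y) {..<k} \<and> independent ((\<lambda>i. s i y) ` {..<k}) \<and>
      span ((\<lambda>i. s i y) ` {..<k}) = mderiv M (snd c0) y ` E y"
    by (elim bexE exE conjE) (rule that)
  have cs: "\<And>i. i < k \<Longrightarrow> continuous_map (subtopology (mtop M) W) euclidean (s i)"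
    using cs' by simp
  have fr: "\<And>y. y \<in> W \<Longrightarrow> inj_on (\<lambda>i. s i y) {..<k}" "\<And>y. y \<in> W \<Longrightarrow> independent ((\<lambda>i. s i y) ` {..<k})"
      "\<And>y. y \<in> W \<Longrightarrow> span ((\<lambda>i. s i y) ` {..<k}) = mderiv M (snd c0) y ` E y"
    using fr' by simp_all
  have k0: "Cr_chart 1 M c0" using atl_Cr_chart[OF c0] .
  note ch0 = Cr_chart_is_chart[OF k0]
  have "k = card ((\<lambda>i. s i x) ` {..<k})" using card_image[OF fr(1)[OF W(2)]] by simp
  also have "\<dots> \<le> DIM('e)" using independent_bound[OF fr(2)[OF W(2)]] by blast
  finally have kD: "k \<le> DIM('e)" .
  \<comment> \<open>Since \<open>k\<close> is at most \<open>DIM('e)\<close>, the indices of the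
    frame can be matched with the first \<open>k\<close> vectors of an enumeration of the standard
    basis; \<open>Z\<close> is the span of these.\<close>
  obtain b :: "nat \<Rightarrow> 'e" where b: "bij_betw b {0..<DIM('e)} Basis"
    using ex_bij_betw_nat_finite[OF finite_Basis] by blast
  have bB: "b i \<in> Basis" if "i < k" for i using b that kD by (auto simp: bij_betw_def)
  have bb: "b i \<bullet> b j = (if i = j then 1 else 0)" if "i < k" "j < k" for i j
    using that kD b bB by (auto simp: inner_Basis bij_betw_def inj_on_def)
  define Z where "Z = {p::'e. \<forall>i\<in>Basis. i \<notin> b ` {..<k} \<longrightarrow> p \<bullet> i = 0}"
  have Z: "subspace Z" unfolding Z_def by (auto simp: subspace_def inner_add_left)
  define A0 where "A0 y p = (\<Sum>i<k. (p \<bullet> b i) *\<^sub>R s i y)" for y p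
  have linA0: "linear (A0 y)" for y
    unfolding A0_def by (rule linearI) (auto simp: inner_add_left scaleR_add_left sum.distrib scaleR_sum_right)
  have injA0: "p = 0" if y: "y \<in> W" and p: "p \<in> Z" "A0 y p = 0" for y p
  proof -
    let ?B = "(\<lambda>i. s i y) ` {..<k}"
    have "(\<Sum>v\<in>?B. (p \<bullet> b (the_inv_into {..<k} (\<lambda>i. s i y) v)) *\<^sub>R v) = A0 y p"
      unfolding A0_def sum.reindex[OF fr(1)[OF y]]
      by (rule sum.cong) (use the_inv_into_f_f[OF fr(1)[OF y]] in auto)
    then have z: "\<forall>v\<in>?B. p \<bullet> b (the_inv_into {..<k} (\<lambda>i. s i y) v) = 0"
      using fr(2)[OF y] p(2) unfolding dependent_finite[OF finite_imageI[OF finite_lessThan]] by auto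
    have "p \<bullet> b i = 0" if "i < k" for i
    proof -
      have "p \<bullet> b (the_inv_into {..<k} (\<lambda>i. s i y) (s i y)) = 0" using z that by blast
      then show ?thesis using the_inv_into_f_f[OF fr(1)[OF y], of i] that by simp
    qed
    then have "p \<bullet> i = 0" if "i \<in> Basis" for i using p(1) that unfolding Z_def by auto
    then show "p = 0" by (simp add: euclidean_eq_iff[of p])
  qed
  have imA0: "A0 y ` Z = mderiv M (snd c0) y ` E y" if y: "y \<in> W" for y
    unfolding fr(3)[OF y, symmetric]
  proof
    show "A0 y ` Z \<subseteq> span ((\<lambda>i. s i y) ` {..<k})"
      unfolding A0_def by (auto intro!: span_sum span_scale intro: span_base)
    show "span ((\<lambda>i. s i y) ` {..<k}) \<subseteq> A0 y ` Z"
    proof (rule span_minimal)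
      show "subspace (A0 y ` Z)" by (rule linear_subspace_image[OF linA0 Z])
      show "(\<lambda>i. s i y) ` {..<k} \<subseteq> A0 y ` Z"
      proof
        fix w assume "w \<in> (\<lambda>i. s i y) ` {..<k}"
        then obtain j where j: "j < k" "w = s j y" by auto
        have "A0 y (b j) = (\<Sum>i<k. if i = j then s i y else 0)"
          unfolding A0_def by (rule sum.cong) (use bb j(1) in auto)
        then have "A0 y (b j) = w" using j by simp
        moreover have "b j \<in> Z" unfolding Z_def using bB[OF j(1)] j(1) by (auto simp: inner_Basis)
        ultimately show "w \<in> A0 y ` Z" by blast
      qed
    qed
  qed
  have o: "openin (mtop M) (W \<inter> fst c)" using W(1) chart_openin[OF chc] by (simp add: openin_Int)
  obtain \<rho> where \<rho>: "\<rho> > 0" "cball (snd c x) \<rho> \<subseteq> snd c ` (W \<inter> fst c)"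
    by (rule cball_chart[OF chc o]) (use x W in auto)
  let ?Q = "cball (snd c x) \<rho>"
  have Qd: "cinv c u \<in> W" "cinv c u \<in> fst c" "cinv c u \<in> fst c0" if u: "u \<in> ?Q" for u
  proof -
    obtain y where "y \<in> W" "y \<in> fst c" "u = snd c y" using \<rho>(2) u by blast
    then show "cinv c u \<in> W" "cinv c u \<in> fst c" "cinv c u \<in> fst c0"
      using cinv_chart[OF chc] W(3) by auto
  qed
  \<comment> \<open>Change of coordinates on tangent vectors, from the chart \<open>c0\<close> of
    the frame to \<open>c\<close>.\<close>
  let ?\<tau> = "\<lambda>y p. mderiv M (snd c) y (cvec M c0 y p)"
  have lin\<tau>: "linear (?\<tau> y)" if "y \<in> fst c" "y \<in> fst c0" for y
    using linear_compose[OF linear_cvec[OF k0 order_refl that(2)] linear_mderiv_chart[OF c order_refl that(1)]]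
    by (simp add: o_def)
  define A where "A u p = ?\<tau> (cinv c u) (A0 (cinv c u) p)" for u p
  have cmQ: "continuous_map (top_of_set ?Q) (mtop M) (cinv c)"
    by (rule continuous_map_from_subtopology_mono[OF continuous_map_cinv[OF chc]]) (use \<rho>(2) in auto)
  have csQ: "continuous_on ?Q (\<lambda>u. s i (cinv c u))" if "i < k" for i
  proof -
    have "continuous_map (top_of_set ?Q) (subtopology (mtop M) W) (cinv c)"
      using cmQ Qd(1) by (auto simp: continuous_map_in_subtopology)
    from continuous_map_compose[OF this cs[OF that]] show ?thesis by (simp add: o_def)
  qed
  then have cA0: "continuous_on ?Q (\<lambda>u. A0 (cinv c u) p)" for p
    unfolding A0_def by (intro continuous_intros) auto
  have c\<tau>: "continuous_on ?Q (\<lambda>u. ?\<tau> (cinv c u) q)" for q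
  proof -
    have tr: "continuous_on ?Q (\<lambda>u. snd c0 (cinv c u))"
      by (rule continuous_on_subset[OF C_on_imp_continuous[OF Cr_chart_transition[OF c k0]]]) (use \<rho>(2) W(3) in blast)
    have "continuous_on ?Q (\<lambda>u. (\<lambda>w. ?\<tau> (cinv c0 w) q) (snd c0 (cinv c u)))"
      by (rule continuous_on_compose2[OF continuous_on_transition_derivative[OF k0 order_refl c] tr]) (use Qd in auto)
    then show ?thesis
      by (rule continuous_on_eq) (use Qd(3) cinv_chart[OF ch0] in simp)
  qed
  have cA: "continuous_on ?Q (\<lambda>u. A u p)" for p
  proof -
    have "continuous_on ?Q (\<lambda>u. \<Sum>b\<in>Basis. (A0 (cinv c u) p \<bullet> b) *\<^sub>R ?\<tau> (cinv c u) b)"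
      by (intro continuous_intros cA0 c\<tau>)
    then show ?thesis
      by (rule continuous_on_eq) (unfold A_def, rule linear_expand[OF lin\<tau>, symmetric], use Qd in auto)
  qed
  have \<tau>0: "p = 0" if "y \<in> fst c" "y \<in> fst c0" "?\<tau> y p = 0" for y p
    using that cvec_mderiv[OF c order_refl that(1), of "cvec M c0 y p"] mderiv_cvec[OF k0 order_refl that(2), of p]
      linear_0[OF linear_cvec[OF c order_refl that(1)]] linear_0[OF linear_mderiv_chart[OF k0 order_refl that(2)]] by metis
  show thesis
  proof (rule that[OF \<rho>(1) _ Z, of A])
    show "?Q \<subseteq> snd c ` fst c" using \<rho>(2) by blast
    show "continuous_on ?Q (\<lambda>u. A u p)" for p by (rule cA)
    show "linear (A u)" if "u \<in> ?Q" for u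
      using linear_compose[OF linA0 lin\<tau>[OF Qd(2,3)[OF that]]] unfolding A_def by (simp add: o_def)
    show "p = 0" if "u \<in> ?Q" "p \<in> Z" "A u p = 0" for u p
      using injA0[OF Qd(1)[OF that(1)] that(2)] \<tau>0[OF Qd(2,3)[OF that(1)]] that(3) unfolding A_def by blast
    show "A u ` Z = mderiv M (snd c) (cinv c u) ` E (cinv c u)" if "u \<in> ?Q" for u
    proof -
      have "A u ` Z = ?\<tau> (cinv c u) ` A0 (cinv c u) ` Z" unfolding A_def by (simp add: image_image)
      also have "\<dots> = ?\<tau> (cinv c u) ` mderiv M (snd c0) (cinv c u) ` E (cinv c u)"
        using imA0[OF Qd(1)[OF that]] by simp
      also have "\<dots> = mderiv M (snd c) (cinv c u) ` E (cinv c u)"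
        using cvec_mderiv[OF k0 order_refl Qd(3)[OF that]] by (simp add: image_image)
      finally show ?thesis .
    qed
  qed
qed

end

section \<open>Invariance of the splitting under the transverse complex structure\<close>

locale ph_flow = th_flow M \<phi> X T
  for M :: "('a, 'e::euclidean_space) manifold" and \<phi> and X and T :: "('a, real \<times> (complex^'q)) chart set" +
  fixes Es Ec Eu :: "'a \<Rightarrow> 'e set"
  assumes compact_M: "compact_space (mtop M)"
    and part_hyp: "partially_hyperbolic M \<phi> X Es Ec Eu"
begin

lemma subbundles: "E \<in> {Es, Ec, Eu} \<Longrightarrow> continuous_subbundle M E"
  using part_hyp by (simp only: partially_hyperbolic_def)

lemma bundle_subspace: "E \<in> {Es, Ec, Eu} \<Longrightarrow> x \<in> topspace (mtop M) \<Longrightarrow> subspace (E x)"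
  using subbundles by (simp only: continuous_subbundle_def)

lemma bundle_invariant:
  assumes "E \<in> {Es, Ec, Eu}" "x \<in> topspace (mtop M)" "v \<in> E x"
  shows "tmap M (\<phi> t) x v \<in> E (\<phi> t x)"
proof -
  have "tmap M (\<phi> t) x ` E x = E (\<phi> t x)"
    using part_hyp assms(1,2) unfolding partially_hyperbolic_def by blast
  then show ?thesis using assms(3) by blast
qed

lemma splitting:
  assumes "x \<in> topspace (mtop M)"
  shows "\<exists>!p. case p of (a, b, r, d) \<Rightarrow> a \<in> Es x \<and> b \<in> Ec x \<and> d \<in> Eu x \<and> v = a + b + r *\<^sub>R X x + d"
  using part_hyp[unfolded partially_hyperbolic_def, THEN conjunct2, THEN conjunct1, THEN bspec, OF assms]
  by (rule spec)

lemma splitting_ex: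
  assumes "x \<in> topspace (mtop M)"
  obtains a b r d where "a \<in> Es x" "b \<in> Ec x" "d \<in> Eu x" "v = a + b + r *\<^sub>R X x + d"
  using ex1_implies_ex[OF splitting[OF assms, of v]] by auto

lemma splitting_unique:
  assumes x: "x \<in> topspace (mtop M)" and "a \<in> Es x" "b \<in> Ec x" "d \<in> Eu x" "a' \<in> Es x" "b' \<in> Ec x" "d' \<in> Eu x"
    and eq: "a + b + r *\<^sub>R X x + d = a' + b' + r' *\<^sub>R X x + d'"
  shows "a = a' \<and> b = b' \<and> r = r' \<and> d = d'"
proof -
  let ?P = "\<lambda>p. case p of (a, b, r, d) \<Rightarrow> a \<in> Es x \<and> b \<in> Ec x \<and> d \<in> Eu x \<and>
    a + b + r *\<^sub>R X x + d = a + b + r *\<^sub>R X x + d"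
  have "(a, b, r, d) = (a', b', r', d')"
    by (rule ex1E[OF splitting[OF x, of "a + b + r *\<^sub>R X x + d"]]) (use assms in auto)
  then show ?thesis by simp
qed

lemma splitting_zero:
  assumes x: "x \<in> topspace (mtop M)" and "a \<in> Es x" "b \<in> Ec x" "d \<in> Eu x" "a + b + d = r *\<^sub>R X x"
  shows "a = 0 \<and> b = 0 \<and> d = 0"
proof -
  have "0 \<in> Es x" "0 \<in> Ec x" "0 \<in> Eu x"
    using subspace_0[OF bundle_subspace[OF _ x]] by auto
  moreover have "a + b + (- r) *\<^sub>R X x + d = 0 + 0 + 0 *\<^sub>R X x + 0"
    using assms(5) by (simp add: algebra_simps)
  ultimately show ?thesis using splitting_unique[OF x assms(2-4)] by blast
qed

abbreviation "H \<equiv> sum_bundle (sum_bundle Es Ec) Eu"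

lemma H_iff: "v \<in> H x \<longleftrightarrow> (\<exists>a\<in>Es x. \<exists>b\<in>Ec x. \<exists>d\<in>Eu x. v = a + b + d)"
  unfolding sum_bundle_def by auto

text \<open>The kernel of \<open>dz\<close> is the flow direction, which meets \<open>H x\<close>
  only in 0 because the splitting is direct.\<close>

lemma H_eqI:
  assumes c: "c \<in> T" "x \<in> fst c" and v: "v \<in> H x" "w \<in> H x" and eq: "dz M c x v = dz M c x w"
  shows "v = w"
proof -
  have x: "x \<in> topspace (mtop M)" using T_topspace c by blast
  note sub = bundle_subspace[OF _ x]
  obtain a b d where 1: "a \<in> Es x" "b \<in> Ec x" "d \<in> Eu x" "v = a + b + d" using v(1) H_iff by auto
  obtain a' b' d' where 2: "a' \<in> Es x" "b' \<in> Ec x" "d' \<in> Eu x" "w = a' + b' + d'" using v(2) H_iff by auto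
  have "dz M c x (v - w) = 0" using eq linear_diff[OF linear_dz[OF c]] by simp
  then obtain r where "v - w = r *\<^sub>R X x" using dz_kernel[OF c] by blast
  then have s: "(a - a') + (b - b') + (d - d') = r *\<^sub>R X x" using 1 2 by (simp add: algebra_simps)
  then have "a - a' = 0 \<and> b - b' = 0 \<and> d - d' = 0"
    by (intro splitting_zero[OF x _ _ _ s] subspace_diff[OF sub] 1 2) simp_all
  then show ?thesis using 1 2 by simp
qed

lemma H_rotation_ex:
  assumes c: "c \<in> T" "x \<in> fst c"
  obtains a b d where "a \<in> Es x" "b \<in> Ec x" "d \<in> Eu x" "dz M c x (a + b + d) = z"
proof -
  have x: "x \<in> topspace (mtop M)" using T_topspace c by blast
  let ?w = "cvec M c x (0, z)"
  have w: "dz M c x ?w = z"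
    using dz_eq[OF c] mderiv_cvec[OF T_Cr_chart[OF c(1), of 1] order_refl c(2)] by simp
  obtain a b r d where *: "a \<in> Es x" "b \<in> Ec x" "d \<in> Eu x" "?w = a + b + r *\<^sub>R X x + d"
    using splitting_ex[OF x, of ?w] by metis
  have "a + b + d = ?w - r *\<^sub>R X x" using *(4) by simp
  then have "dz M c x (a + b + d) = dz M c x ?w - r *\<^sub>R dz M c x (X x)"
    using linear_diff[OF linear_dz[OF c]] linear_cmul[OF linear_dz[OF c]] by simp
  then show thesis using that[OF *(1-3)] w dz_X[OF c] by simp
qed

text \<open>The two comparisons by which \<open>I\<close> is bounded: components are controlled by
  the transverse norm of their sum, and the transverse norm by the metric. The norm of
  \<open>dz\<close> depends on the chart; later \<open>K\<close> becomes uniform while the chart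
  still varies with the point.\<close>

definition components_bounded :: "('a \<Rightarrow> 'e \<Rightarrow> 'e \<Rightarrow> real) \<Rightarrow> real \<Rightarrow> ('a, real \<times> (complex^'q)) chart \<Rightarrow> 'a \<Rightarrow> bool" where
  "components_bounded g K c y \<longleftrightarrow> y \<in> fst c \<and>
     (\<forall>a\<in>Es y. \<forall>b\<in>Ec y. \<forall>d\<in>Eu y. sqrt (g y a a) \<le> K * norm (dz M c y (a + b + d)) \<and>
        sqrt (g y b b) \<le> K * norm (dz M c y (a + b + d)) \<and> sqrt (g y d d) \<le> K * norm (dz M c y (a + b + d))) \<and>
     (\<forall>v. norm (dz M c y v) \<le> K * sqrt (g y v v))"

lemma metric_nonneg:
  assumes g: "riemannian_metric M g" and y: "y \<in> topspace (mtop M)"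
  shows "0 \<le> sqrt (g y v v)"
proof (cases "v = 0")
  case True
  have "bilinear (g y)" using g y unfolding riemannian_metric_def by blast
  then show ?thesis using True by (simp add: bilinear_lzero)
next
  case False
  then have "0 < g y v v" using g y unfolding riemannian_metric_def by blast
  then show ?thesis by simp
qed

lemma components_bounded_mono:
  assumes g: "riemannian_metric M g" and y: "y \<in> topspace (mtop M)"
    and b: "components_bounded g K c y" and le: "K \<le> K'"
  shows "components_bounded g K' c y"
proof -
  have "K * norm z \<le> K' * norm z" for z :: "complex^'q" using le by (rule mult_right_mono) simp
  moreover have "K * sqrt (g y v v) \<le> K' * sqrt (g y v v)" for v
    using le metric_nonneg[OF g y] by (rule mult_right_mono)
  ultimately show ?thesis using b unfolding components_bounded_def by (meson order_trans)
qed

text \<open>The sum of the three frames, followed by the transverse coordinate, is a continuous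
  family of linear maps on \<open>Z1 \<times> Z2 \<times> Z3\<close>. It is injective: a sum of
  components killed by \<open>dz\<close> is a multiple of \<open>X\<close>, hence zero in each
  bundle. Compactness then gives the lower bound \<open>m\<close>.\<close>

lemma components_local_bound:
  assumes g: "riemannian_metric M g" and x: "x \<in> topspace (mtop M)"
  shows "\<exists>W c K. openin (mtop M) W \<and> x \<in> W \<and> c \<in> T \<and> K \<ge> 0 \<and> (\<forall>y\<in>W. components_bounded g K c y)"
proof -
  obtain c where c: "c \<in> T" "x \<in> fst c" using T_cover[OF x] by blast
  have k: "Cr_chart 1 M c" using T_Cr_chart[OF c(1)] .
  note ch = T_is_chart[OF c(1)]
  obtain \<rho>1 Z1 A1 where 1: "\<rho>1 > 0" "cball (snd c x) \<rho>1 \<subseteq> snd c ` fst c" "subspace (Z1 :: 'e set)"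
    "\<And>p. continuous_on (cball (snd c x) \<rho>1) (\<lambda>u. A1 u p)"
    "\<And>u. u \<in> cball (snd c x) \<rho>1 \<Longrightarrow> linear (A1 u)"
    "\<And>u p. u \<in> cball (snd c x) \<rho>1 \<Longrightarrow> p \<in> Z1 \<Longrightarrow> A1 u p = 0 \<Longrightarrow> p = 0"
    "\<And>u. u \<in> cball (snd c x) \<rho>1 \<Longrightarrow> A1 u ` Z1 = mderiv M (snd c) (cinv c u) ` Es (cinv c u)"
    by (rule subbundle_frame[OF subbundles[of Es] k c(2)]) (simp, rule that)
  obtain \<rho>2 Z2 A2 where 2: "\<rho>2 > 0" "cball (snd c x) \<rho>2 \<subseteq> snd c ` fst c" "subspace (Z2 :: 'e set)"
    "\<And>p. continuous_on (cball (snd c x) \<rho>2) (\<lambda>u. A2 u p)"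
    "\<And>u. u \<in> cball (snd c x) \<rho>2 \<Longrightarrow> linear (A2 u)"
    "\<And>u p. u \<in> cball (snd c x) \<rho>2 \<Longrightarrow> p \<in> Z2 \<Longrightarrow> A2 u p = 0 \<Longrightarrow> p = 0"
    "\<And>u. u \<in> cball (snd c x) \<rho>2 \<Longrightarrow> A2 u ` Z2 = mderiv M (snd c) (cinv c u) ` Ec (cinv c u)"
    by (rule subbundle_frame[OF subbundles[of Ec] k c(2)]) (simp, rule that)
  obtain \<rho>3 Z3 A3 where 3: "\<rho>3 > 0" "cball (snd c x) \<rho>3 \<subseteq> snd c ` fst c" "subspace (Z3 :: 'e set)"
    "\<And>p. continuous_on (cball (snd c x) \<rho>3) (\<lambda>u. A3 u p)"
    "\<And>u. u \<in> cball (snd c x) \<rho>3 \<Longrightarrow> linear (A3 u)"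
    "\<And>u p. u \<in> cball (snd c x) \<rho>3 \<Longrightarrow> p \<in> Z3 \<Longrightarrow> A3 u p = 0 \<Longrightarrow> p = 0"
    "\<And>u. u \<in> cball (snd c x) \<rho>3 \<Longrightarrow> A3 u ` Z3 = mderiv M (snd c) (cinv c u) ` Eu (cinv c u)"
    by (rule subbundle_frame[OF subbundles[of Eu] k c(2)]) (simp, rule that)
  define \<rho> where "\<rho> = min \<rho>1 (min \<rho>2 \<rho>3)"
  have \<rho>: "\<rho> > 0" using 1(1) 2(1) 3(1) by (simp add: \<rho>_def)
  let ?Q = "cball (snd c x) \<rho>"
  have Q: "?Q \<subseteq> cball (snd c x) \<rho>1" "?Q \<subseteq> cball (snd c x) \<rho>2" "?Q \<subseteq> cball (snd c x) \<rho>3"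
    unfolding \<rho>_def by (auto intro: subset_cball)
  have Qd: "cinv c u \<in> fst c" if "u \<in> ?Q" for u
    using cinv_in[OF ch] 1(2) Q(1) that by blast
  define f :: "real \<times> (complex^'q) \<Rightarrow> 'e \<times> 'e \<times> 'e \<Rightarrow> complex^'q"
    where "f u P = snd (A1 u (fst P) + A2 u (fst (snd P)) + A3 u (snd (snd P)))" for u P
  have lin: "linear (A1 u)" "linear (A2 u)" "linear (A3 u)" if "u \<in> ?Q" for u
    using 1(5) 2(5) 3(5) Q that by blast+
  have linf: "linear (f u)" if "u \<in> ?Q" for u
    unfolding f_def
    by (rule linearI)
      (simp_all add: linear_add[OF lin(1)[OF that]] linear_add[OF lin(2)[OF that]] linear_add[OF lin(3)[OF that]]
        linear_cmul[OF lin(1)[OF that]] linear_cmul[OF lin(2)[OF that]] linear_cmul[OF lin(3)[OF that]]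
        scaleR_add_right)
  have cont: "continuous_on ?Q (\<lambda>u. A1 u p)" "continuous_on ?Q (\<lambda>u. A2 u p)" "continuous_on ?Q (\<lambda>u. A3 u p)" for p
    using continuous_on_subset[OF 1(4) Q(1)] continuous_on_subset[OF 2(4) Q(2)] continuous_on_subset[OF 3(4) Q(3)]
    by blast+
  have contf: "continuous_on ?Q (\<lambda>u. f u P)" for P
    unfolding f_def by (intro continuous_on_snd continuous_on_add cont)
  have injf: "P = 0" if u: "u \<in> ?Q" and P: "P \<in> Z1 \<times> Z2 \<times> Z3" and f0: "f u P = 0" for u P
  proof -
    obtain p1 p2 p3 where p: "P = (p1, p2, p3)" "p1 \<in> Z1" "p2 \<in> Z2" "p3 \<in> Z3" using P by auto
    let ?y = "cinv c u"
    obtain a where a: "a \<in> Es ?y" "A1 u p1 = mderiv M (snd c) ?y a" using 1(7) Q(1) u p(2) by blast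
    obtain b where b: "b \<in> Ec ?y" "A2 u p2 = mderiv M (snd c) ?y b" using 2(7) Q(2) u p(3) by blast
    obtain d where d: "d \<in> Eu ?y" "A3 u p3 = mderiv M (snd c) ?y d" using 3(7) Q(3) u p(4) by blast
    note y = Qd[OF u]
    note lc = linear_mderiv_chart[OF k order_refl y]
    have "dz M c ?y (a + b + d) = 0"
      using f0 by (simp add: dz_eq[OF c(1) y] linear_add[OF lc] f_def p(1) a b d)
    then obtain r where "a + b + d = r *\<^sub>R X ?y" using dz_kernel[OF c(1) y] by blast
    then have "a = 0 \<and> b = 0 \<and> d = 0" using splitting_zero[OF T_topspace[OF c(1) y] a(1) b(1) d(1)] by blast
    then have z: "A1 u p1 = 0" "A2 u p2 = 0" "A3 u p3 = 0" using a b d linear_0[OF lc] by auto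
    have "p1 = 0" by (rule 1(6)[OF subsetD[OF Q(1) u] p(2) z(1)])
    moreover have "p2 = 0" by (rule 2(6)[OF subsetD[OF Q(2) u] p(3) z(2)])
    moreover have "p3 = 0" by (rule 3(6)[OF subsetD[OF Q(3) u] p(4) z(3)])
    ultimately show "P = 0" by (simp add: p(1) zero_prod_def)
  qed
  have "\<exists>m>0. \<forall>u\<in>?Q. \<forall>P\<in>Z1 \<times> Z2 \<times> Z3. m * norm P \<le> norm (f u P)"
    by (rule compact_linear_family_below[OF compact_cball linf contf
          subspace_Times[OF 1(3) subspace_Times[OF 2(3) 3(3)]] injf])
  then obtain m where m0: "m > 0" and m: "\<forall>u\<in>?Q. \<forall>P\<in>Z1 \<times> Z2 \<times> Z3. m * norm P \<le> norm (f u P)"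
    by (elim exE conjE) (rule that)
  have "\<exists>K\<ge>0. \<forall>u\<in>?Q. \<forall>p. norm (A1 u p) \<le> K * norm p"
    by (rule compact_linear_family_bounded[OF compact_cball lin(1) cont(1)])
  then obtain K1 where K1: "K1 \<ge> 0" "\<forall>u\<in>?Q. \<forall>p. norm (A1 u p) \<le> K1 * norm p"
    by (elim exE conjE) (rule that)
  have "\<exists>K\<ge>0. \<forall>u\<in>?Q. \<forall>p. norm (A2 u p) \<le> K * norm p"
    by (rule compact_linear_family_bounded[OF compact_cball lin(2) cont(2)])
  then obtain K2 where K2: "K2 \<ge> 0" "\<forall>u\<in>?Q. \<forall>p. norm (A2 u p) \<le> K2 * norm p"
    by (elim exE conjE) (rule that)
  have "\<exists>K\<ge>0. \<forall>u\<in>?Q. \<forall>p. norm (A3 u p) \<le> K * norm p"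
    by (rule compact_linear_family_bounded[OF compact_cball lin(3) cont(3)])
  then obtain K3 where K3: "K3 \<ge> 0" "\<forall>u\<in>?Q. \<forall>p. norm (A3 u p) \<le> K3 * norm p"
    by (elim exE conjE) (rule that)
  obtain W1 K where W1: "openin (mtop M) W1" "x \<in> W1" "W1 \<subseteq> fst c" "K \<ge> 0"
    "\<And>y v. y \<in> W1 \<Longrightarrow> sqrt (g y v v) \<le> K * norm (mderiv M (snd c) y v)"
    "\<And>y v. y \<in> W1 \<Longrightarrow> norm (mderiv M (snd c) y v) \<le> K * sqrt (g y v v)"
    using metric_norm_equivalent[OF g k c(2)] by blast
  obtain W2 where W2: "openin (mtop M) W2" "x \<in> W2" "W2 \<subseteq> fst c" "\<And>y. y \<in> W2 \<Longrightarrow> snd c y \<in> ?Q"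
    using openin_cball_preimage[OF ch c(2) \<rho>] by blast
  define L where "L = K1 + K2 + K3"
  \<comment> \<open>\<open>K * L / m\<close> bounds the components: \<open>K\<close> compares the
    metric with the chart norm, \<open>L\<close> bounds the frames, \<open>1 / m\<close> the frame
    coordinates. The summand \<open>K\<close> serves the bound on \<open>dz\<close>.\<close>
  define K' where "K' = K + K * L / m"
  have L: "L \<ge> 0" using K1(1) K2(1) K3(1) by (simp add: L_def)
  have K': "K' \<ge> 0" "K \<le> K'" "K * (L / m) \<le> K'" using W1(4) L m0 by (simp_all add: K'_def)
  have b1: "norm (dz M c y v) \<le> K' * sqrt (g y v v)" if y: "y \<in> W1 \<inter> W2" for y v
  proof -
    have yc: "y \<in> fst c" using y W1(3) by blast
    have "norm (dz M c y v) \<le> norm (mderiv M (snd c) y v)"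
      unfolding dz_eq[OF c(1) yc] by (metis norm_snd_le prod.collapse)
    also have "\<dots> \<le> K * sqrt (g y v v)" using W1(6) y by blast
    also have "\<dots> \<le> K' * sqrt (g y v v)"
      using K'(2) metric_nonneg[OF g T_topspace[OF c(1) yc]] by (rule mult_right_mono)
    finally show ?thesis .
  qed
  have b2: "sqrt (g y a a) \<le> K' * norm (dz M c y (a + b + d)) \<and> sqrt (g y b b) \<le> K' * norm (dz M c y (a + b + d)) \<and>
    sqrt (g y d d) \<le> K' * norm (dz M c y (a + b + d))"
    if y: "y \<in> W1 \<inter> W2" and abd: "a \<in> Es y" "b \<in> Ec y" "d \<in> Eu y" for y a b d
  proof -
    let ?u = "snd c y" and ?l = "mderiv M (snd c) y"
    have yc: "y \<in> fst c" and u: "?u \<in> ?Q" using y W1(3) W2(4) by blast+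
    have cy: "cinv c ?u = y" using cinv_chart[OF ch yc] .
    obtain p1 where p1: "p1 \<in> Z1" "?l a = A1 ?u p1" using 1(7)[of ?u] Q(1) u abd(1) unfolding cy by blast
    obtain p2 where p2: "p2 \<in> Z2" "?l b = A2 ?u p2" using 2(7)[of ?u] Q(2) u abd(2) unfolding cy by blast
    obtain p3 where p3: "p3 \<in> Z3" "?l d = A3 ?u p3" using 3(7)[of ?u] Q(3) u abd(3) unfolding cy by blast
    let ?P = "(p1, p2, p3)" and ?n = "norm (dz M c y (a + b + d))"
    note lc = linear_mderiv_chart[OF k order_refl yc]
    have "f ?u ?P = dz M c y (a + b + d)"
      by (simp add: f_def dz_eq[OF c(1) yc] linear_add[OF lc] p1 p2 p3)
    then have mP: "norm ?P \<le> ?n / m"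
      using m[rule_format, OF u, of ?P] p1(1) p2(1) p3(1) m0 by (simp add: pos_le_divide_eq mult.commute)
    have pP: "norm p1 \<le> norm ?P" "norm p2 \<le> norm ?P" "norm p3 \<le> norm ?P"
      using norm_fst_le[of p1 "(p2, p3)"] norm_snd_le[of "(p2, p3)" p1] norm_fst_le[of p2 p3] norm_snd_le[of p3 p2]
      by linarith+
    have key: "sqrt (g y v v) \<le> K' * ?n" if v: "norm (?l v) \<le> k' * norm p" "norm p \<le> norm ?P" "0 \<le> k'" "k' \<le> L"
      for v k' and p :: 'e
    proof -
      have "sqrt (g y v v) \<le> K * norm (?l v)" using W1(5) y by blast
      also have "\<dots> \<le> K * (L * (?n / m))"
      proof (rule mult_left_mono[OF _ W1(4)])
        have "k' * norm p \<le> L * (?n / m)" using v mP L by (intro mult_mono) auto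
        then show "norm (?l v) \<le> L * (?n / m)" using v(1) by linarith
      qed
      also have "\<dots> = K * (L / m) * ?n" by simp
      also have "\<dots> \<le> K' * ?n" using mult_right_mono[OF K'(3) norm_ge_zero] .
      finally show ?thesis .
    qed
    have LL: "K1 \<le> L" "K2 \<le> L" "K3 \<le> L" using K1(1) K2(1) K3(1) by (auto simp: L_def)
    show "sqrt (g y a a) \<le> K' * ?n \<and> sqrt (g y b b) \<le> K' * ?n \<and> sqrt (g y d d) \<le> K' * ?n"
      using key[OF _ pP(1) K1(1) LL(1), of a] key[OF _ pP(2) K2(1) LL(2), of b] key[OF _ pP(3) K3(1) LL(3), of d]
        K1(2)[rule_format, OF u] K2(2)[rule_format, OF u] K3(2)[rule_format, OF u] by (simp add: p1(2) p2(2) p3(2))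
  qed
  have "\<forall>y\<in>W1 \<inter> W2. components_bounded g K' c y"
    unfolding components_bounded_def using b1 b2 W1(3) by (intro ballI conjI allI) blast+
  moreover have "openin (mtop M) (W1 \<inter> W2)" using W1(1) W2(1) by (simp add: openin_Int)
  ultimately show ?thesis using W1(2) W2(2) c(1) K'(1) by blast
qed

lemma components_global_bound:
  assumes g: "riemannian_metric M g"
  shows "\<exists>K\<ge>0. \<forall>y\<in>topspace (mtop M). \<exists>c\<in>T. components_bounded g K c y"
proof -
  let ?G = "\<lambda>W K. \<forall>y\<in>W. \<exists>c\<in>T. components_bounded g K c y"
  let ?U = "{W. openin (mtop M) W \<and> (\<exists>K\<ge>0. ?G W K)}"
  have "\<exists>W\<in>?U. x \<in> W" if x: "x \<in> topspace (mtop M)" for x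
    using components_local_bound[OF g x] by blast
  then have cov: "topspace (mtop M) \<subseteq> \<Union>?U" by blast
  have op: "\<forall>U\<in>?U. openin (mtop M) U" by blast
  obtain F where F: "finite F" "F \<subseteq> ?U" "topspace (mtop M) \<subseteq> \<Union>F"
    using compact_M[unfolded compact_space_alt, THEN spec, THEN mp, OF conjI[OF op cov]]
    by (elim exE conjE) (rule that)
  have "\<forall>W\<in>F. \<exists>K\<ge>0. ?G W K" using F(2) by blast
  then obtain K where K: "\<forall>W\<in>F. K W \<ge> 0 \<and> ?G W (K W)" by (rule bchoice[THEN exE])
  \<comment> \<open>The sum of the nonnegative constants of a finite subcover dominates each of
    them.\<close>
  have "\<exists>c\<in>T. components_bounded g (sum K F) c y" if y: "y \<in> topspace (mtop M)" for y
  proof -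
    obtain W where W: "W \<in> F" "y \<in> W" using F(3) y by blast
    obtain c where "c \<in> T" "components_bounded g (K W) c y" using K W by blast
    moreover have "K W \<le> sum K F" by (rule member_le_sum[OF W(1) _ F(1)]) (use K in auto)
    ultimately show ?thesis using components_bounded_mono[OF g y] by blast
  qed
  moreover have "sum K F \<ge> 0" using K by (simp add: sum_nonneg)
  ultimately show ?thesis by blast
qed

text \<open>If \<open>v\<close> lies in one of the three bundles, the components of \<open>I v\<close> are bounded by \<open>v\<close> along the whole
  orbit; comparing growth rates, the components in the two other bundles vanish.\<close>

theorem splitting_invariant:
  assumes E: "E \<in> {Es, Ec, Eu}" and c: "c \<in> T" "x \<in> fst c" and v: "v \<in> E x"
  shows "\<exists>w\<in>E x. dz M c x w = \<i> *s dz M c x v"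
proof -
  have x: "x \<in> topspace (mtop M)" using T_topspace c by blast
  obtain g \<alpha> \<alpha>' \<beta>' \<beta> C where g: "riemannian_metric M g"
    and ab: "0 < \<alpha>" "\<alpha> < \<alpha>'" "\<alpha>' < 1" "1 < \<beta>'" "\<beta>' < \<beta>" "0 < C"
    and hyp: "\<forall>t\<ge>0. \<forall>x\<in>topspace (mtop M).
          (\<forall>v\<in>Es x. sqrt (g (\<phi> t x) (tmap M (\<phi> t) x v) (tmap M (\<phi> t) x v)) \<le> C * \<alpha> powr t * sqrt (g x v v)) \<and>
          (\<forall>v\<in>Eu x. inverse C * \<beta> powr t * sqrt (g x v v) \<le> sqrt (g (\<phi> t x) (tmap M (\<phi> t) x v) (tmap M (\<phi> t) x v))) \<and>
          (\<forall>v\<in>Ec x. inverse C * \<alpha>' powr t * sqrt (g x v v) \<le> sqrt (g (\<phi> t x) (tmap M (\<phi> t) x v) (tmap M (\<phi> t) x v)) \<and>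
                     sqrt (g (\<phi> t x) (tmap M (\<phi> t) x v) (tmap M (\<phi> t) x v)) \<le> C * \<beta>' powr t * sqrt (g x v v))"
    using part_hyp unfolding partially_hyperbolic_def Let_def by (elim conjE exE) (rule that)
  \<comment> \<open>The norm of \<open>w\<close> transported for time \<open>t\<close>, negative
    times included. The rates below compare the times \<open>s\<close> and \<open>t + s\<close> for
    arbitrary \<open>s\<close>; taking \<open>s = - t\<close> gives the estimates in the
    past.\<close>
  define n where "n t w = sqrt (g (\<phi> t x) (tmap M (\<phi> t) x w) (tmap M (\<phi> t) x w))" for t w
  have nst: "n (t + s) w = sqrt (g (\<phi> t (\<phi> s x)) (tmap M (\<phi> t) (\<phi> s x) (tmap M (\<phi> s) x w)) (tmap M (\<phi> t) (\<phi> s x) (tmap M (\<phi> s) x w)))" for s t w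
    unfolding n_def using x by (simp add: flow_add tmap_add)
  have rs: "n (t + s) w \<le> C * \<alpha> powr t * n s w"
    if w: "w \<in> Es x" and t: "t \<ge> 0" for s t w
  proof -
    have m: "tmap M (\<phi> s) x w \<in> Es (\<phi> s x)" by (rule bundle_invariant[of Es]) (use x w in simp_all)
    note h = hyp[THEN spec, THEN mp, OF t, THEN bspec, OF flow_topspace[OF x, of s], THEN conjunct1, THEN bspec, OF m]
    from h show "n (t + s) w \<le> C * \<alpha> powr t * n s w" unfolding nst unfolding n_def by simp_all
  qed
  have ru: "inverse C * \<beta> powr t * n s w \<le> n (t + s) w"
    if w: "w \<in> Eu x" and t: "t \<ge> 0" for s t w
  proof -
    have m: "tmap M (\<phi> s) x w \<in> Eu (\<phi> s x)" by (rule bundle_invariant[of Eu]) (use x w in simp_all)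
    note h = hyp[THEN spec, THEN mp, OF t, THEN bspec, OF flow_topspace[OF x, of s], THEN conjunct2, THEN conjunct1, THEN bspec, OF m]
    from h show "inverse C * \<beta> powr t * n s w \<le> n (t + s) w" unfolding nst unfolding n_def by simp_all
  qed
  have rc: "inverse C * \<alpha>' powr t * n s w \<le> n (t + s) w" "n (t + s) w \<le> C * \<beta>' powr t * n s w"
    if w: "w \<in> Ec x" and t: "t \<ge> 0" for s t w
  proof -
    have m: "tmap M (\<phi> s) x w \<in> Ec (\<phi> s x)" by (rule bundle_invariant[of Ec]) (use x w in simp_all)
    note h = hyp[THEN spec, THEN mp, OF t, THEN bspec, OF flow_topspace[OF x, of s], THEN conjunct2, THEN conjunct2, THEN bspec, OF m]
    from h show "inverse C * \<alpha>' powr t * n s w \<le> n (t + s) w" "n (t + s) w \<le> C * \<beta>' powr t * n s w" unfolding nst unfolding n_def by simp_all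
  qed
  obtain K where K: "K \<ge> 0" "\<forall>y\<in>topspace (mtop M). \<exists>c\<in>T. components_bounded g K c y"
    using components_global_bound[OF g] by blast
  \<comment> \<open>These are the components of \<open>I v\<close>; it has to be shown that only the
    one in the bundle of \<open>v\<close> survives.\<close>
  obtain a b d where abd: "a \<in> Es x" "b \<in> Ec x" "d \<in> Eu x" "dz M c x (a + b + d) = \<i> *s dz M c x v"
    using H_rotation_ex[OF c] by metis
  \<comment> \<open>The tangent map commutes with \<open>I\<close>, and multiplication by
    \<open>\<i>\<close> preserves the norm. One factor \<open>K\<close> bounds the components at
    \<open>\<phi> t x\<close> by the transverse norm, the other the transverse norm by the metric;
    neither depends on \<open>t\<close>.\<close>
  have bound: "n t a \<le> K * (K * n t v) \<and> n t b \<le> K * (K * n t v) \<and> n t d \<le> K * (K * n t v)" for t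
  proof -
    let ?f = "tmap M (\<phi> t) x"
    obtain c' where c': "c' \<in> T" "\<phi> t x \<in> fst c'"
      and 1: "\<forall>a\<in>Es (\<phi> t x). \<forall>b\<in>Ec (\<phi> t x). \<forall>d\<in>Eu (\<phi> t x). sqrt (g (\<phi> t x) a a) \<le> K * norm (dz M c' (\<phi> t x) (a + b + d)) \<and>
        sqrt (g (\<phi> t x) b b) \<le> K * norm (dz M c' (\<phi> t x) (a + b + d)) \<and> sqrt (g (\<phi> t x) d d) \<le> K * norm (dz M c' (\<phi> t x) (a + b + d))"
      and 2: "\<forall>v. norm (dz M c' (\<phi> t x) v) \<le> K * sqrt (g (\<phi> t x) v v)"
      using K(2)[THEN bspec, OF flow_topspace[OF x, of t]] unfolding components_bounded_def
      by (elim bexE conjE) (rule that)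
    have "?f (a + b + d) = ?f a + ?f b + ?f d" using linear_add[OF linear_tmap[OF x]] by simp
    then have "dz M c' (\<phi> t x) (?f a + ?f b + ?f d) = \<i> *s dz M c' (\<phi> t x) (?f v)"
      using dz_flow_ii[OF c(1) c'(1) c(2) c'(2) abd(4)] by simp
    moreover have "norm (\<i> *s z) = norm z" for z :: "complex^'q"
      by (simp add: norm_vec_def L2_set_def norm_mult)
    ultimately have "norm (dz M c' (\<phi> t x) (?f a + ?f b + ?f d)) \<le> K * n t v"
      using 2 by (simp add: n_def)
    then have le: "K * norm (dz M c' (\<phi> t x) (?f a + ?f b + ?f d)) \<le> K * (K * n t v)"
      using K(1) by (rule mult_left_mono)
    have fE: "?f a \<in> Es (\<phi> t x)" "?f b \<in> Ec (\<phi> t x)" "?f d \<in> Eu (\<phi> t x)"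
      using bundle_invariant[of Es, OF _ x] bundle_invariant[of Ec, OF _ x] bundle_invariant[of Eu, OF _ x] abd(1-3)
      by simp_all
    have "n t a \<le> K * norm (dz M c' (\<phi> t x) (?f a + ?f b + ?f d)) \<and>
        n t b \<le> K * norm (dz M c' (\<phi> t x) (?f a + ?f b + ?f d)) \<and>
        n t d \<le> K * norm (dz M c' (\<phi> t x) (?f a + ?f b + ?f d))"
      using 1[rule_format, OF fE] unfolding n_def .
    with le show ?thesis by linarith
  qed
  have n0: "w = 0" if "n 0 w \<le> 0" for w
  proof (rule ccontr)
    assume "w \<noteq> 0"
    then have "0 < g x w w" using g x unfolding riemannian_metric_def by blast
    then show False using that x by (simp add: n_def flow_0 tmap_0)
  qed
  \<comment> \<open>In the future \<open>w\<close> has at least rate \<open>p\<close> and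
    \<open>v\<close> at most the smaller rate \<open>q\<close>. Since \<open>w\<close> is dominated
    by \<open>v\<close>, this forces \<open>n 0 w\<close> below a multiple of
    \<open>(q / p) powr t\<close>.\<close>
  have fwd: "n 0 w \<le> 0" if lo: "\<And>t. t \<ge> 0 \<Longrightarrow> inverse C * p powr t * n 0 w \<le> n t w" and
      up: "\<And>t. t \<ge> 0 \<Longrightarrow> n t v \<le> C * q powr t * n 0 v" and w: "\<And>t. n t w \<le> K * (K * n t v)" and pq: "0 < q" "q < p"
      for w p q
  proof (rule le_powr_decay[of _ "C * K * K * C * n 0 v" "q / p"])
    fix t :: real assume t: "0 \<le> t"
    have "inverse C * p powr t * n 0 w \<le> K * (K * (C * q powr t * n 0 v))"
      using lo[OF t] w[of t] mult_left_mono[OF mult_left_mono[OF up[OF t] K(1)] K(1)] by linarith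
    then have "(C / p powr t) * (inverse C * p powr t * n 0 w) \<le> (C / p powr t) * (K * (K * (C * q powr t * n 0 v)))"
      using ab(6) pq by (intro mult_left_mono) auto
    then show "n 0 w \<le> C * K * K * C * n 0 v * (q / p) powr t"
      using ab(6) pq by (simp add: powr_divide field_simps)
  qed (use pq in auto)
  \<comment> \<open>In the past: at time \<open>- t\<close> the norm of \<open>w\<close> is at least
    of order \<open>p powr (- t)\<close> and that of \<open>v\<close> at most of order
    \<open>q powr (- t)\<close>, which is smaller as \<open>p < q\<close>.\<close>
  have bwd: "n 0 w \<le> 0" if up: "\<And>t. t \<ge> 0 \<Longrightarrow> n 0 w \<le> C * p powr t * n (- t) w" and
      lo: "\<And>t. t \<ge> 0 \<Longrightarrow> inverse C * q powr t * n (- t) v \<le> n 0 v" and w: "\<And>t. n t w \<le> K * (K * n t v)" and pq: "0 < p" "p < q"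
      for w p q
  proof (rule le_powr_decay[of _ "C * K * K * C * n 0 v" "p / q"])
    fix t :: real assume t: "0 \<le> t"
    have "n (- t) v \<le> C / q powr t * n 0 v"
      using lo[OF t] ab(6) pq by (simp add: field_simps)
    from mult_left_mono[OF mult_left_mono[OF this K(1)] K(1)] have "n (- t) w \<le> K * (K * (C / q powr t * n 0 v))"
      using w[of "- t"] by linarith
    then have "C * p powr t * n (- t) w \<le> C * p powr t * (K * (K * (C / q powr t * n 0 v)))"
      using ab(6) by (intro mult_left_mono) auto
    with up[OF t] have "n 0 w \<le> C * p powr t * (K * (K * (C / q powr t * n 0 v)))" by linarith
    then show "n 0 w \<le> C * K * K * C * n 0 v * (p / q) powr t"
      using pq by (simp add: powr_divide field_simps)
  qed (use pq in auto)
  have s0: "n t w \<le> C * \<alpha> powr t * n 0 w" "n 0 w \<le> C * \<alpha> powr t * n (- t) w"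
    if "w \<in> Es x" "t \<ge> 0" for t w
    using rs[OF that, of 0] rs[OF that, of "- t"] by simp_all
  have u0: "inverse C * \<beta> powr t * n 0 w \<le> n t w" "inverse C * \<beta> powr t * n (- t) w \<le> n 0 w"
    if "w \<in> Eu x" "t \<ge> 0" for t w
    using ru[OF that, of 0] ru[OF that, of "- t"] by simp_all
  have c0: "inverse C * \<alpha>' powr t * n 0 w \<le> n t w" "inverse C * \<alpha>' powr t * n (- t) w \<le> n 0 w"
     "n t w \<le> C * \<beta>' powr t * n 0 w" "n 0 w \<le> C * \<beta>' powr t * n (- t) w"
    if "w \<in> Ec x" "t \<ge> 0" for t w
    using rc[OF that, of 0] rc[OF that, of "- t"] by simp_all
  have ba: "n t a \<le> K * (K * n t v)" and bb: "n t b \<le> K * (K * n t v)" and bd: "n t d \<le> K * (K * n t v)" for t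
    using bound[of t] by auto
  have pos: "0 < \<alpha>'" "0 < \<beta>'" "0 < \<beta>" "\<alpha> < \<beta>" using ab by linarith+
  \<comment> \<open>Against a stable vector both other components are excluded by the future,
    against an unstable one by the past. For a center vector the future excludes the unstable
    component and the past the stable one.\<close>
  consider "v \<in> Es x" "E = Es" | "v \<in> Ec x" "E = Ec" | "v \<in> Eu x" "E = Eu" using E v by auto
  then have "a + b + d \<in> E x"
  proof cases
    case 1
    have "b = 0" by (rule n0, rule fwd[OF c0(1)[OF abd(2)] s0(1)[OF 1(1)] bb ab(1,2)])
    moreover have "d = 0" by (rule n0, rule fwd[OF u0(1)[OF abd(3)] s0(1)[OF 1(1)] bd ab(1) pos(4)])
    ultimately show ?thesis using 1(2) abd(1) by simp
  next
    case 2
    have "d = 0" by (rule n0, rule fwd[OF u0(1)[OF abd(3)] c0(3)[OF 2(1)] bd pos(2) ab(5)])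
    moreover have "a = 0" by (rule n0, rule bwd[OF s0(2)[OF abd(1)] c0(2)[OF 2(1)] ba ab(1,2)])
    ultimately show ?thesis using 2(2) abd(2) by simp
  next
    case 3
    have "a = 0" by (rule n0, rule bwd[OF s0(2)[OF abd(1)] u0(2)[OF 3(1)] ba ab(1) pos(4)])
    moreover have "b = 0" by (rule n0, rule bwd[OF c0(4)[OF abd(2)] u0(2)[OF 3(1)] bb pos(2) ab(5)])
    ultimately show ?thesis using 3(2) abd(3) by simp
  qed
  then show ?thesis using abd(4) by blast
qed

text \<open>Uniqueness is injectivity of \<open>dz\<close> on \<open>H x\<close>; the condition for
  all charts follows from the one for \<open>c\<close> by complex linearity of chart
  changes.\<close>

lemma induced_I_eqI:
  assumes c: "c \<in> T" "x \<in> fst c" and w: "w \<in> H x" and eq: "dz M c x w = \<i> *s dz M c x v"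
  shows "induced_I M T H x v = w"
  unfolding induced_I_def
proof (rule the_equality)
  show "w \<in> H x \<and> (\<forall>c\<in>T. x \<in> fst c \<longrightarrow> dz M c x w = \<i> *s dz M c x v)"
    using w dz_change_ii[OF c(1) _ c(2) _ eq] by blast
  show "w' = w" if "w' \<in> H x \<and> (\<forall>c\<in>T. x \<in> fst c \<longrightarrow> dz M c x w' = \<i> *s dz M c x v)" for w'
    using H_eqI[OF c] that w eq c by metis
qed

end

section \<open>Second countability of connected spaces\<close>

text \<open>Each member contains a point of a countable dense set, and disjointness makes the choice
  of such points injective.\<close>

lemma countable_disjoint_openin:
  assumes X: "second_countable X" and op: "\<And>D. D \<in> \<D> \<Longrightarrow> openin X D \<and> D \<noteq> {}"
    and dis: "\<And>D D'. D \<in> \<D> \<Longrightarrow> D' \<in> \<D> \<Longrightarrow> D \<inter> D' \<noteq> {} \<Longrightarrow> D = D'"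
  shows "countable \<D>"
proof -
  obtain C where C: "countable C" "X closure_of C = topspace X"
    using second_countable_imp_separable_space[OF X] unfolding separable_space_def by blast
  have "\<exists>x. x \<in> C \<inter> D" if "D \<in> \<D>" for D
    using C(2) op[OF that] unfolding dense_intersects_open by blast
  then obtain p where p: "\<And>D. D \<in> \<D> \<Longrightarrow> p D \<in> C \<inter> D" by metis
  have "inj_on p \<D>"
  proof (rule inj_onI)
    fix D D' assume *: "D \<in> \<D>" "D' \<in> \<D>" "p D = p D'"
    then have "p D \<in> D \<inter> D'" using p[OF *(1)] p[OF *(2)] by auto
    then show "D = D'" using dis[OF *(1,2)] by blast
  qed
  moreover have "countable (p ` \<D>)" by (rule countable_subset[OF _ C(1)]) (use p in auto)
  ultimately show ?thesis using countable_image_inj_on by blast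
qed

text \<open>Chains of successively intersecting members, started at one of them, reach only
  countably many. Their union and the union of the remaining members are disjoint open sets, so
  connectedness leaves nothing over.\<close>

lemma countable_connected_cover:
  assumes conn: "connected_space Y" and cov: "topspace Y = \<Union>\<P>"
    and op: "\<And>P. P \<in> \<P> \<Longrightarrow> openin Y P \<and> P \<noteq> {}"
    and cnt: "\<And>P. P \<in> \<P> \<Longrightarrow> countable {Q \<in> \<P>. P \<inter> Q \<noteq> {}}"
  shows "countable \<P>"
proof (cases "\<P> = {}")
  case False
  then obtain P0 where P0: "P0 \<in> \<P>" by blast
  define R where "R = {(P, Q). P \<in> \<P> \<and> Q \<in> \<P> \<and> P \<inter> Q \<noteq> {}}"
  define \<Q> where "\<Q> = R\<^sup>* `` {P0}"
  have step: "Q \<in> \<Q>" if "P \<in> \<Q>" "(P, Q) \<in> R" for P Q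
    using that unfolding \<Q>_def by (auto intro: rtrancl_into_rtrancl)
  have sub: "\<Q> \<subseteq> \<P>"
  proof
    fix Q assume "Q \<in> \<Q>"
    then have "(P0, Q) \<in> R\<^sup>*" by (simp add: \<Q>_def)
    then show "Q \<in> \<P>" by (induction rule: rtrancl_induct) (use P0 in \<open>auto simp: R_def\<close>)
  qed
  have "countable ((R ^^ n) `` {P0}) \<and> (R ^^ n) `` {P0} \<subseteq> \<P>" for n
  proof (induction n)
    case (Suc n)
    have eq: "(R ^^ Suc n) `` {P0} = (\<Union>P\<in>(R ^^ n) `` {P0}. {Q \<in> \<P>. P \<inter> Q \<noteq> {}})"
      using Suc by (auto simp: R_def relcomp_unfold)
    have "countable (\<Union>P\<in>(R ^^ n) `` {P0}. {Q \<in> \<P>. P \<inter> Q \<noteq> {}})"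
      by (rule countable_UN) (use Suc cnt in blast)+
    then show ?case unfolding eq by blast
  qed (use P0 in simp)
  then have "countable (\<Union>n. (R ^^ n) `` {P0})" by blast
  moreover have "\<Q> = (\<Union>n. (R ^^ n) `` {P0})"
    unfolding \<Q>_def by (auto simp: rtrancl_is_UN_relpow)
  ultimately have cQ: "countable \<Q>" by simp
  have "\<P> - \<Q> = {}"
  proof (rule ccontr)
    assume ne: "\<P> - \<Q> \<noteq> {}"
    have "openin Y (\<Union>\<Q>)" "openin Y (\<Union>(\<P> - \<Q>))" using op sub by blast+
    moreover have "topspace Y \<subseteq> \<Union>\<Q> \<union> \<Union>(\<P> - \<Q>)" using cov by blast
    moreover have "\<Union>\<Q> \<inter> \<Union>(\<P> - \<Q>) = {}"
    proof (rule ccontr)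
      assume "\<Union>\<Q> \<inter> \<Union>(\<P> - \<Q>) \<noteq> {}"
      then obtain P Q where PQ: "P \<in> \<Q>" "Q \<in> \<P> - \<Q>" "P \<inter> Q \<noteq> {}" by blast
      then have "(P, Q) \<in> R" using sub by (auto simp: R_def)
      from step[OF PQ(1) this] show False using PQ(2) by blast
    qed
    moreover have "P0 \<in> \<Q>" by (simp add: \<Q>_def)
    then have "\<Union>\<Q> \<noteq> {}" using op[OF P0] by blast
    moreover have "\<Union>(\<P> - \<Q>) \<noteq> {}" using ne op by blast
    ultimately show False using conn unfolding connected_space_def by blast
  qed
  then have "\<P> \<subseteq> \<Q>" by blast
  then show ?thesis using cQ by (rule countable_subset)
qed simp

lemma second_countable_countable_cover:
  assumes cnt: "countable \<P>" and op: "\<And>P. P \<in> \<P> \<Longrightarrow> openin X P" and cov: "topspace X = \<Union>\<P>"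
    and sc: "\<And>P. P \<in> \<P> \<Longrightarrow> second_countable (subtopology X P)"
  shows "second_countable X"
proof -
  have "\<forall>P\<in>\<P>. \<exists>\<B>. countable \<B> \<and> (\<forall>V\<in>\<B>. openin (subtopology X P) V) \<and>
      (\<forall>U x. openin (subtopology X P) U \<and> x \<in> U \<longrightarrow> (\<exists>V\<in>\<B>. x \<in> V \<and> V \<subseteq> U))"
    by (intro ballI) (rule sc[unfolded second_countable_def])
  then obtain \<B> where \<B>: "\<forall>P\<in>\<P>. countable (\<B> P) \<and> (\<forall>V\<in>\<B> P. openin (subtopology X P) V) \<and>
      (\<forall>U x. openin (subtopology X P) U \<and> x \<in> U \<longrightarrow> (\<exists>V\<in>\<B> P. x \<in> V \<and> V \<subseteq> U))"
    by (rule bchoice[THEN exE])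
  show ?thesis
    unfolding second_countable_def
  proof (intro exI[of _ "\<Union>P\<in>\<P>. \<B> P"] conjI ballI allI impI)
    show "countable (\<Union>P\<in>\<P>. \<B> P)" by (rule countable_UN[OF cnt]) (use \<B> in blast)
    show "openin X V" if V: "V \<in> (\<Union>P\<in>\<P>. \<B> P)" for V
    proof -
      obtain P where P: "P \<in> \<P>" "V \<in> \<B> P" using V by blast
      have "openin (subtopology X P) V" using \<B>[THEN bspec, OF P(1)] P(2) by blast
      then show ?thesis by (rule openin_trans_full[OF _ op[OF P(1)]])
    qed
    fix U x assume Ux: "openin X U \<and> x \<in> U"
    then obtain P where P: "P \<in> \<P>" "x \<in> P" using cov openin_subset by blast
    have "openin (subtopology X P) (P \<inter> U)" using Ux openin_subtopology_Int2 by blast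
    moreover have "x \<in> P \<inter> U" using P(2) Ux by blast
    ultimately obtain V where "V \<in> \<B> P" "x \<in> V" "V \<subseteq> P \<inter> U"
      using \<B>[THEN bspec, OF P(1)] by blast
    then show "\<exists>V\<in>\<Union>P\<in>\<P>. \<B> P. x \<in> V \<and> V \<subseteq> U" using P(1) by blast
  qed
qed

text \<open>Turns membership in \<open>S\<close> into the vanishing of the linear map
  \<open>v - \<pi> v\<close>, which can be composed and differentiated.\<close>

lemma subspace_projection:
  fixes S :: "'e::euclidean_space set"
  assumes "subspace S"
  obtains \<pi> where "linear \<pi>" "range \<pi> \<subseteq> S" "\<And>v. v \<in> S \<Longrightarrow> \<pi> v = v" "\<And>v. v - \<pi> v = 0 \<longleftrightarrow> v \<in> S"
proof -
  obtain \<pi> where \<pi>: "range \<pi> \<subseteq> S" "linear \<pi>" "\<forall>v\<in>S. \<pi> (id v) = v"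
    using linear_exists_left_inverse_on[OF linear_id assms] by auto
  have id: "\<pi> v = v" if "v \<in> S" for v using \<pi>(3) that by simp
  have "\<pi> v \<in> S" for v using \<pi>(1) by blast
  then have "v - \<pi> v = 0 \<longleftrightarrow> v \<in> S" for v
    using id[of v] by (metis eq_iff_diff_eq_0)
  then show thesis by (intro that[OF \<pi>(2,1) id])
qed

section \<open>The leaf topology\<close>

locale foliated = smooth_mfd M for M :: "('a, 'e::euclidean_space) manifold" +
  fixes F :: "('a, 'e) foliation"
  assumes fol: "foliated_atlas M F"
begin

lemma fm_subspace: "subspace (fmodel F)"
  using fol by (simp add: foliated_atlas_def)

lemma fatlas_is_chart: "c \<in> fatlas F \<Longrightarrow> is_chart (mtop M) UNIV c"
  using fol by (simp add: foliated_atlas_def)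

lemma fatlas_convex: "c \<in> fatlas F \<Longrightarrow> convex (snd c ` fst c)"
  using fol by (simp add: foliated_atlas_def)

lemma fatlas_Union: "(\<Union>c\<in>fatlas F. fst c) = topspace (mtop M)"
  using fol by (simp add: foliated_atlas_def)

lemma fatlas_cover: "x \<in> topspace (mtop M) \<Longrightarrow> \<exists>c\<in>fatlas F. x \<in> fst c"
  using fatlas_Union by blast

lemma fatlas_openin: "c \<in> fatlas F \<Longrightarrow> openin (mtop M) (fst c)"
  using chart_openin[OF fatlas_is_chart] .

lemma fatlas_topspace: "c \<in> fatlas F \<Longrightarrow> x \<in> fst c \<Longrightarrow> x \<in> topspace (mtop M)"
  using chart_subset[OF fatlas_is_chart] by blast

lemma plaque_subset: "plaque F c x \<subseteq> fst c"
  by (auto simp: plaque_def)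

lemma plaque_self: "x \<in> fst c \<Longrightarrow> x \<in> plaque F c x"
  using subspace_0[OF fm_subspace] by (simp add: plaque_def)

lemma plaque_iff: "y \<in> plaque F c x \<longleftrightarrow> y \<in> fst c \<and> snd c y - snd c x \<in> fmodel F"
  by (simp add: plaque_def)

lemma plaque_eq:
  assumes "y \<in> plaque F c x" shows "plaque F c y = plaque F c x"
proof -
  have d: "snd c y - snd c x \<in> fmodel F" using assms by (simp add: plaque_iff)
  have "snd c z - snd c y \<in> fmodel F \<longleftrightarrow> snd c z - snd c x \<in> fmodel F" for z
    using subspace_add[OF fm_subspace, of "snd c z - snd c y" "snd c y - snd c x"]
      subspace_diff[OF fm_subspace, of "snd c z - snd c x" "snd c y - snd c x"] d by auto
  then show ?thesis by (simp add: plaque_def)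
qed

lemma plaque_compat:
  assumes c: "c \<in> fatlas F" "d \<in> fatlas F" and x: "x \<in> fst c" "x \<in> fst d"
  shows "\<exists>W. openin (mtop M) W \<and> x \<in> W \<and> plaque F c x \<inter> W \<subseteq> plaque F d x"
proof -
  have "\<forall>c\<in>fatlas F. \<forall>d\<in>fatlas F. \<forall>x \<in> fst c \<inter> fst d.
        \<exists>W. openin (mtop M) W \<and> x \<in> W \<and> W \<subseteq> fst c \<inter> fst d \<and>
          (\<forall>y\<in>W. \<forall>y'\<in>W. snd c y - snd c y' \<in> fmodel F \<longrightarrow> snd d y - snd d y' \<in> fmodel F)"
    using fol unfolding foliated_atlas_def by (elim conjE)
  from this[THEN bspec, OF c(1), THEN bspec, OF c(2), THEN bspec, OF IntI[OF x]]
  obtain W where W: "openin (mtop M) W" "x \<in> W" "W \<subseteq> fst c \<inter> fst d"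
     "\<forall>y\<in>W. \<forall>y'\<in>W. snd c y - snd c y' \<in> fmodel F \<longrightarrow> snd d y - snd d y' \<in> fmodel F"
    by (elim exE conjE) (rule that)
  have "plaque F c x \<inter> W \<subseteq> plaque F d x" using W(2-4) by (auto simp: plaque_iff)
  then show ?thesis using W(1,2) by blast
qed

lemma leaf_refl: "x \<in> leaf F x"
  by (simp add: leaf_def)

lemma leaf_step: "y \<in> leaf F x \<Longrightarrow> c \<in> fatlas F \<Longrightarrow> y \<in> fst c \<Longrightarrow> plaque F c y \<subseteq> leaf F x"
  unfolding leaf_def by (auto intro: rtrancl_into_rtrancl)

lemma leaf_topspace: "x \<in> topspace (mtop M) \<Longrightarrow> leaf F x \<subseteq> topspace (mtop M)"
proof
  fix y assume x: "x \<in> topspace (mtop M)" and "y \<in> leaf F x"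
  then have "(x, y) \<in> {(a, b). \<exists>c\<in>fatlas F. a \<in> fst c \<and> b \<in> plaque F c a}\<^sup>*" by (simp add: leaf_def)
  then show "y \<in> topspace (mtop M)"
    by (induction rule: rtrancl_induct) (use x plaque_subset fatlas_topspace in blast)+
qed

end

locale a_leaf = foliated M F for M :: "('a, 'e::euclidean_space) manifold" and F +
  fixes x :: 'a
  assumes x: "x \<in> topspace (mtop M)"
begin

abbreviation "L \<equiv> leaf F x"
abbreviation "Y \<equiv> leaf_topology M F (leaf F x)"

lemma L_topspace: "y \<in> L \<Longrightarrow> y \<in> topspace (mtop M)"
  using leaf_topspace[OF x] by blast

text \<open>The sets satisfying the right-hand side form a topology that contains the generators, by
  \<open>plaque_compat\<close>; conversely such a set is a union of generators. For an open set the
  neighbourhood can thus be taken in a plaque of any foliated chart at hand.\<close>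

lemma openin_leaf_iff:
  "openin Y U \<longleftrightarrow> U \<subseteq> L \<and>
     (\<forall>y\<in>U. \<forall>c\<in>fatlas F. y \<in> fst c \<longrightarrow> (\<exists>W. openin (mtop M) W \<and> y \<in> W \<and> plaque F c y \<inter> W \<subseteq> U))"
  (is "_ \<longleftrightarrow> ?P U")
proof
  assume "openin Y U"
  then have gen: "generate_topology_on {plaque F c y \<inter> W | c y W.
        c \<in> fatlas F \<and> y \<in> fst c \<inter> L \<and> openin (mtop M) W} U"
    unfolding leaf_topology_def by (rule openin_topology_generated_by)
  have top: "istopology ?P"
    unfolding istopology_def
  proof (intro conjI allI impI)
    fix S T assume S: "?P S" and T: "?P T"
    show "S \<inter> T \<subseteq> L" using S by blast
    show "\<forall>y\<in>S \<inter> T. \<forall>c\<in>fatlas F. y \<in> fst c \<longrightarrow> (\<exists>W. openin (mtop M) W \<and> y \<in> W \<and> plaque F c y \<inter> W \<subseteq> S \<inter> T)"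
    proof (intro ballI impI)
      fix y c assume y: "y \<in> S \<inter> T" "c \<in> fatlas F" "y \<in> fst c"
      obtain W1 where W1: "openin (mtop M) W1" "y \<in> W1" "plaque F c y \<inter> W1 \<subseteq> S" using S y by blast
      obtain W2 where W2: "openin (mtop M) W2" "y \<in> W2" "plaque F c y \<inter> W2 \<subseteq> T" using T y by blast
      show "\<exists>W. openin (mtop M) W \<and> y \<in> W \<and> plaque F c y \<inter> W \<subseteq> S \<inter> T"
        using W1 W2 by (intro exI[of _ "W1 \<inter> W2"]) (auto simp: openin_Int)
    qed
  next
    fix K assume K: "\<forall>S\<in>K. ?P S"
    show "\<Union>K \<subseteq> L" using K by blast
    show "\<forall>y\<in>\<Union>K. \<forall>c\<in>fatlas F. y \<in> fst c \<longrightarrow> (\<exists>W. openin (mtop M) W \<and> y \<in> W \<and> plaque F c y \<inter> W \<subseteq> \<Union>K)"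
    proof (intro ballI impI)
      fix y c assume "y \<in> \<Union>K" and y: "c \<in> fatlas F" "y \<in> fst c"
      then obtain S where S: "S \<in> K" "y \<in> S" by blast
      have "\<exists>W. openin (mtop M) W \<and> y \<in> W \<and> plaque F c y \<inter> W \<subseteq> S"
        using K[THEN bspec, OF S(1), THEN conjunct2] S(2) y by blast
      then show "\<exists>W. openin (mtop M) W \<and> y \<in> W \<and> plaque F c y \<inter> W \<subseteq> \<Union>K"
        using S(1) by (elim exE conjE) (intro exI conjI, assumption+, blast)
    qed
  qed
  show "?P U"
  proof (rule generate_topology_on_coarsest[OF top _ gen])
    fix S assume "S \<in> {plaque F c y \<inter> W | c y W. c \<in> fatlas F \<and> y \<in> fst c \<inter> L \<and> openin (mtop M) W}"
    then obtain c y W where S: "S = plaque F c y \<inter> W" and c: "c \<in> fatlas F" "y \<in> fst c" "y \<in> L" "openin (mtop M) W"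
      by blast
    show "?P S"
    proof (intro conjI ballI impI)
      show "S \<subseteq> L" using leaf_step[OF c(3,1,2)] S by blast
      fix z d assume z: "z \<in> S" "d \<in> fatlas F" "z \<in> fst d"
      then have zc: "z \<in> fst c" "z \<in> plaque F c y" "z \<in> W" using S plaque_subset by blast+
      obtain W' where W': "openin (mtop M) W'" "z \<in> W'" "plaque F d z \<inter> W' \<subseteq> plaque F c z"
        using plaque_compat[OF z(2) c(1) z(3) zc(1)] by blast
      show "\<exists>W. openin (mtop M) W \<and> z \<in> W \<and> plaque F d z \<inter> W \<subseteq> S"
        using W' zc c(4) plaque_eq[OF zc(2)] S by (intro exI[of _ "W' \<inter> W"]) (auto simp: openin_Int)
    qed
  qed
next
  assume P: "?P U"
  show "openin Y U"
    unfolding openin_subopen[of Y U]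
  proof
    fix y assume y: "y \<in> U"
    then have yL: "y \<in> L" using P by blast
    obtain c where c: "c \<in> fatlas F" "y \<in> fst c" using fatlas_cover[OF L_topspace[OF yL]] by blast
    obtain W where W: "openin (mtop M) W" "y \<in> W" "plaque F c y \<inter> W \<subseteq> U" using P y c by blast
    have "openin Y (plaque F c y \<inter> W)"
      unfolding leaf_topology_def by (rule topology_generated_by_Basis) (use c W(1) yL in blast)
    then show "\<exists>T. openin Y T \<and> y \<in> T \<and> T \<subseteq> U" using W plaque_self[OF c(2)] by blast
  qed
qed

lemma openin_leaf_plaque: "c \<in> fatlas F \<Longrightarrow> y \<in> fst c \<Longrightarrow> y \<in> L \<Longrightarrow> openin (mtop M) W \<Longrightarrow> openin Y (plaque F c y \<inter> W)"
  unfolding leaf_topology_def by (rule topology_generated_by_Basis) blast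

lemma openin_plaque: "c \<in> fatlas F \<Longrightarrow> y \<in> fst c \<Longrightarrow> y \<in> L \<Longrightarrow> openin Y (plaque F c y)"
  using openin_leaf_plaque[OF _ _ _ fatlas_openin, of c y c] plaque_subset[of c y] by (simp add: inf_absorb1)

lemma openin_leaf_Int: "openin (mtop M) W \<Longrightarrow> openin Y (W \<inter> L)"
  unfolding openin_leaf_iff using leaf_step by blast

lemma topspace_leaf: "topspace Y = L"
proof
  show "topspace Y \<subseteq> L" using openin_leaf_iff[of "topspace Y"] openin_topspace by blast
  have "openin Y (topspace (mtop M) \<inter> L)" by (rule openin_leaf_Int) simp
  then show "L \<subseteq> topspace Y" using openin_subset leaf_topspace[OF x] by blast
qed

lemma leaf_id_continuous: "continuous_map Y (mtop M) id"
  unfolding continuous_map_def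
proof (intro conjI allI impI)
  show "id \<in> topspace Y \<rightarrow> topspace (mtop M)" using topspace_leaf L_topspace by auto
  fix U assume "openin (mtop M) U"
  from openin_leaf_Int[OF this] show "openin Y {y \<in> topspace Y. id y \<in> U}"
    by (simp add: topspace_leaf Int_def conj_commute)
qed

lemma Hausdorff_leaf: "Hausdorff_space Y"
  by (rule Hausdorff_space_injective_preimage[OF _ leaf_id_continuous])
     (use smooth_M in \<open>auto simp: smooth_manifold_def\<close>)

text \<open>A leaf may return to a chart infinitely often, so its topology can differ from that of
  \<open>M\<close>; within one plaque the two agree. Connectedness and second countability of
  plaques are therefore checked in \<open>M\<close> and transported.\<close>

lemma subtopology_plaque:
  assumes c: "c \<in> fatlas F" "y \<in> fst c" "y \<in> L" and U: "U \<subseteq> plaque F c y"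
  shows "subtopology Y U = subtopology (mtop M) U"
  unfolding topology_eq
proof (intro allI iffI)
  fix S assume "openin (subtopology Y U) S"
  then obtain T where T: "openin Y T" "S = T \<inter> U" by (auto simp: openin_subtopology)
  \<comment> \<open>The union of all open sets of \<open>M\<close> whose trace on the plaque lies in
    \<open>T\<close>; around each point of \<open>T\<close> in the plaque such a set exists by
    \<open>openin_leaf_iff\<close>.\<close>
  define W where "W = \<Union>{W. openin (mtop M) W \<and> plaque F c y \<inter> W \<subseteq> T}"
  have "openin (mtop M) W" unfolding W_def by blast
  moreover have "S = W \<inter> U"
  proof
    show "W \<inter> U \<subseteq> S" unfolding W_def T(2) using U by blast
    show "S \<subseteq> W \<inter> U"
    proof
      fix z assume z: "z \<in> S"
      then have zp: "z \<in> plaque F c y" "z \<in> T" "z \<in> U" using T(2) U by auto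
      then have "z \<in> fst c" using plaque_subset by blast
      then obtain W' where "openin (mtop M) W'" "z \<in> W'" "plaque F c z \<inter> W' \<subseteq> T"
        using T(1) c(1) zp(2) unfolding openin_leaf_iff by blast
      then show "z \<in> W \<inter> U" unfolding W_def using plaque_eq[OF zp(1)] zp(3) by blast
    qed
  qed
  ultimately show "openin (subtopology (mtop M) U) S" by (auto simp: openin_subtopology)
next
  fix S assume "openin (subtopology (mtop M) U) S"
  then obtain W where W: "openin (mtop M) W" "S = W \<inter> U" by (auto simp: openin_subtopology)
  have "U \<subseteq> L" using U leaf_step[OF c(3,1,2)] by blast
  then have "S = (W \<inter> L) \<inter> U" using W(2) by blast
  then show "openin (subtopology Y U) S" using openin_leaf_Int[OF W(1)] openin_subtopology by blast
qed

text \<open>A slice of a convex set is convex. Besides whole plaques, where \<open>B\<close> is the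
  chart image, this is used for small balls.\<close>

lemma connectedin_slice:
  assumes c: "c \<in> fatlas F" and B: "convex B" "B \<subseteq> snd c ` fst c"
  shows "connectedin (mtop M) (cinv c ` (B \<inter> {u. u - v \<in> fmodel F}))"
proof (rule connectedin_continuous_map_image[OF continuous_map_cinv[OF fatlas_is_chart[OF c]]])
  have "convex {u. u - v \<in> fmodel F}"
  proof (rule convexI)
    fix a b :: 'e and s t :: real
    assume *: "a \<in> {u. u - v \<in> fmodel F}" "b \<in> {u. u - v \<in> fmodel F}" "s + t = 1"
    have "s *\<^sub>R (a - v) + t *\<^sub>R (b - v) \<in> fmodel F"
      using * by (auto intro!: subspace_add[OF fm_subspace] subspace_scale[OF fm_subspace])
    moreover have "s *\<^sub>R (a - v) + t *\<^sub>R (b - v) = s *\<^sub>R a + t *\<^sub>R b - (s + t) *\<^sub>R v"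
      by (simp add: algebra_simps)
    ultimately show "s *\<^sub>R a + t *\<^sub>R b \<in> {u. u - v \<in> fmodel F}" using *(3) by simp
  qed
  then have "connected (B \<inter> {u. u - v \<in> fmodel F})"
    by (intro convex_connected convex_Int B(1))
  then show "connectedin (top_of_set (snd c ` fst c)) (B \<inter> {u. u - v \<in> fmodel F})"
    using B(2) by (auto simp: connectedin_subtopology)
qed

lemma plaque_slice:
  assumes c: "c \<in> fatlas F" and B: "B \<subseteq> snd c ` fst c"
  shows "cinv c ` (B \<inter> {u. u - snd c y \<in> fmodel F}) = plaque F c y \<inter> {z \<in> fst c. snd c z \<in> B}"
proof -
  note ch = fatlas_is_chart[OF c]
  show ?thesis
  proof (intro set_eqI iffI)
    fix z assume "z \<in> cinv c ` (B \<inter> {u. u - snd c y \<in> fmodel F})"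
    then obtain u where u: "u \<in> B" "u - snd c y \<in> fmodel F" "z = cinv c u" by blast
    then show "z \<in> plaque F c y \<inter> {z \<in> fst c. snd c z \<in> B}"
      using cinv_in[OF ch, of u] chart_cinv[OF ch, of u] B by (auto simp: plaque_iff)
  next
    fix z assume z: "z \<in> plaque F c y \<inter> {z \<in> fst c. snd c z \<in> B}"
    then have "z = cinv c (snd c z)" using cinv_chart[OF ch] by auto
    then show "z \<in> cinv c ` (B \<inter> {u. u - snd c y \<in> fmodel F})" using z by (auto simp: plaque_iff)
  qed
qed

lemma connectedin_plaque:
  assumes c: "c \<in> fatlas F" "y \<in> fst c" "y \<in> L"
  shows "connectedin Y (plaque F c y)"
proof -
  have "plaque F c y \<inter> {z \<in> fst c. snd c z \<in> snd c ` fst c} = plaque F c y"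
    using plaque_subset by blast
  then have "connectedin (mtop M) (plaque F c y)"
    using connectedin_slice[OF c(1) fatlas_convex[OF c(1)] order_refl, of "snd c y"]
      plaque_slice[OF c(1) order_refl, of y] by simp
  then have "connectedin (subtopology (mtop M) (plaque F c y)) (plaque F c y)"
    by (simp add: connectedin_subtopology)
  then have "connectedin (subtopology Y (plaque F c y)) (plaque F c y)"
    using subtopology_plaque[OF c order_refl] by simp
  then show ?thesis by (simp add: connectedin_subtopology)
qed

text \<open>Each plaque of a chain that starts at \<open>x\<close> is connected and contains the
  point where the chain enters it.\<close>

lemma connected_leaf: "connected_space Y"
proof -
  have ex: "\<exists>C. connectedin Y C \<and> x \<in> C \<and> y \<in> C" if "y \<in> L" for y
  proof -
    from that have "(x, y) \<in> {(a, b). \<exists>c\<in>fatlas F. a \<in> fst c \<and> b \<in> plaque F c a}\<^sup>*" by (simp add: leaf_def)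
    then show ?thesis
    proof (induction rule: rtrancl_induct)
      case base
      then show ?case using leaf_refl topspace_leaf by (intro exI[of _ "{x}"]) simp
    next
      case (step y z)
      then obtain C c where C: "connectedin Y C" "x \<in> C" "y \<in> C" and c: "c \<in> fatlas F" "y \<in> fst c" "z \<in> plaque F c y"
        by blast
      have yL: "y \<in> L" using connectedin_subset_topspace[OF C(1)] C(3) topspace_leaf by blast
      have "connectedin Y (C \<union> plaque F c y)"
        by (rule connectedin_Un[OF C(1) connectedin_plaque[OF c(1,2) yL]]) (use C(3) plaque_self[OF c(2)] in blast)
      then show ?case using C(2) c(3) by blast
    qed
  qed
  have "connectedin Y (\<Union>{C. connectedin Y C \<and> x \<in> C})"
    by (rule connectedin_Union) auto
  moreover have "\<Union>{C. connectedin Y C \<and> x \<in> C} = topspace Y"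
    using ex connectedin_subset_topspace topspace_leaf by blast
  ultimately show ?thesis by (simp add: connectedin_topspace)
qed

lemma second_countable_plaque:
  assumes c: "c \<in> fatlas F" "y \<in> fst c" "y \<in> L"
  shows "second_countable (subtopology Y (plaque F c y))"
  unfolding subtopology_plaque[OF c order_refl]
  by (rule second_countable_subtopology) (use smooth_M in \<open>simp add: smooth_manifold_def\<close>)

text \<open>An argument of Poincare-Volterra type. Countably many foliated charts cover
  \<open>M\<close>, and their plaques cover the leaf. A plaque is second countable, so it meets only
  countably many plaques of each of these charts; by connectedness the leaf consists of countably
  many plaques.\<close>

lemma second_countable_leaf: "second_countable Y"
proof -
  have "Lindelof_space (mtop M)"
    by (rule second_countable_imp_Lindelof_space) (use smooth_M in \<open>simp add: smooth_manifold_def\<close>)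
  moreover have "(\<forall>U\<in>fst ` fatlas F. openin (mtop M) U) \<and> \<Union>(fst ` fatlas F) = topspace (mtop M)"
    using fatlas_openin fatlas_Union by auto
  ultimately obtain \<V> where \<V>: "countable \<V>" "\<V> \<subseteq> fst ` fatlas F" "\<Union>\<V> = topspace (mtop M)"
    unfolding Lindelof_space_def by (metis (no_types, lifting))
  obtain \<C> where \<C>: "countable \<C>" "\<C> \<subseteq> fatlas F" "\<V> = fst ` \<C>"
    using countable_subset_image[THEN iffD1, OF conjI[OF \<V>(1,2)]] by blast
  define \<P> where "\<P> = {plaque F c y | c y. c \<in> \<C> \<and> y \<in> fst c \<and> y \<in> L}"
  have \<P>E: "\<exists>c y. P = plaque F c y \<and> c \<in> fatlas F \<and> y \<in> fst c \<and> y \<in> L" if "P \<in> \<P>" for P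
    using that \<C>(2) unfolding \<P>_def by blast
  have op: "openin Y P \<and> P \<noteq> {}" if "P \<in> \<P>" for P
    using \<P>E[OF that] openin_plaque plaque_self by blast
  have cov: "topspace Y = \<Union>\<P>"
  proof
    show "\<Union>\<P> \<subseteq> topspace Y" using op openin_subset by blast
    show "topspace Y \<subseteq> \<Union>\<P>"
    proof
      fix y assume "y \<in> topspace Y"
      then have yL: "y \<in> L" using topspace_leaf by simp
      then obtain c where c: "c \<in> \<C>" "y \<in> fst c" using \<V>(3) \<C>(3) L_topspace by blast
      then show "y \<in> \<Union>\<P>" unfolding \<P>_def using plaque_self[OF c(2)] yL by blast
    qed
  qed
  have sc: "second_countable (subtopology Y P)" if "P \<in> \<P>" for P
    using \<P>E[OF that] second_countable_plaque by blast
  have "countable {Q \<in> \<P>. P \<inter> Q \<noteq> {}}" if P: "P \<in> \<P>" for P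
  proof -
    let ?D = "\<lambda>d. {plaque F d z | z. z \<in> P \<and> z \<in> fst d}"
    have PL: "P \<subseteq> L" using op[OF P] openin_subset topspace_leaf by blast
    \<comment> \<open>Distinct plaques of \<open>d\<close> are disjoint, and those meeting
      \<open>P\<close> cut it in nonempty open sets, of which a disjoint family is
      countable.\<close>
    have cD: "countable (?D d)" if d: "d \<in> \<C>" for d
    proof -
      let ?f = "\<lambda>Q. P \<inter> Q"
      have dF: "d \<in> fatlas F" using d \<C>(2) by blast
      have eq: "Q = Q'" if Q: "Q \<in> ?D d" "Q' \<in> ?D d" "w \<in> Q \<inter> Q'" for Q Q' w
      proof -
        obtain z z' where "Q = plaque F d z" "Q' = plaque F d z'" using Q by blast
        then show ?thesis using plaque_eq[of w d z] plaque_eq[of w d z'] Q(3) by auto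
      qed
      have ne: "?f Q \<noteq> {}" if "Q \<in> ?D d" for Q using that plaque_self by blast
      have "countable (?f ` ?D d)"
      proof (rule countable_disjoint_openin[OF sc[OF P]])
        fix S assume "S \<in> ?f ` ?D d"
        then obtain z where z: "S = P \<inter> plaque F d z" "z \<in> P" "z \<in> fst d" by blast
        have "openin Y (plaque F d z)" by (rule openin_plaque[OF dF z(3)]) (use z(2) PL in blast)
        then have "openin (subtopology Y P) S" unfolding z(1) by (rule openin_subtopology_Int2)
        then show "openin (subtopology Y P) S \<and> S \<noteq> {}" using z plaque_self[OF z(3)] by blast
      next
        fix S S' assume "S \<in> ?f ` ?D d" "S' \<in> ?f ` ?D d" and i: "S \<inter> S' \<noteq> {}"
        then obtain Q Q' where Q: "Q \<in> ?D d" "Q' \<in> ?D d" "S = P \<inter> Q" "S' = P \<inter> Q'" by blast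
        obtain w where "w \<in> Q \<inter> Q'" using i Q(3,4) by blast
        from eq[OF Q(1,2) this] show "S = S'" using Q(3,4) by simp
      qed
      moreover have "inj_on ?f (?D d)"
      proof (rule inj_onI)
        fix Q Q' assume Q: "Q \<in> ?D d" "Q' \<in> ?D d" "P \<inter> Q = P \<inter> Q'"
        obtain w where "w \<in> P \<inter> Q" using ne[OF Q(1)] by blast
        then have "w \<in> Q \<inter> Q'" using Q(3) by blast
        then show "Q = Q'" by (rule eq[OF Q(1,2)])
      qed
      ultimately show ?thesis using countable_image_inj_on by blast
    qed
    have "{Q \<in> \<P>. P \<inter> Q \<noteq> {}} \<subseteq> (\<Union>d\<in>\<C>. ?D d)"
    proof
      fix Q assume "Q \<in> {Q \<in> \<P>. P \<inter> Q \<noteq> {}}"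
      then obtain d y z where dy: "Q = plaque F d y" "d \<in> \<C>" "z \<in> P" "z \<in> plaque F d y"
        unfolding \<P>_def by blast
      then have "Q = plaque F d z" "z \<in> fst d" using plaque_eq[OF dy(4)] plaque_subset by blast+
      then show "Q \<in> (\<Union>d\<in>\<C>. ?D d)" using dy(2,3) by blast
    qed
    moreover have "countable (\<Union>d\<in>\<C>. ?D d)" using \<C>(1) cD by (rule countable_UN)
    ultimately show ?thesis by (rule countable_subset)
  qed
  from countable_connected_cover[OF connected_leaf cov op this]
  have "countable \<P>" by blast
  then show ?thesis using second_countable_countable_cover op cov sc by metis
qed

lemma countable_leaf_plaques:
  assumes c: "c \<in> fatlas F"
  shows "countable {plaque F c z | z. z \<in> L \<and> z \<in> fst c}"
proof (rule countable_disjoint_openin[OF second_countable_leaf])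
  fix D assume "D \<in> {plaque F c z | z. z \<in> L \<and> z \<in> fst c}"
  then obtain z where "D = plaque F c z" "z \<in> L" "z \<in> fst c" by blast
  then show "openin Y D \<and> D \<noteq> {}" using openin_plaque[OF c] plaque_self by blast
next
  fix D D' assume "D \<in> {plaque F c z | z. z \<in> L \<and> z \<in> fst c}" "D' \<in> {plaque F c z | z. z \<in> L \<and> z \<in> fst c}"
    and i: "D \<inter> D' \<noteq> {}"
  then obtain z z' where "D = plaque F c z" "D' = plaque F c z'" by blast
  then show "D = D'" using i plaque_eq by blast
qed

end

context foliated
begin

text \<open>A leaf meets a foliated chart in countably many plaques, and a connected set with countably many
  transverse coordinates lies in a single plaque.\<close>

lemma leaf_continuous_map:
  assumes x: "x \<in> topspace (mtop M)" and x': "x' \<in> topspace (mtop M)"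
    and f: "continuous_map (mtop M) (mtop M) f" and fL: "f ` leaf F x \<subseteq> leaf F x'"
  shows "continuous_map (leaf_topology M F (leaf F x)) (leaf_topology M F (leaf F x')) f"
proof -
  interpret A: a_leaf M F x by unfold_locales (rule x)
  interpret B: a_leaf M F x' by unfold_locales (rule x')
  obtain \<pi> :: "'e \<Rightarrow> 'e" where \<pi>: "linear \<pi>" "\<And>v. v - \<pi> v = 0 \<longleftrightarrow> v \<in> fmodel F"
    using subspace_projection[OF fm_subspace] by metis
  \<comment> \<open>\<open>p\<close> has kernel \<open>fmodel F\<close>, so
    \<open>p (snd d z)\<close> is a transverse coordinate that labels the plaques of
    \<open>d\<close>.\<close>
  define p where "p v = v - \<pi> v" for v
  have lp: "linear p" unfolding p_def by (rule linear_compose_sub[OF linear_ident \<pi>(1)])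
  have p: "p v = p w \<longleftrightarrow> v - w \<in> fmodel F" for v w
    using \<pi>(2)[of "v - w", folded p_def] linear_diff[OF lp, of v w] by simp
  have "openin (leaf_topology M F (leaf F x)) {y \<in> topspace (leaf_topology M F (leaf F x)). f y \<in> U}"
    if U: "openin (leaf_topology M F (leaf F x')) U" for U
    unfolding A.openin_leaf_iff A.topspace_leaf
  proof (intro conjI ballI impI)
    show "{y \<in> leaf F x. f y \<in> U} \<subseteq> leaf F x" by blast
    fix y c assume "y \<in> {y \<in> leaf F x. f y \<in> U}" and c: "c \<in> fatlas F" "y \<in> fst c"
    then have y: "y \<in> leaf F x" "f y \<in> U" by auto
    have fy: "f y \<in> leaf F x'" using fL y by blast
    obtain d where d: "d \<in> fatlas F" "f y \<in> fst d" using fatlas_cover[OF B.L_topspace[OF fy]] by blast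
    obtain W' where W': "openin (mtop M) W'" "f y \<in> W'" "plaque F d (f y) \<inter> W' \<subseteq> U"
      using U y(2) d unfolding B.openin_leaf_iff by blast
    note chc = fatlas_is_chart[OF c(1)] and chd = fatlas_is_chart[OF d(1)]
    let ?S = "{z \<in> topspace (mtop M). f z \<in> W' \<inter> fst d} \<inter> fst c"
    have "openin (mtop M) {z \<in> topspace (mtop M). f z \<in> W' \<inter> fst d}"
      by (rule openin_continuous_map_preimage[OF f]) (use W'(1) fatlas_openin[OF d(1)] in \<open>simp add: openin_Int\<close>)
    then have S: "openin (mtop M) ?S" using fatlas_openin[OF c(1)] by (rule openin_Int)
    have yS: "y \<in> ?S" using A.L_topspace[OF y(1)] W'(2) d(2) c(2) by blast
    have oS: "open (snd c ` ?S)" by (rule open_chart_image[OF chc S]) blast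
    obtain \<rho> where \<rho>: "\<rho> > 0" "ball (snd c y) \<rho> \<subseteq> snd c ` ?S"
      by (rule openE[OF oS imageI[OF yS]])
    let ?B = "ball (snd c y) \<rho>"
    \<comment> \<open>\<open>?V\<close> is the part of the plaque of \<open>y\<close> inside a ball:
      it is connected since the ball is convex, and \<open>f\<close> maps it into
      \<open>W' \<inter> fst d\<close>.\<close>
    let ?W = "{z \<in> fst c. snd c z \<in> ?B}" and ?V = "cinv c ` (?B \<inter> {u. u - snd c y \<in> fmodel F})"
    have Bc: "?B \<subseteq> snd c ` fst c" using \<rho>(2) by blast
    have V: "?V = plaque F c y \<inter> ?W" by (rule A.plaque_slice[OF c(1) Bc])
    have VS: "z \<in> ?S" if "z \<in> ?V" for z
    proof -
      obtain u where "u \<in> ?B" "z = cinv c u" using \<open>z \<in> ?V\<close> by blast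
      then show ?thesis using \<rho>(2) cinv_chart[OF chc] by auto
    qed
    have yV: "y \<in> ?V" unfolding V using plaque_self[OF c(2)] c(2) \<rho>(1) by simp
    let ?q = "\<lambda>z. p (snd d (f z))"
    have "connectedin (mtop M) ?V" by (rule A.connectedin_slice[OF c(1) convex_ball Bc])
    then have cV: "connectedin (subtopology (mtop M) ?S) ?V" using VS by (auto simp: connectedin_subtopology)
    have "continuous_map (subtopology (mtop M) ?S) (subtopology (mtop M) (fst d)) f"
      using continuous_map_from_subtopology[OF f] by (auto simp: continuous_map_in_subtopology)
    from continuous_map_compose[OF this continuous_map_chart[OF chd]]
    have "continuous_map (subtopology (mtop M) ?S) euclidean (\<lambda>z. snd d (f z))" by (simp add: o_def)
    moreover have "continuous_map euclidean euclidean p"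
      using lp by (simp add: linear_continuous_on linear_conv_bounded_linear)
    ultimately have "continuous_map (subtopology (mtop M) ?S) euclidean ?q"
      using continuous_map_compose[of _ euclidean "\<lambda>z. snd d (f z)" euclidean p] by (simp add: o_def)
    from connectedin_continuous_map_image[OF this cV] have conn: "connected (?q ` ?V)" by simp
    let ?\<P> = "{plaque F d z | z. z \<in> leaf F x' \<and> z \<in> fst d}"
    \<comment> \<open>\<open>p (snd d w)\<close> is the same for all points \<open>w\<close> of a
      plaque, so the values of \<open>?q\<close> are indexed by the countably many plaques in which
      the leaf of \<open>x'\<close> meets \<open>d\<close>.\<close>
    have "?q z \<in> (\<lambda>P. p (snd d (SOME w. w \<in> P))) ` ?\<P>" if z: "z \<in> ?V" for z
    proof -
      have "z \<in> leaf F x" using z V leaf_step[OF y(1) c] by blast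
      then have fz: "f z \<in> leaf F x'" "f z \<in> fst d" using fL VS[OF z] by auto
      have "(SOME w. w \<in> plaque F d (f z)) \<in> plaque F d (f z)"
        by (rule someI[of _ "f z"]) (rule plaque_self[OF fz(2)])
      then have "p (snd d (SOME w. w \<in> plaque F d (f z))) = ?q z" unfolding p by (simp add: plaque_iff)
      then show ?thesis using fz by (intro image_eqI[of _ _ "plaque F d (f z)"]) auto
    qed
    then have "?q ` ?V \<subseteq> (\<lambda>P. p (snd d (SOME w. w \<in> P))) ` ?\<P>" by blast
    then have cnt: "countable (?q ` ?V)"
      by (rule countable_subset[OF _ countable_image[OF B.countable_leaf_plaques[OF d(1)]]])
    \<comment> \<open>A connected set with two different points is uncountable.\<close>
    have const: "?q z = ?q y" if z: "z \<in> ?V" for z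
      using connected_uncountable[OF conn imageI[OF z] imageI[OF yV]] cnt by blast
    have "?V \<subseteq> {y \<in> leaf F x. f y \<in> U}"
    proof
      fix z assume z: "z \<in> ?V"
      have "f z \<in> plaque F d (f y)" using const[OF z] VS[OF z] unfolding p by (simp add: plaque_iff)
      then have "f z \<in> U" using W'(3) VS[OF z] by blast
      moreover have "z \<in> leaf F x" using z V leaf_step[OF y(1) c] by blast
      ultimately show "z \<in> {y \<in> leaf F x. f y \<in> U}" by blast
    qed
    then have "plaque F c y \<inter> ?W \<subseteq> {y \<in> leaf F x. f y \<in> U}" unfolding V .
    moreover have "openin (mtop M) ?W" by (rule openin_chart_preimage[OF chc open_ball])
    moreover have "y \<in> ?W" using c(2) \<rho>(1) by simp
    ultimately show "\<exists>W. openin (mtop M) W \<and> y \<in> W \<and> plaque F c y \<inter> W \<subseteq> {y \<in> leaf F x. f y \<in> U}" by blast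
  qed
  moreover have "f \<in> topspace (leaf_topology M F (leaf F x)) \<rightarrow> topspace (leaf_topology M F (leaf F x'))"
    unfolding A.topspace_leaf B.topspace_leaf using fL by blast
  ultimately show ?thesis unfolding continuous_map_def by blast
qed

end

section \<open>Complex linear algebra\<close>

lemma clinear_imp_linear:
  fixes D :: "complex^'n::finite \<Rightarrow> complex^'m::finite"
  assumes "\<And>v w. D (v + w) = D v + D w" "clinear D"
  shows "linear D"
proof (rule linearI)
  fix r :: real and v
  show "D (r *\<^sub>R v) = r *\<^sub>R D v"
    using clinearD[OF assms(2), of "complex_of_real r" v] by (simp only: vector_scaleC_of_real)
qed (rule assms(1))

lemma vec_subspaceI:
  fixes V :: "(complex^'n::finite) set"
  assumes V: "subspace V" and i: "\<And>v. v \<in> V \<Longrightarrow> \<i> *s v \<in> V"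
  shows "vec.subspace V"
proof (rule vec.subspaceI)
  show "0 \<in> V" using subspace_0[OF V] .
  show "v + w \<in> V" if "v \<in> V" "w \<in> V" for v w using subspace_add[OF V that] .
  fix a :: complex and v assume v: "v \<in> V"
  have "a *s v = (complex_of_real (Re a) + \<i> * complex_of_real (Im a)) *s v"
    by (simp add: complex_eq[symmetric])
  also have "\<dots> = complex_of_real (Re a) *s v + complex_of_real (Im a) *s (\<i> *s v)"
    by (simp add: vec.scale_left_distrib vec.scale_scale mult.commute)
  finally have "a *s v = Re a *\<^sub>R v + Im a *\<^sub>R (\<i> *s v)" by (simp only: vector_scaleC_of_real)
  then show "a *s v \<in> V"
    using subspace_add[OF V subspace_scale[OF V v] subspace_scale[OF V i[OF v]]] by metis
qed

lemma cspace_vec_subspace: "vec.subspace (cspace (J :: 'n::finite set))"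
  by (rule vec.subspaceI) (auto simp: cspace_def)

lemma cspace_subspace: "subspace (cspace (J :: 'n::finite set))"
  by (auto simp: subspace_def cspace_def)

lemma cspace_ii: "v \<in> cspace J \<Longrightarrow> a *s v \<in> cspace J"
  by (auto simp: cspace_def)

lemma vec_dim_cspace: "vec.dim (cspace (J :: 'n::finite set)) = card J"
  unfolding cspace_def by (rule dim_substandard_cart)

lemma cproj_in [simp]: "cproj J z \<in> cspace J"
  by (simp add: cproj_def cspace_def)

lemma cproj_id: "z \<in> cspace J \<Longrightarrow> cproj J z = z"
  by (auto simp: cproj_def cspace_def vec_eq_iff)

lemma clinear_cproj: "clinear (cproj J)"
  by (auto simp: clinear_def cproj_def vec_eq_iff)

lemma linear_cproj: "linear (cproj (J :: 'n::finite set))"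
  by (rule clinear_imp_linear[OF _ clinear_cproj]) (auto simp: cproj_def vec_eq_iff)

lemma continuous_on_cproj: "continuous_on S (cproj (J :: 'n::finite set))"
  by (rule linear_continuous_on) (simp add: linear_cproj linear_conv_bounded_linear[symmetric])

lemma open_cproj_vimage:
  assumes "openin (top_of_set (cspace (J :: 'n::finite set))) S"
  shows "open (cproj J -` S)"
proof -
  obtain T where T: "open T" "S = cspace J \<inter> T" using assms by (auto simp: openin_open)
  have "cproj J -` S = cproj J -` T" unfolding T(2) by auto
  then show ?thesis
    using continuous_open_vimage[OF T(1), of "cproj J"] continuous_on_cproj[of UNIV J]
    by (simp add: continuous_on_eq_continuous_at)
qed

text \<open>Complex subspaces of equal dimension are isomorphic through a linear map defined on the
  whole space. Composing it with \<open>cproj J\<close> leaves it unchanged on \<open>V\<close> and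
  forces its values off \<open>V\<close> into \<open>cspace J\<close> too.\<close>

lemma straighten_complex_subspace:
  fixes V :: "(complex^'n::finite) set"
  assumes "vec.subspace V" "vec.dim V = card (J :: 'n set)"
  obtains A where "linear A" "clinear A" "range A \<subseteq> cspace J" "inj_on A V" "A ` V = cspace J"
proof -
  have "vec.dim V = vec.dim (cspace J)" using assms(2) vec_dim_cspace by metis
  from vec.subspace_isomorphism[OF assms(1) cspace_vec_subspace this]
  obtain f where f: "Vector_Spaces.linear (*s) (*s) f" "f ` V = cspace J" "inj_on f V"
    by (elim exE conjE) (rule that)
  interpret f: Vector_Spaces.linear "(*s)" "(*s)" f by (rule f(1))
  let ?A = "\<lambda>v. cproj J (f v)"
  have eq: "?A v = f v" if "v \<in> V" for v using f(2) that cproj_id by blast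
  have cl: "clinear ?A" by (simp add: clinear_def f.scale clinearD[OF clinear_cproj])
  show thesis
  proof (rule that[of ?A])
    show "linear ?A" by (rule clinear_imp_linear[OF _ cl]) (simp add: f.add linear_add[OF linear_cproj])
    show "inj_on ?A V" using f(3) eq by (metis (no_types, lifting) inj_on_cong)
    show "?A ` V = cspace J" using f(2) eq by (metis (no_types, lifting) image_cong)
  qed (use cl in auto)
qed

text \<open>Every complex subspace is isomorphic, also over the reals, to a coordinate subspace of
  the same complex dimension. Were the complex dimensions different, the coordinate subspaces could
  be chosen nested, with \<open>J\<close> properly inside \<open>J'\<close> but of equal real
  dimension, hence equal.\<close>

lemma real_dim_determines_complex_dim:
  fixes V W :: "(complex^'n::finite) set"
  assumes V: "vec.subspace V" and W: "vec.subspace W" and dim: "dim V = dim W"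
  shows "vec.dim V = vec.dim W"
proof -
  have le: "vec.dim W \<le> vec.dim V" if V: "vec.subspace V" and W: "vec.subspace W" and dim: "dim V = dim W"
    for V W :: "(complex^'n) set"
  proof (rule ccontr)
    assume "\<not> vec.dim W \<le> vec.dim V"
    then have lt: "vec.dim V < vec.dim W" by simp
    obtain J' :: "'n set" where J': "card J' = vec.dim W"
      using obtain_subset_with_card_n[OF dim_subset_UNIV_cart_gen[of W]] by metis
    obtain J where J: "J \<subseteq> J'" "card J = vec.dim V"
      using obtain_subset_with_card_n[of "vec.dim V" J'] lt J' by auto
    have real: "dim U = dim (cspace K)" if U: "vec.subspace U" "vec.dim U = card K" for U :: "(complex^'n) set" and K :: "'n set"
    proof -
      obtain A where A: "linear A" "clinear A" "range A \<subseteq> cspace K" "inj_on A U" "A ` U = cspace K"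
        by (rule straighten_complex_subspace[OF U])
      have "subspace U"
      proof (rule subspaceI)
        show "r *\<^sub>R v \<in> U" if "v \<in> U" for r v
          using vec.subspace_scale[OF U(1) that, of "complex_of_real r"] by (simp only: vector_scaleC_of_real)
      qed (use vec.subspace_0[OF U(1)] vec.subspace_add[OF U(1)] in auto)
      then have s: "span U = U" by (simp only: span_eq_iff)
      show ?thesis by (rule dim_image_eq[OF A(1), of U, unfolded s, OF A(4), unfolded A(5), symmetric])
    qed
    have "cspace J = cspace J'"
    proof (rule subspace_dim_equal[OF cspace_subspace cspace_subspace])
      show "cspace J \<subseteq> cspace J'" using J(1) by (auto simp: cspace_def)
      show "dim (cspace J') \<le> dim (cspace J)" using real[OF V J(2)[symmetric]] real[OF W J'[symmetric]] dim by simp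
    qed
    moreover have "\<not> J' \<subseteq> J" using J J' lt by (metis nat_neq_iff subset_antisym)
    then obtain j where j: "j \<in> J'" "j \<notin> J" by blast
    have "axis j 1 \<in> cspace J'" "axis j 1 \<notin> cspace J" using j by (auto simp: cspace_def axis_def)
    ultimately show False by blast
  qed
  show ?thesis using le[OF V W dim] le[OF W V dim[symmetric]] by simp
qed

text \<open>A left inverse \<open>\<Lambda>\<close> of \<open>\<Gamma>'\<close> on \<open>S\<close>
  expresses increments of \<open>h\<close> through those of \<open>k\<close>, up to the error of
  \<open>\<Gamma>\<close>, which continuity of \<open>h\<close> makes small relative to the
  increment of \<open>h\<close>. In the application \<open>\<Gamma>\<close> is the inclusion of a
  leaf read in a leaf chart, and \<open>h\<close> the flow between leaf charts.\<close>

lemma has_derivative_through_immersion: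
  fixes \<Gamma> :: "'a::euclidean_space \<Rightarrow> 'b::euclidean_space" and h :: "'c::euclidean_space \<Rightarrow> 'a"
  assumes \<Gamma>: "(\<Gamma> has_derivative \<Gamma>') (at (h z))" and S: "subspace S" "inj_on \<Gamma>' S"
    and Q: "open Q" "z \<in> Q" "h ` Q \<subseteq> S" "continuous_on Q h"
    and k: "(k has_derivative k') (at z)" and eq: "\<And>w. w \<in> Q \<Longrightarrow> \<Gamma> (h w) = k w"
  obtains D where "(h has_derivative D) (at z)" "\<And>v. D v \<in> S" "\<And>v. \<Gamma>' (D v) = k' v"
proof -
  have lin: "linear \<Gamma>'" "linear k'" using \<Gamma> k has_derivative_linear by blast+
  obtain \<Lambda> where \<Lambda>: "range \<Lambda> \<subseteq> S" "linear \<Lambda>" "\<forall>v\<in>S. \<Lambda> (\<Gamma>' v) = v"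
    using linear_exists_left_inverse_on[OF lin(1) S] by blast
  obtain B where B: "B > 0" "\<And>v. norm (\<Lambda> v) \<le> B * norm v"
    using linear_bounded_pos[OF \<Lambda>(2)] by blast
  obtain C where C: "C > 0" "\<And>v. norm (k' v) \<le> C * norm v"
    using linear_bounded_pos[OF lin(2)] by blast
  have \<Gamma>e: "\<exists>d>0. \<forall>y. norm (y - h z) < d \<longrightarrow> norm (\<Gamma> y - \<Gamma> (h z) - \<Gamma>' (y - h z)) \<le> e * norm (y - h z)" if "e > 0" for e
    using \<Gamma> that unfolding has_derivative_at_alt by blast
  have ke: "\<exists>d>0. \<forall>y. norm (y - z) < d \<longrightarrow> norm (k y - k z - k' (y - z)) \<le> e * norm (y - z)" if "e > 0" for e
    using k that unfolding has_derivative_at_alt by blast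
  have ch: "\<exists>d>0. \<forall>w. norm (w - z) < d \<longrightarrow> w \<in> Q \<and> norm (h w - h z) < e" if e: "e > 0" for e
  proof -
    obtain d1 where d1: "d1 > 0" "ball z d1 \<subseteq> Q" using Q(1,2) openE by blast
    have "isCont h z" using Q continuous_on_eq_continuous_at by blast
    then obtain d2 where d2: "d2 > 0" "\<forall>w. dist w z < d2 \<longrightarrow> dist (h w) (h z) < e"
      using e unfolding continuous_at_eps_delta by blast
    show ?thesis
      using d1 d2 by (intro exI[of _ "min d1 d2"]) (auto simp: dist_norm norm_minus_commute subset_iff)
  qed
  define D where "D v = \<Lambda> (k' v)" for v
  have linD: "linear D" unfolding D_def using linear_compose[OF lin(2) \<Lambda>(2)] by (simp add: o_def)
  have main: "\<exists>d>0. \<forall>w. norm (w - z) < d \<longrightarrow> norm (h w - h z - D (w - z)) \<le> e * norm (w - z)" if e: "e > 0" for e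
  proof -
    \<comment> \<open>\<open>B\<close> and \<open>C\<close> bound \<open>\<Lambda>\<close> and
      \<open>k'\<close>. With \<open>e2\<close> the error of \<open>k\<close> contributes at most
      half of \<open>e\<close>; keeping it also below factor 1 and \<open>e3\<close> below
      \<open>1 / (2 * B)\<close> allows half of the increment of \<open>h\<close> to be absorbed,
      whence the Lipschitz factor \<open>2 * B * (C + 1)\<close>. The other bound in
      \<open>e3\<close> then makes the error of \<open>\<Gamma>\<close> contribute at most the
      second half of \<open>e\<close>.\<close>
    define e2 where "e2 = e / (2 * B)"
    define e3 where "e3 = min (1 / (2 * B)) (e / (4 * B * B * (C + 1)))"
    have pos: "e2 > 0" "e3 > 0" using e B(1) C(1) by (auto simp: e2_def e3_def)
    obtain d1 where d1: "d1 > 0" "\<forall>y. norm (y - h z) < d1 \<longrightarrow> norm (\<Gamma> y - \<Gamma> (h z) - \<Gamma>' (y - h z)) \<le> e3 * norm (y - h z)"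
      using \<Gamma>e[OF pos(2)] by blast
    obtain d2 where d2: "d2 > 0" "\<forall>w. norm (w - z) < d2 \<longrightarrow> w \<in> Q \<and> norm (h w - h z) < d1"
      using ch[OF d1(1)] by blast
    obtain d3 where d3: "d3 > 0" "\<forall>y. norm (y - z) < d3 \<longrightarrow> norm (k y - k z - k' (y - z)) \<le> min 1 e2 * norm (y - z)"
      using ke[of "min 1 e2"] pos(1) by auto
    have "norm (h w - h z - D (w - z)) \<le> e * norm (w - z)" if w: "norm (w - z) < min d2 d3" for w
    proof -
      let ?n = "norm (w - z)" and ?m = "norm (h w - h z)"
      define r where "r = \<Gamma> (h w) - \<Gamma> (h z) - \<Gamma>' (h w - h z)"
      define q where "q = k w - k z - k' (w - z)"
      have wO: "w \<in> Q" using d2(2) w by simp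
      have r: "norm r \<le> e3 * ?m" using d1(2) d2(2) w unfolding r_def by simp
      have q: "norm q \<le> min 1 e2 * ?n" using d3(2) w unfolding q_def by simp
      have hS: "h w - h z \<in> S" using subspace_diff[OF S(1)] Q(2,3) wO by blast
      have "\<Gamma>' (h w - h z) = k' (w - z) + q - r"
        using eq[OF wO] eq[OF Q(2)] by (simp add: r_def q_def)
      then have "h w - h z = \<Lambda> (k' (w - z) + q - r)" using \<Lambda>(3) hS by metis
      then have dec: "h w - h z = D (w - z) + \<Lambda> q - \<Lambda> r"
        by (simp add: linear_add[OF \<Lambda>(2)] linear_diff[OF \<Lambda>(2)] D_def)
      have Dn: "norm (D (w - z)) \<le> B * (C * ?n)"
        unfolding D_def using B(2)[of "k' (w - z)"] mult_left_mono[OF C(2)[of "w - z"], of B] B(1) by linarith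
      have qn1: "norm (\<Lambda> q) \<le> B * ?n" and qn2: "norm (\<Lambda> q) \<le> e / 2 * ?n"
      proof -
        have e2: "B * (e2 * ?n) = e / 2 * ?n" using B(1) by (simp add: e2_def)
        have "min 1 e2 * ?n \<le> 1 * ?n" "min 1 e2 * ?n \<le> e2 * ?n" by (intro mult_right_mono; simp)+
        then have "norm q \<le> ?n" "norm q \<le> e2 * ?n" using q by linarith+
        then have "B * norm q \<le> B * ?n" "B * norm q \<le> B * (e2 * ?n)" using B(1) by (auto intro: mult_left_mono)
        then show "norm (\<Lambda> q) \<le> B * ?n" "norm (\<Lambda> q) \<le> e / 2 * ?n"
          using B(2)[of q] e2 by linarith+
      qed
      have rn: "norm (\<Lambda> r) \<le> B * (e3 * ?m)"
        using B(2)[of r] mult_left_mono[OF r, of B] B(1) by linarith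
      have "e3 * (B * ?m) \<le> 1 / (2 * B) * (B * ?m)"
        unfolding e3_def using B(1) by (intro mult_right_mono) auto
      then have rn1: "norm (\<Lambda> r) \<le> ?m / 2" using rn B(1) by (simp add: mult.commute mult.left_commute)
      have "?m \<le> norm (D (w - z)) + norm (\<Lambda> q) + norm (\<Lambda> r)"
        unfolding dec using norm_triangle_ineq4[of "D (w - z) + \<Lambda> q" "\<Lambda> r"] norm_triangle_ineq[of "D (w - z)" "\<Lambda> q"] by linarith
      then have "?m \<le> B * (C * ?n) + B * ?n + ?m / 2" using Dn qn1 rn1 by linarith
      then have m: "?m \<le> 2 * B * (C + 1) * ?n" by (simp add: algebra_simps)
      have "norm (\<Lambda> r) \<le> B * (e3 * (2 * B * (C + 1) * ?n))"
      proof -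
        have "B * (e3 * ?m) \<le> B * (e3 * (2 * B * (C + 1) * ?n))"
          using m pos(2) B(1) by (intro mult_left_mono) auto
        then show ?thesis using rn by linarith
      qed
      also have "\<dots> = e3 * (2 * B * B * (C + 1) * ?n)" by simp
      also have "\<dots> \<le> e / (4 * B * B * (C + 1)) * (2 * B * B * (C + 1) * ?n)"
        unfolding e3_def using B(1) C(1) by (intro mult_right_mono) auto
      also have "\<dots> = e / 2 * ?n"
      proof -
        have "e / (4 * B * B * c) * (2 * B * B * c * ?n) = e / 2 * ?n" if "c > 0" for c
          using B(1) that by (simp add: field_simps)
        then show ?thesis using C(1) by simp
      qed
      finally have rn2: "norm (\<Lambda> r) \<le> e / 2 * ?n" .
      have "h w - h z - D (w - z) = \<Lambda> q - \<Lambda> r" unfolding dec by simp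
      then have "norm (h w - h z - D (w - z)) \<le> norm (\<Lambda> q) + norm (\<Lambda> r)" using norm_triangle_ineq4 by metis
      then show ?thesis using qn2 rn2 by (simp add: field_simps)
    qed
    then show ?thesis using d2(1) d3(1) by (intro exI[of _ "min d2 d3"]) auto
  qed
  have hD: "(h has_derivative D) (at z)"
    unfolding has_derivative_at_alt using main linD by (simp add: linear_conv_bounded_linear)
  have DS: "D v \<in> S" for v unfolding D_def using \<Lambda>(1) by blast
  have "((\<lambda>w. \<Gamma> (h w)) has_derivative (\<lambda>v. \<Gamma>' (D v))) (at z)" using has_derivative_compose[OF hD \<Gamma>] .
  moreover have "((\<lambda>w. \<Gamma> (h w)) has_derivative k') (at z)"
    by (rule has_derivative_cong_open[THEN iffD2, OF Q(1,2) eq k])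
  ultimately have "\<Gamma>' (D v) = k' v" for v using has_derivative_unique by metis
  with hD DS show thesis by (rule that)
qed

lemma C_on_linear_compose:
  "open S \<Longrightarrow> linear L \<Longrightarrow> C_on r S f \<Longrightarrow> C_on r S (\<lambda>x. L (f x))"
  unfolding C_on_def by (simp add: Ck_on_linear_compose)

lemma holo_on_cong:
  assumes "open S" "\<And>z. z \<in> S \<Longrightarrow> f z = g z" "holo_on S f"
  shows "holo_on S g"
  unfolding holo_on_def
proof
  fix z assume z: "z \<in> S"
  then obtain D where D: "(f has_derivative D) (at z)" "\<forall>a v. D (a *s v) = a *s D v"
    using assms(3) unfolding holo_on_def by blast
  have "(g has_derivative D) (at z)" by (rule has_derivative_cong_open[THEN iffD1, OF assms(1) z assms(2) D(1)])
  then show "\<exists>D. (g has_derivative D) (at z) \<and> (\<forall>a v. D (a *s v) = a *s D v)" using D(2) by blast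
qed

section \<open>Leaves as complex manifolds\<close>

text \<open>One setting for five bundles: \<open>Es\<close>, \<open>Ec\<close>, \<open>Eu\<close>
  and the sums of \<open>Es\<close> and \<open>Eu\<close> with \<open>Ec\<close>. \<open>E_H\<close>
  and \<open>E_rot\<close> express, by means of \<open>dz\<close>, that the fibres of
  \<open>E\<close> are \<open>I\<close>-invariant subspaces of those of \<open>H\<close>. In the
  applications \<open>r\<close> is 1 or infinity.\<close>

locale holo_foliation = ph_flow M \<phi> X T Es Ec Eu + foliated M F
  for M :: "('a, 'e::euclidean_space) manifold" and \<phi> and X and T :: "('a, real \<times> (complex^'q)) chart set"
    and Es Ec Eu :: "'a \<Rightarrow> 'e set" and F :: "('a, 'e) foliation" +
  fixes E :: "'a \<Rightarrow> 'e set" and r :: enat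
  assumes r: "1 \<le> r" and tang: "tangent_foliation r M E F" and flow_inv: "flow_invariant M \<phi> F"
    and E_subspace: "y \<in> topspace (mtop M) \<Longrightarrow> subspace (E y)"
    and E_H: "y \<in> topspace (mtop M) \<Longrightarrow> E y \<subseteq> H y"
    and E_rot: "c \<in> T \<Longrightarrow> y \<in> fst c \<Longrightarrow> v \<in> E y \<Longrightarrow> \<exists>w\<in>E y. dz M c y w = \<i> *s dz M c y v"
begin

lemma dz_inj_on: "c \<in> T \<Longrightarrow> y \<in> fst c \<Longrightarrow> inj_on (dz M c y) (E y)"
  using H_eqI E_H[OF T_topspace] by (intro inj_onI) blast

lemma flat_chart:
  assumes c: "c \<in> fatlas F" and x: "x \<in> fst c"
  obtains k where "Cr_chart r M k" "x \<in> fst k" "fst k \<inter> plaque F c x = {y \<in> fst k. snd k y - snd k x \<in> fmodel F}"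
    "mderiv M (snd k) x ` E x = fmodel F"
proof -
  have "\<forall>c\<in>fatlas F. \<forall>x\<in>fst c. \<exists>k. Cr_chart r M k \<and> x \<in> fst k \<and>
        fst k \<inter> plaque F c x = {y \<in> fst k. snd k y - snd k x \<in> fmodel F} \<and>
        mderiv M (snd k) x ` E x = fmodel F"
    using tang unfolding tangent_foliation_def by (elim conjE)
  from this[THEN bspec, OF c, THEN bspec, OF x] show thesis by (elim exE conjE) (rule that)
qed

text \<open>The flat chart around \<open>x\<close> is tangent to \<open>E\<close> along the whole plaque: it is compared with the flat
  chart around another point of the plaque.\<close>

lemma flat_chart_tangent:
  assumes c: "c \<in> fatlas F" and x: "x \<in> fst c" and k: "Cr_chart r M k"
    and flat: "fst k \<inter> plaque F c x = {y \<in> fst k. snd k y - snd k x \<in> fmodel F}"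
    and y: "y \<in> fst k" "y \<in> plaque F c x"
  shows "cvec M k y ` fmodel F = E y"
proof -
  have yc: "y \<in> fst c" using y plaque_subset by blast
  have t: "y \<in> topspace (mtop M)" using fatlas_topspace[OF c yc] .
  obtain l where l: "Cr_chart r M l" "y \<in> fst l" "fst l \<inter> plaque F c y = {z \<in> fst l. snd l z - snd l y \<in> fmodel F}"
    "mderiv M (snd l) y ` E y = fmodel F"
    by (rule flat_chart[OF c yc])
  note chk = Cr_chart_is_chart[OF k] and chl = Cr_chart_is_chart[OF l(1)]
  let ?D = "\<lambda>p. mderiv M (snd l) y (cvec M k y p)"
  have linD: "linear ?D"
    using linear_compose[OF linear_cvec[OF k r y(1)] linear_mderiv_chart[OF l(1) r l(2)]] by (simp add: o_def)
  have inv1: "cvec M l y (mderiv M (snd l) y v) = v" for v by (rule cvec_mderiv[OF l(1) r l(2)])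
  have inv2: "mderiv M (snd k) y (cvec M k y p) = p" for p by (rule mderiv_cvec[OF k r y(1)])
  have injD: "inj ?D" by (rule injI) (metis inv1 inv2)
  obtain \<pi> :: "'e \<Rightarrow> 'e" where \<pi>: "linear \<pi>" "\<And>v. v - \<pi> v = 0 \<longleftrightarrow> v \<in> fmodel F"
    using subspace_projection[OF fm_subspace] by metis
  \<comment> \<open>The line \<open>?g\<close> in direction \<open>p\<close> gives, through
    \<open>k\<close>, a curve in the plaque of \<open>y\<close>. In the flat chart \<open>l\<close>
    the component of this curve transverse to \<open>fmodel F\<close> vanishes, hence so does that
    of its derivative.\<close>
  have sub: "?D p \<in> fmodel F" if p: "p \<in> fmodel F" for p
  proof -
    let ?g = "\<lambda>s::real. snd k y + s *\<^sub>R p"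
    have "has_pderiv M (cinv k) (cvec M k y) (?g 0)" using has_pderiv_cinv[OF k r y(1)] by simp
    moreover have dg: "(?g has_derivative (\<lambda>s. s *\<^sub>R p)) (at 0)" by (auto intro!: derivative_eq_intros)
    ultimately have "has_pderiv M (\<lambda>s. cinv k (?g s)) (\<lambda>s. cvec M k y (s *\<^sub>R p)) 0"
      by (rule has_pderiv_compose)
    from has_derivative_chain[OF this]
    have d: "((\<lambda>s. snd l (cinv k (?g s))) has_derivative (\<lambda>s. ?D (s *\<^sub>R p))) (at 0)"
      using has_mderiv_chart[OF l(1) r l(2)] t cinv_chart[OF chk y(1)] by simp
    have "((\<lambda>s. (snd l (cinv k (?g s)) - snd l y) - \<pi> (snd l (cinv k (?g s)) - snd l y)) has_derivative
        (\<lambda>s. ?D (s *\<^sub>R p) - \<pi> (?D (s *\<^sub>R p)))) (at 0)"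
    proof -
      have e: "((\<lambda>s. snd l (cinv k (?g s)) - snd l y) has_derivative (\<lambda>s. ?D (s *\<^sub>R p))) (at 0)"
        using has_derivative_diff[OF d has_derivative_const] by simp
      have "bounded_linear \<pi>" using \<pi>(1) by (simp add: linear_conv_bounded_linear)
      from has_derivative_diff[OF e bounded_linear.has_derivative[OF this e]] show ?thesis .
    qed
    moreover have "\<forall>\<^sub>F s in nhds 0. (snd l (cinv k (?g s)) - snd l y) - \<pi> (snd l (cinv k (?g s)) - snd l y) = 0"
    proof -
      have "\<forall>\<^sub>F u in nhds (?g 0). u \<in> snd k ` fst k \<and> cinv k u \<in> fst l \<inter> fst k"
        using eventually_chart[OF chk y(1) chart_openin[OF chl] l(2)] by simp
      from eventually_nhds_compose[OF dg this] show ?thesis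
      proof eventually_elim
        case (elim s)
        let ?z = "cinv k (?g s)"
        have "snd k ?z = ?g s" using chart_cinv[OF chk] elim by blast
        then have "snd k ?z - snd k x = (snd k y - snd k x) + s *\<^sub>R p" by simp
        moreover have "snd k y - snd k x \<in> fmodel F" using flat y by blast
        ultimately have "snd k ?z - snd k x \<in> fmodel F"
          using subspace_add[OF fm_subspace _ subspace_scale[OF fm_subspace p]] by metis
        then have "?z \<in> plaque F c x" using flat elim by blast
        then have "?z \<in> plaque F c y" using plaque_eq[OF y(2)] by simp
        then have "snd l ?z - snd l y \<in> fmodel F" using l(3) elim by blast
        then show ?case using \<pi>(2) by blast
      qed
    qed
    ultimately have "((\<lambda>s::real. 0) has_derivative (\<lambda>s. ?D (s *\<^sub>R p) - \<pi> (?D (s *\<^sub>R p)))) (at 0)"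
      by (rule has_derivative_transform_nhds[rotated])
    then have "(\<lambda>s. ?D (s *\<^sub>R p) - \<pi> (?D (s *\<^sub>R p))) = (\<lambda>s. 0)"
      using has_derivative_unique has_derivative_const by blast
    then have "?D (1 *\<^sub>R p) - \<pi> (?D (1 *\<^sub>R p)) = 0" by metis
    then show ?thesis using \<pi>(2) by simp
  qed
  \<comment> \<open>An injective linear map that takes a finite-dimensional subspace into itself
    maps it onto itself.\<close>
  have "?D ` fmodel F = fmodel F"
  proof (rule subspace_dim_equal[OF linear_subspace_image[OF linD fm_subspace] fm_subspace])
    show "?D ` fmodel F \<subseteq> fmodel F" using sub by blast
    show "dim (fmodel F) \<le> dim (?D ` fmodel F)"
      using dim_image_eq[OF linD inj_on_subset[OF injD subset_UNIV], of "fmodel F"] by simp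
  qed
  then have "mderiv M (snd l) y ` cvec M k y ` fmodel F = mderiv M (snd l) y ` E y"
    using l(4) by (simp add: image_image)
  moreover have "inj (mderiv M (snd l) y)" by (rule injI) (metis inv1)
  ultimately show ?thesis by (simp add: inj_image_eq_iff)
qed

lemma dz_image_subspace:
  assumes "c \<in> T" "y \<in> fst c" shows "vec.subspace (dz M c y ` E y)"
proof (rule vec_subspaceI)
  show "subspace (dz M c y ` E y)"
    by (rule linear_subspace_image[OF linear_dz[OF assms] E_subspace[OF T_topspace[OF assms]]])
  show "\<i> *s v \<in> dz M c y ` E y" if v: "v \<in> dz M c y ` E y" for v
  proof -
    obtain u where "u \<in> E y" "v = dz M c y u" using v by blast
    then show ?thesis using E_rot[OF assms, of u] by (metis imageI)
  qed
qed

text \<open>A flat chart maps \<open>E y\<close> isomorphically onto \<open>fmodel F\<close>, so the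
  real dimension is the same at all points; this fixes the complex dimension as well.\<close>

lemma dim_dz_image:
  assumes c: "c \<in> T" "y \<in> fst c" shows "dim (dz M c y ` E y) = dim (fmodel F)"
proof -
  have t: "y \<in> topspace (mtop M)" using T_topspace[OF c] .
  obtain d where d: "d \<in> fatlas F" "y \<in> fst d" using fatlas_cover[OF t] by blast
  obtain k where k: "Cr_chart r M k" "y \<in> fst k" "mderiv M (snd k) y ` E y = fmodel F"
    by (rule flat_chart[OF d])
  have sp: "span (E y) = E y" using E_subspace[OF t] by (simp add: span_eq_iff)
  have "inj (mderiv M (snd k) y)" by (rule injI) (metis cvec_mderiv[OF k(1) r k(2)])
  then have "dim (fmodel F) = dim (E y)"
    using dim_image_eq[OF linear_mderiv_chart[OF k(1) r k(2)] inj_on_subset[OF _ subset_UNIV], of "E y"] k(3) by simp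
  moreover have "dim (dz M c y ` E y) = dim (E y)"
    by (rule dim_image_eq[OF linear_dz[OF c]]) (unfold sp, rule dz_inj_on[OF c])
  ultimately show ?thesis by simp
qed

lemma leaf_dimension:
  obtains J :: "'q set" where "\<And>c y. c \<in> T \<Longrightarrow> y \<in> fst c \<Longrightarrow> vec.dim (dz M c y ` E y) = card J"
proof (cases "\<exists>c\<in>T. fst c \<noteq> {}")
  case True
  then obtain c0 y0 where c0: "c0 \<in> T" "y0 \<in> fst c0" by blast
  obtain J :: "'q set" where J: "card J = vec.dim (dz M c0 y0 ` E y0)"
    using obtain_subset_with_card_n[OF dim_subset_UNIV_cart_gen[of "dz M c0 y0 ` E y0"]] by metis
  show thesis
  proof (rule that[of J])
    fix c y assume c: "c \<in> T" "y \<in> fst c"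
    show "vec.dim (dz M c y ` E y) = card J"
      unfolding J by (rule real_dim_determines_complex_dim[OF dz_image_subspace[OF c] dz_image_subspace[OF c0]])
        (simp add: dim_dz_image[OF c] dim_dz_image[OF c0])
  qed
next
  \<comment> \<open>There are no points to test, so the condition on \<open>J\<close> is
    vacuous.\<close>
  case False
  show thesis by (rule that[of "{}"]) (use False in blast)
qed

text \<open>Leaf charts are singled out by properties instead of a construction, and
  \<open>x\<close> enters only through its leaf; all of them together will be the atlas of the leaf.
  Complex linearity of the inclusion is stated by \<open>dz\<close> in all charts of
  \<open>T\<close>, the relation by which \<open>induced_I\<close> is defined.\<close>

definition leaf_chart :: "'q set \<Rightarrow> 'a \<Rightarrow> ('a, complex^'q) chart \<Rightarrow> bool" where
  "leaf_chart J x \<beta> \<longleftrightarrow> is_chart (leaf_topology M F (leaf F x)) (cspace J) \<beta> \<and>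
     (\<forall>d\<in>atl M. C_on r (cproj J -` (snd \<beta> ` (fst \<beta> \<inter> fst d))) (snd d \<circ> cinv \<beta> \<circ> cproj J)) \<and>
     (\<forall>y\<in>fst \<beta>. inj_on (incl_deriv M J \<beta> y) (cspace J) \<and>
        (\<forall>v\<in>cspace J. incl_deriv M J \<beta> y v \<in> E y \<and>
           (\<forall>c\<in>T. y \<in> fst c \<longrightarrow> dz M c y (incl_deriv M J \<beta> y (\<i> *s v)) = \<i> *s dz M c y (incl_deriv M J \<beta> y v))))"

lemma leaf_chart_facts:
  assumes x: "x \<in> topspace (mtop M)" and \<beta>: "leaf_chart J x \<beta>"
  shows leaf_chart_is_chart: "is_chart (leaf_topology M F (leaf F x)) (cspace J) \<beta>"
    and leaf_chart_domain: "fst \<beta> \<subseteq> leaf F x"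
    and leaf_chart_range: "y \<in> fst \<beta> \<Longrightarrow> snd \<beta> y \<in> cspace J"
    and leaf_chart_open: "openin (leaf_topology M F (leaf F x)) U \<Longrightarrow> U \<subseteq> fst \<beta> \<Longrightarrow> open (cproj J -` (snd \<beta> ` U))"
proof -
  interpret A: a_leaf M F x by unfold_locales (rule x)
  show ch: "is_chart (leaf_topology M F (leaf F x)) (cspace J) \<beta>" using \<beta> by (simp add: leaf_chart_def)
  show "fst \<beta> \<subseteq> leaf F x" using chart_subset[OF ch] A.topspace_leaf by simp
  have o: "openin (top_of_set (cspace J)) (snd \<beta> ` fst \<beta>)" using ch by (simp add: is_chart_def)
  show "snd \<beta> y \<in> cspace J" if "y \<in> fst \<beta>" using openin_subset[OF o] that by auto
  show "open (cproj J -` (snd \<beta> ` U))" if "openin (leaf_topology M F (leaf F x)) U" "U \<subseteq> fst \<beta>"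
    by (rule open_cproj_vimage) (rule openin_trans[OF openin_chart_image[OF ch that] o])
qed

lemma leaf_chart_has_pderiv:
  assumes x: "x \<in> topspace (mtop M)" and \<beta>: "leaf_chart J x \<beta>" and y: "y \<in> fst \<beta>"
  shows "has_pderiv M (\<lambda>z. cinv \<beta> (cproj J z)) (incl_deriv M J \<beta> y) (snd \<beta> y)"
proof -
  interpret A: a_leaf M F x by unfold_locales (rule x)
  note ch = leaf_chart_is_chart[OF x \<beta>]
  have yL: "y \<in> leaf F x" using leaf_chart_domain[OF x \<beta>] y by blast
  have t: "y \<in> topspace (mtop M)" using A.L_topspace[OF yL] .
  let ?d = "chart_at M y"
  let ?O = "cproj J -` (snd \<beta> ` (fst \<beta> \<inter> fst ?d))"
  have d: "?d \<in> atl M" "y \<in> fst ?d" using chart_at_atl[OF t] chart_at_mem[OF t] by auto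
  have "openin (leaf_topology M F (leaf F x)) (fst ?d \<inter> leaf F x)"
    by (rule A.openin_leaf_Int[OF chart_openin[OF atl_is_chart[OF d(1)]]])
  then have "openin (leaf_topology M F (leaf F x)) (fst \<beta> \<inter> (fst ?d \<inter> leaf F x))"
    by (rule openin_Int[OF chart_openin[OF ch]])
  moreover have "fst \<beta> \<inter> (fst ?d \<inter> leaf F x) = fst \<beta> \<inter> fst ?d" using leaf_chart_domain[OF x \<beta>] by blast
  ultimately have o: "open ?O" using leaf_chart_open[OF x \<beta>] by simp
  have p: "cproj J (snd \<beta> y) = snd \<beta> y" using cproj_id[OF leaf_chart_range[OF x \<beta> y]] .
  have mem: "snd \<beta> y \<in> ?O" using p y d(2) by auto
  have C: "C_on r ?O (snd ?d \<circ> cinv \<beta> \<circ> cproj J)" using \<beta> d(1) by (simp add: leaf_chart_def)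
  have [simp]: "cinv \<beta> (snd \<beta> y) = y" using cinv_chart[OF ch y] .
  have "((snd ?d \<circ> cinv \<beta> \<circ> cproj J) has_derivative incl_deriv M J \<beta> y) (at (snd \<beta> y))"
    using C_on_has_derivative[OF C r mem] by (simp only: incl_deriv_def)
  moreover have "\<forall>\<^sub>F z in nhds (snd \<beta> y). z \<in> ?O" by (rule eventually_nhds_in_open[OF o mem])
  then have "\<forall>\<^sub>F z in nhds (snd \<beta> y). cinv \<beta> (cproj J z) \<in> fst ?d"
    by eventually_elim (use cinv_chart[OF ch] in auto)
  ultimately show ?thesis unfolding has_pderiv_def p by (simp add: o_def)
qed

lemma leaf_flow:
  assumes "x \<in> topspace (mtop M)"
  shows "\<phi> t ` leaf F x = leaf F (\<phi> t x)"
  using flow_inv assms by (simp add: flow_invariant_def)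

lemma leaf_flow_continuous:
  assumes "x \<in> topspace (mtop M)"
  shows "continuous_map (leaf_topology M F (leaf F x)) (leaf_topology M F (leaf F (\<phi> t x))) (\<phi> t)"
  by (rule leaf_continuous_map[OF assms flow_topspace[OF assms] flow_continuous_map])
     (simp add: leaf_flow[OF assms])

text \<open>In leaf charts, \<open>\<phi>\<^sup>t\<close> is differentiable because the second inclusion is an immersion; its
  derivative is complex linear because \<open>d\<phi>\<^sup>t\<close> and both inclusions are complex linear transversally.\<close>

lemma leaf_flow_holo:
  assumes x: "x \<in> topspace (mtop M)" and \<beta>: "leaf_chart J x \<beta>" and \<gamma>: "leaf_chart J (\<phi> t x) \<gamma>"
  shows "holo_on (cproj J -` (snd \<beta> ` {y \<in> fst \<beta>. \<phi> t y \<in> fst \<gamma>})) (snd \<gamma> \<circ> \<phi> t \<circ> cinv \<beta> \<circ> cproj J)"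
    (is "holo_on ?O ?h") and "open (cproj J -` (snd \<beta> ` {y \<in> fst \<beta>. \<phi> t y \<in> fst \<gamma>}))"
proof -
  have x': "\<phi> t x \<in> topspace (mtop M)" using x by simp
  interpret A: a_leaf M F x by unfold_locales (rule x)
  let ?Y = "leaf_topology M F (leaf F x)" and ?Y' = "leaf_topology M F (leaf F (\<phi> t x))"
  let ?S = "{y \<in> fst \<beta>. \<phi> t y \<in> fst \<gamma>}"
  note chb = leaf_chart_is_chart[OF x \<beta>] and chg = leaf_chart_is_chart[OF x' \<gamma>]
  have "openin ?Y {y \<in> topspace ?Y. \<phi> t y \<in> fst \<gamma>}"
    by (rule openin_continuous_map_preimage[OF leaf_flow_continuous[OF x] chart_openin[OF chg]])
  then have "openin ?Y (fst \<beta> \<inter> {y \<in> topspace ?Y. \<phi> t y \<in> fst \<gamma>})"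
    by (rule openin_Int[OF chart_openin[OF chb]])
  moreover have "fst \<beta> \<inter> {y \<in> topspace ?Y. \<phi> t y \<in> fst \<gamma>} = ?S" using chart_subset[OF chb] by blast
  ultimately have S: "openin ?Y ?S" by simp
  show oO: "open ?O" by (rule leaf_chart_open[OF x \<beta> S]) blast
  have O: "cinv \<beta> (cproj J z) \<in> fst \<beta>" "\<phi> t (cinv \<beta> (cproj J z)) \<in> fst \<gamma>"
    "snd \<beta> (cinv \<beta> (cproj J z)) = cproj J z" if z: "z \<in> ?O" for z
  proof -
    obtain y where y: "y \<in> ?S" "cproj J z = snd \<beta> y" using z by blast
    then have "cinv \<beta> (cproj J z) = y" using cinv_chart[OF chb] by simp
    then show "cinv \<beta> (cproj J z) \<in> fst \<beta>" "\<phi> t (cinv \<beta> (cproj J z)) \<in> fst \<gamma>"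
      "snd \<beta> (cinv \<beta> (cproj J z)) = cproj J z" using y by auto
  qed
  have hS: "?h ` ?O \<subseteq> cspace J" using leaf_chart_range[OF x' \<gamma>] O(2) by auto
  have cont: "continuous_on ?O ?h"
  proof -
    have "continuous_map (top_of_set ?O) (top_of_set (snd \<beta> ` fst \<beta>)) (cproj J)"
      by (auto simp: continuous_map_in_subtopology continuous_on_cproj)
    from continuous_map_compose[OF this continuous_map_cinv[OF chb]]
    have "continuous_map (top_of_set ?O) ?Y (\<lambda>z. cinv \<beta> (cproj J z))" by (simp add: o_def)
    from continuous_map_compose[OF this leaf_flow_continuous[OF x]]
    have "continuous_map (top_of_set ?O) ?Y' (\<lambda>z. \<phi> t (cinv \<beta> (cproj J z)))" by (simp add: o_def)
    then have "continuous_map (top_of_set ?O) (subtopology ?Y' (fst \<gamma>)) (\<lambda>z. \<phi> t (cinv \<beta> (cproj J z)))"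
      using O(2) by (auto simp: continuous_map_in_subtopology)
    from continuous_map_compose[OF this continuous_map_chart[OF chg]]
    show ?thesis by (simp add: o_def)
  qed
  show "holo_on ?O ?h"
    unfolding holo_on_def
  proof
    fix z assume z: "z \<in> ?O"
    define y where "y = cinv \<beta> (cproj J z)"
    have y: "y \<in> fst \<beta>" "\<phi> t y \<in> fst \<gamma>" "snd \<beta> y = cproj J z" using O[OF z] by (simp_all add: y_def)
    have hz: "?h z = snd \<gamma> (\<phi> t y)" by (simp add: y_def)
    let ?F' = "incl_deriv M J \<beta> y" and ?G' = "incl_deriv M J \<gamma> (\<phi> t y)"
    have ty: "y \<in> topspace (mtop M)" using A.L_topspace leaf_chart_domain[OF x \<beta>] y(1) by blast
    have G: "has_pderiv M (\<lambda>w. cinv \<gamma> (cproj J w)) ?G' (?h z)"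
      unfolding hz by (rule leaf_chart_has_pderiv[OF x' \<gamma> y(2)])
    \<comment> \<open>The differential is known at \<open>cproj J z\<close>, whereas
      \<open>z\<close> need not lie in \<open>cspace J\<close>. As \<open>cproj J\<close> is
      idempotent, composing with it moves the base point without changing the map.\<close>
    have "has_pderiv M (\<lambda>w. cinv \<beta> (cproj J w)) ?F' (cproj J z)"
      using leaf_chart_has_pderiv[OF x \<beta> y(1)] y(3) by simp
    moreover have "(cproj J has_derivative cproj J) (at z)"
      by (rule bounded_linear_imp_has_derivative) (simp add: linear_cproj linear_conv_bounded_linear[symmetric])
    ultimately have "has_pderiv M (\<lambda>w. cinv \<beta> (cproj J (cproj J w))) (\<lambda>v. ?F' (cproj J v)) z"
      by (rule has_pderiv_compose)
    then have "has_pderiv M (\<lambda>w. cinv \<beta> (cproj J w)) (\<lambda>v. ?F' (cproj J v)) z"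
      by (simp add: cproj_id)
    from has_pderiv_flow[OF this, of t]
    have K: "has_pderiv M (\<lambda>w. \<phi> t (cinv \<beta> (cproj J w))) (\<lambda>v. tmap M (\<phi> t) y (?F' (cproj J v))) z"
      using ty by (simp add: y_def)
    have Gh: "cinv \<gamma> (cproj J (?h w)) = \<phi> t (cinv \<beta> (cproj J w))" if w: "w \<in> ?O" for w
    proof -
      have "?h w \<in> cspace J" using hS w by blast
      then show ?thesis using cproj_id cinv_chart[OF chg O(2)[OF w]] by (simp add: cproj_id)
    qed
    let ?c0 = "chart_at M (\<phi> t y)"
    have Gc: "((\<lambda>w. snd ?c0 (cinv \<gamma> (cproj J w))) has_derivative ?G') (at (?h z))"
      using G Gh[OF z] unfolding has_pderiv_def by (simp add: y_def o_def)
    have Kc: "((\<lambda>w. snd ?c0 (\<phi> t (cinv \<beta> (cproj J w)))) has_derivative (\<lambda>v. tmap M (\<phi> t) y (?F' (cproj J v)))) (at z)"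
      using K unfolding has_pderiv_def by (simp add: y_def o_def)
    have injG: "inj_on ?G' (cspace J)" using \<gamma> y(2) by (simp add: leaf_chart_def)
    obtain D where D: "(?h has_derivative D) (at z)" "\<And>v. D v \<in> cspace J"
      "\<And>v. ?G' (D v) = tmap M (\<phi> t) y (?F' (cproj J v))"
      by (rule has_derivative_through_immersion[OF Gc cspace_subspace injG oO z hS cont Kc])
         (simp only: Gh, rule that)
    obtain c where c: "c \<in> T" "y \<in> fst c" using T_cover[OF ty] by blast
    obtain d where d: "d \<in> T" "\<phi> t y \<in> fst d" using T_cover[OF flow_topspace[OF ty]] by blast
    \<comment> \<open>\<open>?G'\<close> is injective on \<open>cspace J\<close> and
      \<open>dz\<close> on \<open>E\<close>, so the equality can be tested after applying both;
      there it becomes complex linearity of the tangent map of the flow.\<close>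
    have "D (\<i> *s v) = \<i> *s D v" for v
    proof -
      have Gprop: "?G' w \<in> E (\<phi> t y) \<and> dz M d (\<phi> t y) (?G' (\<i> *s w)) = \<i> *s dz M d (\<phi> t y) (?G' w)" if "w \<in> cspace J" for w
        using \<gamma> y(2) that d unfolding leaf_chart_def by blast
      have Fprop: "dz M c y (?F' (\<i> *s w)) = \<i> *s dz M c y (?F' w)" if "w \<in> cspace J" for w
        using \<beta> y(1) that c unfolding leaf_chart_def by blast
      have "dz M c y (?F' (cproj J (\<i> *s v))) = \<i> *s dz M c y (?F' (cproj J v))"
        using Fprop[of "cproj J v"] clinearD[OF clinear_cproj, of J \<i> v] by simp
      from dz_flow_ii[OF c(1) d(1) c(2) d(2) this]
      have "dz M d (\<phi> t y) (?G' (D (\<i> *s v))) = dz M d (\<phi> t y) (?G' (\<i> *s D v))"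
        using D(3) Gprop[OF D(2)] by simp
      then have "?G' (D (\<i> *s v)) = ?G' (\<i> *s D v)"
        using inj_onD[OF dz_inj_on[OF d]] Gprop[OF D(2)] Gprop[OF cspace_ii[OF D(2)]] by blast
      then show ?thesis using inj_onD[OF injG] D(2) cspace_ii[OF D(2)] by blast
    qed
    from clinearI[OF has_derivative_linear[OF D(1)] this]
    show "\<exists>D. (?h has_derivative D) (at z) \<and> (\<forall>a v. D (a *s v) = a *s D v)"
      using D(1) unfolding clinear_def by blast
  qed
qed

end

section \<open>Construction of leaf charts and the complex structure of the leaves\<close>

context holo_foliation
begin

text \<open>The transverse coordinate \<open>z\<close> of a chart of the flow, followed by a complex linear map that sends
  \<open>dz (E y)\<close> onto \<open>\<complex>\<^sup>J\<close>, is a local chart of the leaf. To invert it on the plaque, it is extended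
  to a local diffeomorphism \<open>f\<close> of the model space that preserves the slices parallel to \<open>fmodel F\<close>.\<close>

lemma leaf_chart_exists:
  assumes J: "\<And>c y. c \<in> T \<Longrightarrow> y \<in> fst c \<Longrightarrow> vec.dim (dz M c y ` E y) = card J"
    and x: "x \<in> topspace (mtop M)" and y: "y \<in> leaf F x"
  shows "\<exists>\<beta>. leaf_chart J x \<beta> \<and> y \<in> fst \<beta>"
proof -
  interpret L: a_leaf M F x by unfold_locales (rule x)
  let ?fm = "fmodel F" and ?Y = "leaf_topology M F (leaf F x)"
  have ty: "y \<in> topspace (mtop M)" using L.L_topspace[OF y] .
  obtain c where c: "c \<in> fatlas F" "y \<in> fst c" using fatlas_cover[OF ty] by blast
  obtain k where k: "Cr_chart r M k" and yk: "y \<in> fst k"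
    and flat: "fst k \<inter> plaque F c y = {z \<in> fst k. snd k z - snd k y \<in> ?fm}"
    by (rule flat_chart[OF c])
  note tangent = flat_chart_tangent[OF c k flat]
  obtain e where e: "e \<in> T" "y \<in> fst e" using T_cover[OF ty] by blast
  have er: "Cr_chart r M e" using T_Cr_chart[OF e(1)] .
  note chk = Cr_chart_is_chart[OF k] and che = T_is_chart[OF e(1)]
  define u0 where "u0 = snd k y"
  let ?U = "snd k ` (fst k \<inter> fst e)"
  define Z where "Z u = snd (snd e (cinv k u))" for u
  have oU: "open ?U"
    by (rule open_chart_image[OF chk openin_Int[OF chart_openin[OF chk] chart_openin[OF che]]]) blast
  have u0: "u0 \<in> ?U" using yk e(2) by (auto simp: u0_def)
  have CZ: "C_on r ?U Z"
    unfolding Z_def by (rule C_on_linear_compose[OF oU linear_snd Cr_chart_transition[OF k er]])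
  have dZ: "(Z has_derivative (\<lambda>p. dz M e z (cvec M k z p))) (at (snd k z))" if z: "z \<in> fst k" "z \<in> fst e" for z
  proof -
    have "has_pderiv M (cinv k) (cvec M k z) (snd k z)" by (rule has_pderiv_cinv[OF k r z(1)])
    from has_derivative_chain[OF this, of "\<lambda>y. snd (snd e y)"] show ?thesis
      using has_mderiv_dz[OF e(1) z(2)] T_topspace[OF e(1) z(2)] cinv_chart[OF chk z(1)] by (simp add: Z_def[abs_def])
  qed
  obtain A where A: "linear A" "clinear A" "range A \<subseteq> cspace J" "inj_on A (dz M e y ` E y)" "A ` dz M e y ` E y = cspace J"
    by (rule straighten_complex_subspace[OF dz_image_subspace[OF e] J[OF e]])
  \<comment> \<open>The differential at \<open>y\<close> of the future leaf chart, read in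
    \<open>k\<close>; it maps \<open>fmodel F\<close> isomorphically onto \<open>cspace J\<close>,
    and \<open>B\<close> inverts it there.\<close>
  define S where "S p = A (dz M e y (cvec M k y p))" for p
  have Ey: "cvec M k y ` ?fm = E y" by (rule tangent[OF yk plaque_self[OF c(2)]])
  have linS: "linear S"
    unfolding S_def using linear_compose[OF linear_compose[OF linear_cvec[OF k r yk] linear_dz[OF e]] A(1)] by (simp add: o_def)
  have injk: "cvec M k z p = cvec M k z p' \<Longrightarrow> p = p'" if "z \<in> fst k" for z p p'
    using mderiv_cvec[OF k r that] by metis
  have injS: "inj_on S ?fm"
  proof (rule inj_onI)
    fix p p' assume p: "p \<in> ?fm" "p' \<in> ?fm" "S p = S p'"
    then have m: "cvec M k y p \<in> E y" "cvec M k y p' \<in> E y" using Ey by blast+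
    have "dz M e y (cvec M k y p) = dz M e y (cvec M k y p')"
      using inj_onD[OF A(4)] p(3) m unfolding S_def by blast
    then have "cvec M k y p = cvec M k y p'" using inj_onD[OF dz_inj_on[OF e]] m by blast
    then show "p = p'" by (rule injk[OF yk])
  qed
  have imS: "S ` ?fm = cspace J"
    using A(5) unfolding Ey[symmetric] S_def by (simp add: image_image)
  obtain B where B: "range B \<subseteq> ?fm" "linear B" "\<forall>p\<in>?fm. B (S p) = p"
    using linear_exists_left_inverse_on[OF linS fm_subspace injS] by blast
  have Bfm: "B w \<in> ?fm" for w using B(1) by blast
  have SB: "S (B w) = w" if "w \<in> cspace J" for w
    using that imS B(3) by (metis imageE)
  obtain \<pi> where \<pi>: "linear \<pi>" "range \<pi> \<subseteq> ?fm" "\<And>v. v \<in> ?fm \<Longrightarrow> \<pi> v = v" "\<And>v. v - \<pi> v = 0 \<longleftrightarrow> v \<in> ?fm"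
    by (rule subspace_projection[OF fm_subspace]) (rule that)
  have \<pi>fm: "\<pi> v \<in> ?fm" for v using \<pi>(2) by blast
  define N where "N v = v - \<pi> v" for v
  have linN: "linear N" unfolding N_def by (rule linear_compose_sub[OF linear_ident \<pi>(1)])
  have N0: "N v = 0 \<longleftrightarrow> v \<in> ?fm" for v unfolding N_def by (rule \<pi>(4))
  have NN: "N (N v) = N v" for v
    using linear_diff[OF linN, of v "\<pi> v"] N0[of "\<pi> v"] \<pi>fm by (simp add: N_def)
  have Nfm: "N v \<in> ?fm \<Longrightarrow> v \<in> ?fm" for v using NN[of v] N0 by metis
  have Neq: "N v = N w \<longleftrightarrow> v - w \<in> ?fm" for v w
    using linear_diff[OF linN, of v w] N0[of "v - w"] by simp
  \<comment> \<open>Along the slices \<open>f\<close> records the complex coordinate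
    \<open>A (Z u)\<close>, brought back into \<open>fmodel F\<close> by \<open>B\<close>;
    transversally it records \<open>N u\<close>. So it preserves slices, and its differential at
    \<open>u0\<close> is injective because \<open>B \<circ> S\<close> is the identity on
    \<open>fmodel F\<close>.\<close>
  define f where "f u = B (A (Z u)) + N u" for u
  have Cf: "C_on r ?U f"
    unfolding f_def
    by (rule C_on_add[OF oU C_on_linear_compose[OF oU B(2) C_on_linear_compose[OF oU A(1) CZ]] C_on_linear[OF linN]])
  have df: "frechet_derivative f (at (snd k z)) p = B (A (dz M e z (cvec M k z p))) + N p"
    if z: "z \<in> fst k" "z \<in> fst e" for z p
  proof -
    have bl: "bounded_linear A" "bounded_linear B" "bounded_linear N"
      using A(1) B(2) linN by (simp_all add: linear_conv_bounded_linear)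
    have "(f has_derivative (\<lambda>p. B (A (dz M e z (cvec M k z p))) + N p)) (at (snd k z))"
      unfolding f_def
      by (rule has_derivative_add[OF bounded_linear.has_derivative[OF bl(2) bounded_linear.has_derivative[OF bl(1) dZ[OF z]]]
            bounded_linear_imp_has_derivative[OF bl(3)]])
    from frechet_derivative_at[OF this] show ?thesis by metis
  qed
  have inj_df: "inj (frechet_derivative f (at u0))"
  proof -
    have "linear (frechet_derivative f (at u0))"
      using C_on_has_derivative[OF Cf r u0] has_derivative_linear by blast
    moreover have "p = 0" if p: "frechet_derivative f (at u0) p = 0" for p
    proof -
      have eq: "B (S p) + N p = 0" using p df[OF yk e(2)] by (simp add: u0_def S_def)
      then have "N p = - B (S p)" by (simp add: eq_neg_iff_add_eq_0 add.commute)
      then have "N p \<in> ?fm" using subspace_neg[OF fm_subspace Bfm] by metis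
      then have pf: "p \<in> ?fm" by (rule Nfm)
      then have "N p = 0" "B (S p) = p" using N0 B(3) by blast+
      then show "p = 0" using eq by simp
    qed
    ultimately show ?thesis by (simp add: linear_injective_0)
  qed
  obtain U V g where UV: "open U" "U \<subseteq> ?U" "u0 \<in> U" "open V" "homeomorphism U V f g" "C_on r V g"
    and dg: "\<And>v. v \<in> V \<Longrightarrow> (g has_derivative frechet_derivative g (at v)) (at v)"
      "\<And>v p. v \<in> V \<Longrightarrow> frechet_derivative f (at (g v)) (frechet_derivative g (at v) p) = p"
      "\<And>v p. v \<in> V \<Longrightarrow> frechet_derivative g (at v) (frechet_derivative f (at (g v)) p) = p"
    by (rule C_on_inverse_function[OF oU r Cf u0 inj_df]) (rule that)
  have gU: "g v \<in> U" "f (g v) = v" if "v \<in> V" for v using UV(5) that unfolding homeomorphism_def by blast+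
  have fV: "f u \<in> V" "g (f u) = u" if "u \<in> U" for u using UV(5) that unfolding homeomorphism_def by blast+
  \<comment> \<open>The constant value of \<open>N\<close> on the slice through \<open>u0\<close>;
    on this slice \<open>f (snd k z)\<close> is \<open>B (b z) + \<kappa>\<close>.\<close>
  define \<kappa> where "\<kappa> = N u0"
  have N\<kappa>: "N \<kappa> = N u0" unfolding \<kappa>_def by (rule NN)
  define b where "b z = A (snd (snd e z))" for z
  \<comment> \<open>The part of the plaque of \<open>y\<close> in the domain where \<open>f\<close>
    is invertible; \<open>D\<close> with the coordinate \<open>b\<close> is the leaf chart.\<close>
  define D where "D = {z \<in> fst k. snd k z \<in> U \<and> snd k z - u0 \<in> ?fm}"
  have Dk: "D \<subseteq> fst k" by (auto simp: D_def)
  have Dp: "z \<in> plaque F c y" if "z \<in> D" for z using that flat by (auto simp: D_def u0_def)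
  have De: "z \<in> fst e" if "z \<in> D" for z
  proof -
    have "snd k z \<in> ?U" "z \<in> fst k" using that UV(2) by (auto simp: D_def)
    then show ?thesis using inj_onD[OF chart_inj_on[OF chk]] by fastforce
  qed
  have b_cspace: "b z \<in> cspace J" for z using A(3) by (auto simp: b_def)
  have f_D: "f (snd k z) = B (b z) + \<kappa>" if z: "z \<in> D" for z
  proof -
    have "Z (snd k z) = snd (snd e z)" using cinv_chart[OF chk] z Dk by (auto simp: Z_def)
    moreover have "N (snd k z) = \<kappa>" unfolding \<kappa>_def Neq using z by (simp add: D_def)
    ultimately show ?thesis by (simp add: f_def b_def)
  qed
  have kz: "B (b z) + \<kappa> \<in> V" "g (B (b z) + \<kappa>) = snd k z" if z: "z \<in> D" for z
    using fV[of "snd k z"] f_D[OF z] z by (auto simp: D_def)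
  \<comment> \<open>The candidate inverse lands on the slice of \<open>u0\<close> because
    \<open>f\<close> preserves the \<open>N\<close>-component; and \<open>w\<close> is recovered
    from \<open>B w\<close> by \<open>S\<close>.\<close>
  have b_inv: "cinv k (g (B w + \<kappa>)) \<in> D" "b (cinv k (g (B w + \<kappa>))) = w" if w: "w \<in> cspace J" "B w + \<kappa> \<in> V" for w
  proof -
    define u where "u = g (B w + \<kappa>)"
    define z where "z = cinv k u"
    have uU: "u \<in> U" "f u = B w + \<kappa>" using gU[OF w(2)] by (simp_all add: u_def)
    have uk: "u \<in> snd k ` fst k" using uU(1) UV(2) by blast
    have z: "z \<in> fst k" "snd k z = u" using cinv_in[OF chk uk] chart_cinv[OF chk uk] by (simp_all add: z_def)
    have "N (f u) = N u" unfolding f_def using linear_add[OF linN] N0 Bfm NN by simp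
    moreover have "N (B w + \<kappa>) = N u0" using linear_add[OF linN] N0 Bfm N\<kappa> by simp
    ultimately have "u - u0 \<in> ?fm" using uU(2) Neq by metis
    then have zD: "z \<in> D" using z uU(1) by (simp add: D_def)
    have "B (b z) = B w" using f_D[OF zD] uU(2) z(2) by simp
    then have "b z = w" using SB[OF b_cspace] SB[OF w(1)] by metis
    with zD show "cinv k (g (B w + \<kappa>)) \<in> D" "b (cinv k (g (B w + \<kappa>))) = w" by (simp_all add: z_def u_def)
  qed
  have b_range: "b ` D = {w \<in> cspace J. B w + \<kappa> \<in> V}"
  proof
    show "b ` D \<subseteq> {w \<in> cspace J. B w + \<kappa> \<in> V}" using b_cspace kz(1) by blast
    show "{w \<in> cspace J. B w + \<kappa> \<in> V} \<subseteq> b ` D"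
    proof
      fix w assume "w \<in> {w \<in> cspace J. B w + \<kappa> \<in> V}"
      then show "w \<in> b ` D" using imageI[OF b_inv(1), of w b] b_inv(2)[of w] by simp
    qed
  qed
  have b_left: "cinv k (g (B (b z) + \<kappa>)) = z" if z: "z \<in> D" for z
    using kz(2)[OF z] cinv_chart[OF chk] z Dk by auto
  let ?\<beta> = "(D, b)"
  have b_inj: "inj_on b D" by (rule inj_onI) (metis b_left)
  have cinv_b: "cinv ?\<beta> w = cinv k (g (B w + \<kappa>))" if w: "w \<in> b ` D" for w
  proof -
    obtain z where z: "z \<in> D" "w = b z" using w by blast
    have "cinv ?\<beta> w = z" unfolding cinv_def using inv_into_f_f[OF b_inj z(1)] z(2) by simp
    then show ?thesis using b_left[OF z(1)] z(2) by simp
  qed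
  have DL: "D \<subseteq> leaf F x" using Dp leaf_step[OF y c] by blast
  have sub: "subtopology ?Y D = subtopology (mtop M) D"
    by (rule L.subtopology_plaque[OF c y]) (use Dp in blast)
  have oD: "openin ?Y D"
  proof -
    have "openin ?Y (plaque F c y \<inter> {z \<in> fst k. snd k z \<in> U})"
      by (rule L.openin_leaf_plaque[OF c y openin_chart_preimage[OF chk UV(1)]])
    moreover have "plaque F c y \<inter> {z \<in> fst k. snd k z \<in> U} = D" using flat by (auto simp: D_def u0_def)
    ultimately show ?thesis by simp
  qed
  have contB: "continuous_on S' (\<lambda>w. B w + \<kappa>)" for S'
    using B(2) by (intro continuous_on_add continuous_on_const linear_continuous_on) (simp add: linear_conv_bounded_linear)
  \<comment> \<open>Continuity in both directions is checked in the topology of \<open>M\<close>,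
    which on \<open>D\<close> agrees with that of the leaf.\<close>
  have chart: "is_chart ?Y (cspace J) ?\<beta>"
    unfolding is_chart_def fst_conv snd_conv
  proof (intro conjI oD)
    have "open ((\<lambda>w. B w + \<kappa>) -` V)"
      by (rule open_vimage[OF UV(4) contB])
    moreover have "b ` D = cspace J \<inter> (\<lambda>w. B w + \<kappa>) -` V" unfolding b_range by auto
    ultimately show "openin (top_of_set (cspace J)) (b ` D)" by (auto simp: openin_open)
    have "continuous_map (subtopology (mtop M) D) (subtopology (mtop M) (fst e)) id"
      using De by (auto simp: continuous_map_in_subtopology continuous_map_from_subtopology)
    from continuous_map_compose[OF this continuous_map_chart[OF che]]
    have 1: "continuous_map (subtopology (mtop M) D) euclidean (snd e)" by (simp add: o_def)
    have "bounded_linear (\<lambda>w :: real \<times> (complex^'q). A (snd w))"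
      using A(1) unfolding linear_conv_bounded_linear by (rule bounded_linear_compose[OF _ bounded_linear_snd])
    from linear_continuous_on[OF this] have "continuous_map euclidean euclidean (\<lambda>w :: real \<times> (complex^'q). A (snd w))" by simp
    from continuous_map_compose[OF 1 this]
    have cb: "continuous_map (subtopology (mtop M) D) (top_of_set (b ` D)) b"
      by (auto simp: o_def b_def[abs_def] continuous_map_in_subtopology)
    have "continuous_on (b ` D) (\<lambda>w. g (B w + \<kappa>))"
      by (rule continuous_on_compose2[OF C_on_imp_continuous[OF UV(6)] contB]) (auto simp: b_range)
    then have "continuous_map (top_of_set (b ` D)) (top_of_set (snd k ` fst k)) (\<lambda>w. g (B w + \<kappa>))"
      using gU(1) UV(2) by (auto simp: continuous_map_in_subtopology b_range)
    from continuous_map_compose[OF this continuous_map_cinv[OF chk]]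
    have ci: "continuous_map (top_of_set (b ` D)) (subtopology (mtop M) D) (\<lambda>w. cinv k (g (B w + \<kappa>)))"
      using b_left by (auto simp: o_def continuous_map_in_subtopology)
    have "homeomorphic_maps (subtopology ?Y D) (top_of_set (b ` D)) b (\<lambda>w. cinv k (g (B w + \<kappa>)))"
      unfolding sub homeomorphic_maps_def using cb ci b_left by auto
    then show "homeomorphic_map (subtopology ?Y D) (top_of_set (b ` D)) b"
      unfolding homeomorphic_map_maps by blast
  qed
  have o\<beta>: "open (cproj J -` (b ` W))" if W: "openin ?Y W" "W \<subseteq> D" for W
    using openin_trans[OF openin_chart_image[OF chart, of W]] chart W
    by (intro open_cproj_vimage) (simp add: is_chart_def)
  have oDd: "open (cproj J -` (b ` (D \<inter> fst d)))" if d: "d \<in> atl M" for d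
  proof (rule o\<beta>)
    have "openin ?Y (D \<inter> (fst d \<inter> leaf F x))"
      by (rule openin_Int[OF oD L.openin_leaf_Int[OF chart_openin[OF atl_is_chart[OF d]]]])
    moreover have "D \<inter> (fst d \<inter> leaf F x) = D \<inter> fst d" using DL by blast
    ultimately show "openin ?Y (D \<inter> fst d)" by simp
  qed blast
  have smooth: "C_on r (cproj J -` (b ` (D \<inter> fst d))) (snd d \<circ> cinv ?\<beta> \<circ> cproj J)" if d: "d \<in> atl M" for d
  proof -
    let ?O = "cproj J -` (b ` (D \<inter> fst d))" and ?W = "snd k ` (fst k \<inter> fst d)"
    let ?h = "\<lambda>w. g (B (cproj J w) + \<kappa>)"
    have oO: "open ?O" by (rule oDd[OF d])
    have oW: "open ?W"
      by (rule open_chart_image[OF chk openin_Int[OF chart_openin[OF chk] chart_openin[OF atl_is_chart[OF d]]]]) blast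
    have 1: "C_on r ?O (\<lambda>w. B (cproj J w) + \<kappa>)"
      using linear_compose[OF linear_cproj B(2)] by (intro C_on_add[OF oO C_on_linear C_on_const]) (simp add: o_def)
    have 2: "C_on r ?O ?h"
      by (rule C_on_compose[OF oO UV(4) 1 UV(6)]) (use kz(1) in auto)
    have hO: "?h ` ?O \<subseteq> ?W"
    proof
      fix u assume "u \<in> ?h ` ?O"
      then obtain w z where "u = ?h w" "z \<in> D" "z \<in> fst d" "cproj J w = b z" by auto
      then show "u \<in> ?W" using kz(2) Dk by auto
    qed
    have "C_on r ?O (\<lambda>w. snd d (cinv k (?h w)))"
      by (rule C_on_compose[OF oO oW 2 Cr_chart_transition[OF k atl_Cr_chart[OF d]] hO])
    moreover have "C_on r ?O (\<lambda>w. snd d (cinv k (?h w))) \<longleftrightarrow> C_on r ?O (snd d \<circ> cinv ?\<beta> \<circ> cproj J)"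
      by (rule C_on_cong[OF oO]) (use cinv_b in auto)
    ultimately show ?thesis by blast
  qed
  have deriv: "incl_deriv M J ?\<beta> z = (\<lambda>v. cvec M k z (frechet_derivative g (at (B (b z) + \<kappa>)) (B (cproj J v))))"
    (is "_ = ?F'") if z: "z \<in> D" for z
  proof -
    let ?w = "b z"
    have bz: "cproj J ?w = ?w" by (rule cproj_id[OF b_cspace])
    have zk: "z \<in> fst k" using Dk z by blast
    have "bounded_linear (\<lambda>v. B (cproj J v))"
      using linear_compose[OF linear_cproj B(2)] by (simp add: o_def linear_conv_bounded_linear)
    then have "((\<lambda>w. B (cproj J w) + \<kappa>) has_derivative (\<lambda>v. B (cproj J v))) (at ?w)"
      using has_derivative_add[OF bounded_linear_imp_has_derivative has_derivative_const] by simp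
    from has_derivative_compose[OF this, of g]
    have dgw: "((\<lambda>w. g (B (cproj J w) + \<kappa>)) has_derivative (\<lambda>v. frechet_derivative g (at (B ?w + \<kappa>)) (B (cproj J v)))) (at ?w)"
      using dg(1)[OF kz(1)[OF z]] bz by simp
    have "has_pderiv M (cinv k) (cvec M k z) (g (B (cproj J ?w) + \<kappa>))"
      using has_pderiv_cinv[OF k r zk] kz(2)[OF z] bz by simp
    from has_pderiv_compose[OF this dgw]
    have "has_pderiv M (\<lambda>w. cinv k (g (B (cproj J w) + \<kappa>))) ?F' ?w" .
    then have *: "((snd (chart_at M z) \<circ> (\<lambda>w. cinv k (g (B (cproj J w) + \<kappa>)))) has_derivative ?F') (at ?w)"
      unfolding has_pderiv_def using b_left[OF z] bz by simp
    have "((snd (chart_at M z) \<circ> cinv ?\<beta> \<circ> cproj J) has_derivative ?F') (at ?w)"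
    proof (rule has_derivative_cong_open[THEN iffD1, OF _ _ _ *])
      show "open (cproj J -` (b ` D))" by (rule o\<beta>[OF oD order_refl])
      show "?w \<in> cproj J -` (b ` D)" using bz z by auto
    qed (use cinv_b in auto)
    from frechet_derivative_at[OF this] show ?thesis by (simp add: incl_deriv_def)
  qed
  have props: "inj_on (incl_deriv M J ?\<beta> z) (cspace J) \<and> (\<forall>v\<in>cspace J. incl_deriv M J ?\<beta> z v \<in> E z \<and>
      (\<forall>c\<in>T. z \<in> fst c \<longrightarrow> dz M c z (incl_deriv M J ?\<beta> z (\<i> *s v)) = \<i> *s dz M c z (incl_deriv M J ?\<beta> z v)))"
    if z: "z \<in> D" for z
  proof -
    let ?F' = "incl_deriv M J ?\<beta> z"
    let ?v = "B (b z) + \<kappa>"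
    let ?Dg = "frechet_derivative g (at ?v)" and ?Df = "frechet_derivative f (at (g ?v))"
    have zk: "z \<in> fst k" and ze: "z \<in> fst e" using Dk De z by auto
    have Ez: "cvec M k z ` ?fm = E z" by (rule tangent[OF zk Dp[OF z]])
    note dgz = dg(2,3)[OF kz(1)[OF z]]
    have Dfeq: "?Df p = B (A (dz M e z (cvec M k z p))) + N p" for p
      using df[OF zk ze] kz(2)[OF z] by simp
    have F': "?F' v = cvec M k z (?Dg (B v))" if "v \<in> cspace J" for v
      using deriv[OF z] cproj_id[OF that] by simp
    have inj: "inj_on ?F' (cspace J)"
    proof (rule inj_onI)
      fix v w assume v: "v \<in> cspace J" "w \<in> cspace J" "?F' v = ?F' w"
      then have "?Dg (B v) = ?Dg (B w)" using F' injk[OF zk] by simp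
      then have "B v = B w" using dgz(1) by metis
      then show "v = w" using SB[OF v(1)] SB[OF v(2)] by metis
    qed
    \<comment> \<open>The differential of \<open>f\<close> alters only the component along the
      slice, so its inverse sends \<open>fmodel F\<close> into itself: the
      \<open>N\<close>-component of \<open>?p\<close> lies in \<open>fmodel F\<close> and therefore
      vanishes.\<close>
    have FE: "?F' v \<in> E z" if v: "v \<in> cspace J" for v
    proof -
      let ?p = "?Dg (B v)"
      have "B (A (dz M e z (cvec M k z ?p))) + N ?p = B v" using dgz(1)[of "B v"] Dfeq by simp
      then have "N ?p = B v - B (A (dz M e z (cvec M k z ?p)))" by (simp add: algebra_simps)
      then have "N ?p \<in> ?fm" using subspace_diff[OF fm_subspace Bfm Bfm] by metis
      then have "?p \<in> ?fm" by (rule Nfm)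
      then show ?thesis using F'[OF v] Ez by blast
    qed
    \<comment> \<open>\<open>A \<circ> dz\<close> is a left inverse of the differential of the inclusion.\<close>
    have key: "?F' (A (dz M e z q)) = q" if q: "q \<in> E z" for q
    proof -
      obtain p where p: "p \<in> ?fm" "q = cvec M k z p" using q Ez by blast
      have "N p = 0" using N0 p(1) by simp
      then have "?Df p = B (A (dz M e z q))" using Dfeq[of p] p(2) by simp
      then have "?Dg (B (A (dz M e z q))) = p" using dgz(2)[of p] by simp
      moreover have "A (dz M e z q) \<in> cspace J" using A(3) by blast
      ultimately show ?thesis using F' p(2) by simp
    qed
    \<comment> \<open>By invariance of \<open>E\<close>, \<open>\<i>\<close> times the
      \<open>dz\<close>-image of \<open>?F' v\<close> is the image of some \<open>q\<close> in
      \<open>E z\<close>. Applying \<open>A\<close> to it gives \<open>\<i> *s v\<close>, and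
      \<open>key\<close> identifies \<open>q\<close> as \<open>?F' (\<i> *s v)\<close>.\<close>
    have "dz M c' z (?F' (\<i> *s v)) = \<i> *s dz M c' z (?F' v)" if v: "v \<in> cspace J" and c': "c' \<in> T" "z \<in> fst c'" for v c'
    proof -
      have "A (dz M e z (?F' v)) \<in> cspace J" using A(3) by blast
      then have Av: "A (dz M e z (?F' v)) = v" using inj_onD[OF inj key[OF FE[OF v]]] v by blast
      obtain q where q: "q \<in> E z" "dz M e z q = \<i> *s dz M e z (?F' v)"
        using E_rot[OF e(1) ze FE[OF v]] by blast
      have "A (dz M e z q) = \<i> *s v" unfolding q(2) clinearD[OF A(2)] Av ..
      then have "?F' (\<i> *s v) = q" using key[OF q(1)] by simp
      then have "dz M e z (?F' (\<i> *s v)) = \<i> *s dz M e z (?F' v)" using q(2) by simp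
      then show ?thesis by (rule dz_change_ii[OF e(1) c'(1) ze c'(2)])
    qed
    with inj FE show ?thesis by blast
  qed
  have "leaf_chart J x ?\<beta>"
    unfolding leaf_chart_def using chart smooth props by (simp only: fst_conv snd_conv) blast
  moreover have "y \<in> D" using yk UV(3) subspace_0[OF fm_subspace] by (simp add: D_def u0_def)
  ultimately show ?thesis by auto
qed

theorem holomorphic_leaves: "holomorphic_leaves r M \<phi> T H F"
proof -
  obtain J :: "'q set" where J: "\<And>c y. c \<in> T \<Longrightarrow> y \<in> fst c \<Longrightarrow> vec.dim (dz M c y ` E y) = card J"
    by (rule leaf_dimension) (rule that)
  have leaf_chart_cong: "leaf_chart J x \<beta> = leaf_chart J x' \<beta>" if "leaf F x = leaf F x'" for x x' \<beta>
    using that by (simp add: leaf_chart_def)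
  \<comment> \<open>The atlas is attached to the leaf as a set, whatever point it is given through;
    the target leaf of the flow, for instance, is given through \<open>\<phi> t x\<close>.\<close>
  define B where "B L = {\<beta>. \<exists>x\<in>topspace (mtop M). L = leaf F x \<and> leaf_chart J x \<beta>}" for L
  have B: "B (leaf F x) = {\<beta>. leaf_chart J x \<beta>}" if "x \<in> topspace (mtop M)" for x
    unfolding B_def using that leaf_chart_cong by blast
  have "topspace (leaf_topology M F (leaf F x)) = leaf F x \<and>
      complex_manifold (leaf_topology M F (leaf F x)) J (B (leaf F x)) \<and>
      immersed r M (leaf_topology M F (leaf F x)) J (B (leaf F x)) \<and>
      (\<forall>c\<in>B (leaf F x). \<forall>y\<in>fst c. \<forall>v\<in>cspace J.
         incl_deriv M J c y v \<in> H y \<and>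
         incl_deriv M J c y (\<i> *s v) = induced_I M T H y (incl_deriv M J c y v))"
    if x: "x \<in> topspace (mtop M)" for x
  proof -
    interpret L: a_leaf M F x by unfold_locales (rule x)
    let ?Y = "leaf_topology M F (leaf F x)"
    have cov: "(\<Union>c\<in>B (leaf F x). fst c) = topspace ?Y"
      unfolding B[OF x] L.topspace_leaf
      using leaf_chart_exists[OF J x] leaf_chart_domain[OF x] by blast
    \<comment> \<open>A transition map is the flow at time 0, read in two charts of the same
      leaf.\<close>
    have trans: "holo_on (cproj J -` (snd c ` (fst c \<inter> fst d))) (snd d \<circ> cinv c \<circ> cproj J)"
      if c: "leaf_chart J x c" and d: "leaf_chart J x d" for c d
    proof -
      have d': "leaf_chart J (\<phi> 0 x) d" using d flow_0[OF x] by simp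
      have f0: "\<phi> 0 y = y" if "y \<in> fst c" for y
        using flow_0 L.L_topspace leaf_chart_domain[OF x c] that by blast
      have eq: "{y \<in> fst c. \<phi> 0 y \<in> fst d} = fst c \<inter> fst d" using f0 by auto
      note h = leaf_flow_holo[OF x c d', unfolded eq]
      show ?thesis
      proof (rule holo_on_cong[OF h(2) _ h(1)])
        fix z assume "z \<in> cproj J -` (snd c ` (fst c \<inter> fst d))"
        then have "cinv c (cproj J z) \<in> fst c" using cinv_in[OF leaf_chart_is_chart[OF x c]] by blast
        then show "(snd d \<circ> \<phi> 0 \<circ> cinv c \<circ> cproj J) z = (snd d \<circ> cinv c \<circ> cproj J) z" by (simp add: f0)
      qed
    qed
    have cm: "complex_manifold ?Y J (B (leaf F x))"
      unfolding complex_manifold_def using cov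
    proof (intro conjI L.Hausdorff_leaf L.second_countable_leaf L.connected_leaf)
      show "\<forall>c\<in>B (leaf F x). is_chart ?Y (cspace J) c" using B[OF x] leaf_chart_is_chart[OF x] by blast
      show "\<forall>c\<in>B (leaf F x). \<forall>d\<in>B (leaf F x).
          holo_on (cproj J -` (snd c ` (fst c \<inter> fst d))) (snd d \<circ> cinv c \<circ> cproj J)"
        using B[OF x] trans by blast
    qed
    have im: "immersed r M ?Y J (B (leaf F x))"
      unfolding immersed_def using L.leaf_id_continuous by (simp add: B[OF x] leaf_chart_def)
    have "incl_deriv M J c y v \<in> H y \<and> incl_deriv M J c y (\<i> *s v) = induced_I M T H y (incl_deriv M J c y v)"
      if c: "leaf_chart J x c" and y: "y \<in> fst c" and v: "v \<in> cspace J" for c y v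
    proof -
      have ty: "y \<in> topspace (mtop M)" using L.L_topspace leaf_chart_domain[OF x c] y by blast
      obtain e where e: "e \<in> T" "y \<in> fst e" using T_cover[OF ty] by blast
      have p: "inj_on (incl_deriv M J c y) (cspace J) \<and> (\<forall>v\<in>cspace J. incl_deriv M J c y v \<in> E y \<and>
           (\<forall>e\<in>T. y \<in> fst e \<longrightarrow> dz M e y (incl_deriv M J c y (\<i> *s v)) = \<i> *s dz M e y (incl_deriv M J c y v)))"
        using c y unfolding leaf_chart_def by blast
      have iv: "incl_deriv M J c y (\<i> *s v) \<in> H y" "incl_deriv M J c y v \<in> H y"
        using p E_H[OF ty] v cspace_ii[OF v, of \<i>] by blast+
      have "dz M e y (incl_deriv M J c y (\<i> *s v)) = \<i> *s dz M e y (incl_deriv M J c y v)" using p v e by blast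
      from induced_I_eqI[OF e iv(1) this] iv(2) show ?thesis by simp
    qed
    with L.topspace_leaf cm im show ?thesis by (simp add: B[OF x])
  qed
  moreover have "holomorphic_map J (leaf_topology M F (leaf F x)) (B (leaf F x))
      (leaf_topology M F (leaf F (\<phi> t x))) (B (leaf F (\<phi> t x))) (\<phi> t)"
    if x: "x \<in> topspace (mtop M)" for x t
    unfolding holomorphic_map_def
    using leaf_flow_continuous[OF x, of t] leaf_flow_holo(1)[OF x]
    by (simp add: B[OF x] B[OF flow_topspace[OF x]])
  ultimately show ?thesis
    unfolding holomorphic_leaves_def Let_def by (intro exI[of _ J] exI[of _ B]) blast
qed

end

section \<open>The stable, unstable, center, center-stable and center-unstable foliations\<close>

theorem proposition4p5:
  fixes M :: "('a, 'e::euclidean_space) manifold"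
    and \<phi> :: "real \<Rightarrow> 'a \<Rightarrow> 'a"
    and X :: "'a \<Rightarrow> 'e"
    and Es Ec Eu :: "'a \<Rightarrow> 'e set"
    and T :: "('a, real \<times> (complex^'q)) chart set"
    and Fs Fc Fu :: "('a, 'e) foliation"
  assumes "smooth_manifold M" and "compact_space (mtop M)"
    and "smooth_flow M \<phi>"
    and "smooth_vector_field M X" and "\<forall>x\<in>topspace (mtop M). X x \<noteq> 0" and "generates M X \<phi>"
    and "partially_hyperbolic M \<phi> X Es Ec Eu"
    and "transversely_holomorphic M \<phi> T"
    and "tangent_foliation \<infinity> M Es Fs" and "flow_invariant M \<phi> Fs"
    and "tangent_foliation \<infinity> M Eu Fu" and "flow_invariant M \<phi> Fu"
    and "tangent_foliation 1 M Ec Fc" and "flow_invariant M \<phi> Fc"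
  shows "let H = sum_bundle (sum_bundle Es Ec) Eu in
    holomorphic_leaves \<infinity> M \<phi> T H Fs \<and>
    holomorphic_leaves \<infinity> M \<phi> T H Fu \<and>
    holomorphic_leaves 1 M \<phi> T H Fc \<and>
    (\<forall>E\<in>{Es, Eu}. \<forall>F.
       tangent_foliation 1 M (sum_bundle E Ec) F \<and> flow_invariant M \<phi> F \<longrightarrow>
       holomorphic_leaves 1 M \<phi> T H F)"
proof -
  interpret ph_flow M \<phi> X T Es Ec Eu
    by unfold_locales (use assms in auto)
  have leaves: "holomorphic_leaves r M \<phi> T H F"
    if E: "\<And>y. y \<in> topspace (mtop M) \<Longrightarrow> subspace (E y)" "\<And>y. y \<in> topspace (mtop M) \<Longrightarrow> E y \<subseteq> H y"
        "\<And>c y v. c \<in> T \<Longrightarrow> y \<in> fst c \<Longrightarrow> v \<in> E y \<Longrightarrow> \<exists>w\<in>E y. dz M c y w = \<i> *s dz M c y v"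
      and F: "1 \<le> r" "tangent_foliation r M E F" "flow_invariant M \<phi> F" for E F r
  proof -
    interpret holo_foliation M \<phi> X T Es Ec Eu F E r
      by unfold_locales (use E F in \<open>auto simp: tangent_foliation_def\<close>)
    show ?thesis by (rule holomorphic_leaves)
  qed
  \<comment> \<open>Zero supplies the missing components when a bundle is placed inside
    \<open>H\<close>.\<close>
  have zero: "0 \<in> Es y" "0 \<in> Ec y" "0 \<in> Eu y" if "y \<in> topspace (mtop M)" for y
    using subspace_0[OF bundle_subspace[OF _ that]] by simp_all
  have single: "holomorphic_leaves r M \<phi> T H F"
    if E: "E \<in> {Es, Ec, Eu}" and F: "1 \<le> r" "tangent_foliation r M E F" "flow_invariant M \<phi> F" for E F r
  proof (rule leaves[OF bundle_subspace[OF E] _ splitting_invariant[OF E] F])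
    fix y assume y: "y \<in> topspace (mtop M)"
    show "E y \<subseteq> H y"
    proof
      fix v assume "v \<in> E y"
      then show "v \<in> H y" unfolding H_iff using E zero[OF y]
        by (elim insertE emptyE) (force intro: bexI[of _ 0])+
    qed
  qed
  have double: "holomorphic_leaves r M \<phi> T H F"
    if E: "E \<in> {Es, Eu}" and F: "1 \<le> r" "tangent_foliation r M (sum_bundle E Ec) F" "flow_invariant M \<phi> F" for E F r
  proof -
    have E3: "E \<in> {Es, Ec, Eu}" "Ec \<in> {Es, Ec, Eu}" using E by auto
    show ?thesis
    proof (rule leaves[OF _ _ _ F])
      fix y assume y: "y \<in> topspace (mtop M)"
      show "subspace (sum_bundle E Ec y)"
        unfolding sum_bundle_def using subspace_sums[OF bundle_subspace[OF E3(1) y] bundle_subspace[OF E3(2) y]] .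
      show "sum_bundle E Ec y \<subseteq> H y"
      proof
        fix v assume "v \<in> sum_bundle E Ec y"
        then obtain a b where ab: "a \<in> E y" "b \<in> Ec y" "v = a + b" unfolding sum_bundle_def by blast
        from E consider "E = Es" | "E = Eu" by blast
        then show "v \<in> H y"
        proof cases
          case 1
          then show ?thesis unfolding H_iff using ab zero(3)[OF y] by (intro bexI[of _ a] bexI[of _ b] bexI[of _ 0]) auto
        next
          case 2
          then show ?thesis unfolding H_iff using ab zero(1)[OF y]
            by (intro bexI[of _ 0] bexI[of _ b] bexI[of _ a]) (auto simp: add.commute)
        qed
      qed
    next
      \<comment> \<open>The summands are \<open>I\<close>-invariant and \<open>dz\<close> is
        additive, so rotating each summand rotates the sum.\<close>
      fix c y v assume c: "c \<in> T" "y \<in> fst c" and v: "v \<in> sum_bundle E Ec y"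
      then obtain a b where ab: "a \<in> E y" "b \<in> Ec y" "v = a + b" unfolding sum_bundle_def by blast
      obtain a' where a': "a' \<in> E y" "dz M c y a' = \<i> *s dz M c y a" using splitting_invariant[OF E3(1) c ab(1)] by blast
      obtain b' where b': "b' \<in> Ec y" "dz M c y b' = \<i> *s dz M c y b" using splitting_invariant[OF E3(2) c ab(2)] by blast
      have "dz M c y (a' + b') = \<i> *s dz M c y v"
        using a'(2) b'(2) by (simp add: ab(3) linear_add[OF linear_dz[OF c]] vec.scale_right_distrib)
      moreover have "a' + b' \<in> sum_bundle E Ec y" unfolding sum_bundle_def using a'(1) b'(1) by blast
      ultimately show "\<exists>w\<in>sum_bundle E Ec y. dz M c y w = \<i> *s dz M c y v" by blast
    qed
  qed
  show ?thesis
    unfolding Let_def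
  proof (intro conjI ballI allI impI)
    show "holomorphic_leaves \<infinity> M \<phi> T H Fs" by (rule single[of Es, OF _ _ assms(9,10)]) simp_all
    show "holomorphic_leaves \<infinity> M \<phi> T H Fu" by (rule single[of Eu, OF _ _ assms(11,12)]) simp_all
    show "holomorphic_leaves 1 M \<phi> T H Fc" by (rule single[of Ec, OF _ _ assms(13,14)]) simp_all
    fix E F assume "E \<in> {Es, Eu}" "tangent_foliation 1 M (sum_bundle E Ec) F \<and> flow_invariant M \<phi> F"
    then show "holomorphic_leaves 1 M \<phi> T H F" using double[of E 1 F] by simp
  qed
qed

end
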